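(* For every $\tau\in\mathbb{H}^2$ set $$f(\tau)=\frac{\eta^4(2\tau)\,\eta^8(3\tau)}{\eta^8(\tau)\,\eta^4(6\tau)} .$$ Then the inverse function $\tau=\tau(f)$ yields $m(f)=a(2\tau(f))$, and $m(f)$ satisfies the differential equation $$\frac{d^2m}{df^2}+\left\{\frac1f+\frac{1}{f-1}-\frac{2}{f+\frac13}+\frac{1}{f-\frac19}\right\}\frac{dm}{df}-\frac{2}{3f\left(f+\frac13\right)^2}\,m=0 .$$
   Context: $\mathbb{H}^2=\{\tau\in\mathbb{C}\mid \Im\tau>0\}$; $\eta(\tau)=e^{2\pi i\tau/24}\prod_{n\ge1}(1-e^{2\pi i n\tau})$ is the Dedekind eta function and $\eta^k(m\tau)=(\eta(m\tau))^k$. The cubic theta function $a$ is $a(\tau)=\sum_{m,n\in\mathbb{Z}}q^{m^2+mn+n^2}$, $q=\exp(2\pi i\tau)$. The inverse function $\tau=\tau(f)$ means any local holomorphic inverse of $\tau\mapsto f(\tau)$; the differential equation is understood where its coefficients are finite. *)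

theory Defs
  imports "HOL-Complex_Analysis.Complex_Analysis"
begin

definition upper_half_plane :: "complex set" where
  "upper_half_plane = {\<tau>. Im \<tau> > 0}"

text \<open>
  The product of the eta function starts at exponent 1, hence the shift by one below.
\<close>

definition dedekind_eta :: "complex \<Rightarrow> complex" where
  "dedekind_eta \<tau> = exp (2 * of_real pi * \<i> * \<tau> / 24) *
     (\<Prod>n. 1 - exp (2 * of_real pi * \<i> * of_nat (n + 1) * \<tau>))"

definition cubic_theta_a :: "complex \<Rightarrow> complex" where
  "cubic_theta_a \<tau> = (\<Sum>\<^sub>\<infinity>(m, n)\<in>(UNIV :: (int \<times> int) set).
     exp (2 * of_real pi * \<i> * \<tau>) powi (m\<^sup>2 + m * n + n\<^sup>2))"

text \<open>
  A local holomorphic inverse of \<open>f\<close> is a holomorphic section over an open set \<open>W\<close> with values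
  in the upper half-plane. Then \<open>T\<close> is injective, so that \<open>T (f \<tau>) = \<tau>\<close> on \<open>T ` W\<close> as well.
\<close>

definition local_holomorphic_inverse ::
  "(complex \<Rightarrow> complex) \<Rightarrow> complex set \<Rightarrow> (complex \<Rightarrow> complex) \<Rightarrow> bool" where
  "local_holomorphic_inverse f W T \<longleftrightarrow>
     open W \<and> T holomorphic_on W \<and> T ` W \<subseteq> upper_half_plane \<and> (\<forall>w\<in>W. f (T w) = w)"

end

theory Submission
  imports Defs
begin

text \<open>
  The eta quotients \<open>A, B, C, D\<close> below have weight one and level six, each vanishes at exactly one
  of the four cusps, and \<open>f = A / B\<close>. The Atkin-Lehner involutions \<open>W6\<close>, \<open>W3\<close> permute them up to
  explicit factors, and by the maximum modulus principle a family of functions of the nome that is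
  permuted by \<open>W6\<close> and \<open>W3\<close> is constant. This yields \<open>A = B + 8 C\<close>, \<open>D = A + C\<close>,
  \<open>4 a(2\<tau>) = 3 A + B\<close>, the derivative \<open>f' = 2 \<pi> i \<cdot> 8 f C D\<close>, and an expression of weight four
  for \<open>U' - U\<^sup>2 / 4\<close>, where \<open>U\<close> is the logarithmic derivative of \<open>A B C D\<close>. As functions of \<open>f\<close> these
  relations say that \<open>B\<close> satisfies a linear differential equation of second order, and
  \<open>a(2\<tau>) = (3 f + 1) B / 4\<close>.

  The transformation of \<open>\<eta>\<close> comes from the Lambert expansion of a function with the quasi-periods of
  the Weierstrass zeta function: comparing its versions for \<open>\<tau>\<close> and \<open>-1/\<tau>\<close> gives a bounded, hence
  constant, doubly periodic function, whose Taylor coefficient at 0 is the law for the Eisenstein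
  series of weight two.
\<close>

section \<open>The Euler product\<close>

text \<open>\<open>W6\<close>, \<open>W3\<close> and their composite carry the cusp at infinity to
  0, 1/2 and 1/3, up to translation, so growth at the other cusps never has to be examined:
  holomorphy in the nome at \<open>q = 0\<close>, for all members of a family, is enough. Inside the
  half-plane the quotients have no poles because eta has no zeros; at \<open>q = 0\<close> only
  \<open>C\<close> vanishes, so only a division by \<open>C\<close> needs a numerator with a zero
  there. Both involutions are inversions about a centre, 0 or 1/2, so the law for
  \<open>-1/\<tau>\<close> and the effect of \<open>q \<mapsto> -q\<close> on Euler products
  suffice; no multiplier system for eta enters.

  Since \<open>A = f B\<close>, \<open>8 C = (f - 1) B\<close> and \<open>8 D = (9 f - 1) B\<close>,
  the cusps lie over f = 0, 1, 1/9 and infinity, and these are the singular points of the equation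
  for \<open>B\<close>. The point -1/3 is not a cusp: it is the zero of the factor
  \<open>3 f + 1\<close> that leads from \<open>B\<close> to \<open>a(2\<tau>)\<close>. The
  logarithmic derivative of \<open>B\<close> satisfies an equation whose quadratic term disappears
  on passing to \<open>B\<close> with \<open>f\<close> as variable, which makes the result
  linear.\<close>

definition euler_prod :: "complex \<Rightarrow> complex" where
  "euler_prod q = (\<Prod>n. 1 - q ^ (n + 1))"

lemma summable_norm_power_Suc:
  assumes "norm (q::complex) < 1"
  shows "summable (\<lambda>n. norm (q ^ (n + 1)))"
  using assms by (simp add: norm_power norm_mult summable_mult summable_geometric)

lemma power_Suc_neq_1:
  assumes "norm (q::complex) < 1"
  shows "q ^ (n + 1) \<noteq> 1"
proof
  assume "q ^ (n + 1) = 1"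
  hence "norm q ^ (n + 1) = 1" by (metis norm_one norm_power)
  moreover have "norm q ^ (n + 1) < 1"
    using assms by (intro power_less_one_iff[THEN iffD2]) auto
  ultimately show False by simp
qed

lemma convergent_prod_euler:
  assumes "norm (q::complex) < 1"
  shows "convergent_prod (\<lambda>n. 1 - q ^ (n + 1))"
proof (rule abs_convergent_prod_imp_convergent_prod, rule summable_imp_abs_convergent_prod)
  show "summable (\<lambda>i. norm (1 - q ^ (i + 1) - 1))"
    using summable_norm_power_Suc[OF assms] by (simp add: norm_minus_commute norm_mult)
qed

lemma euler_prod_nonzero:
  assumes "norm q < 1"
  shows "euler_prod q \<noteq> 0"
  unfolding euler_prod_def
  using prodinf_nonzero[OF convergent_prod_euler[OF assms]] power_Suc_neq_1[OF assms] by auto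

lemma tendsto_euler_prod:
  assumes "norm q < 1"
  shows "(\<lambda>n. \<Prod>k<n. 1 - q ^ (k + 1)) \<longlonglongrightarrow> euler_prod q"
proof -
  have "(\<lambda>n. \<Prod>k\<le>n. 1 - q ^ (k + 1)) \<longlonglongrightarrow> euler_prod q"
    unfolding euler_prod_def using convergent_prod_LIMSEQ[OF convergent_prod_euler[OF assms]] .
  thus ?thesis by (simp only: LIMSEQ_lessThan_iff_atMost)
qed

lemma euler_prod_eqI:
  assumes "norm q < 1" "(\<lambda>n. \<Prod>k<n. 1 - q ^ (k + 1)) \<longlonglongrightarrow> l"
  shows "euler_prod q = l"
  using LIMSEQ_unique[OF tendsto_euler_prod[OF assms(1)] assms(2)] .

lemma euler_prod_0 [simp]: "euler_prod 0 = 1"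
  by (simp add: euler_prod_def)

lemma uniform_limit_euler_prod:
  assumes "r < 1"
  shows "uniform_limit (cball 0 r) (\<lambda>n q. \<Prod>k<n. 1 - q ^ (k + 1)) euler_prod sequentially"
proof -
  have "uniformly_convergent_on (cball 0 r) (\<lambda>N q. \<Prod>n<N. 1 - q ^ (n + 1) :: complex)"
  proof (rule uniformly_convergent_on_prod')
    show "uniformly_convergent_on (cball 0 r) (\<lambda>N q. \<Sum>n<N. norm (1 - q ^ (n + 1) - 1 :: complex))"
    proof (cases "r \<ge> 0")
      case True
      show ?thesis
      proof (rule Weierstrass_m_test')
        show "norm (norm (1 - q ^ (n + 1) - 1 :: complex)) \<le> r ^ (n + 1)" if "q \<in> cball 0 r" for n q
          using that power_mono[of "norm q" r "n + 1"] by (simp add: norm_mult norm_power)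
        show "summable (\<lambda>n. r ^ (n + 1))"
          using True assms by (simp add: summable_mult summable_geometric)
      qed
    next
      case False
      hence "cball 0 r = ({} :: complex set)" by simp
      thus ?thesis by (simp add: uniformly_convergent_on_def uniform_limit_iff)
    qed
  qed (auto intro!: continuous_intros)
  then obtain l where l: "uniform_limit (cball 0 r) (\<lambda>n q. \<Prod>k<n. 1 - q ^ (k + 1) :: complex) l sequentially"
    by (auto simp: uniformly_convergent_on_def)
  have "l q = euler_prod q" if "q \<in> cball 0 r" for q
    using euler_prod_eqI[of q "l q"] tendsto_uniform_limitI[OF l that] that assms by auto
  thus ?thesis
    using uniform_limit_cong'[of "cball 0 r" "\<lambda>n q. \<Prod>k<n. 1 - q ^ (k + 1)" "\<lambda>n q. \<Prod>k<n. 1 - q ^ (k + 1)" l euler_prod] l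
    by auto
qed

lemma holomorphic_euler_prod: "euler_prod holomorphic_on ball 0 1"
proof (rule holomorphic_uniform_sequence[where f = "\<lambda>n q. \<Prod>k<n. 1 - q ^ (k + 1)"])
  fix x :: complex assume x: "x \<in> ball 0 1"
  define d where "d = (1 - norm x) / 2"
  have sub: "cball x d \<subseteq> cball 0 ((1 + norm x) / 2)"
  proof
    fix y assume "y \<in> cball x d"
    hence "norm (y - x) \<le> (1 - norm x) / 2" by (simp add: d_def dist_norm norm_minus_commute)
    hence "norm y \<le> (1 + norm x) / 2" using norm_triangle_ineq2[of y x] by (simp add: field_simps)
    thus "y \<in> cball 0 ((1 + norm x) / 2)" by simp
  qed
  have "uniform_limit (cball 0 ((1 + norm x) / 2)) (\<lambda>n q. \<Prod>k<n. 1 - q ^ (k + 1)) euler_prod sequentially"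
    using x by (intro uniform_limit_euler_prod) auto
  moreover have "d > 0" using x by (auto simp: d_def)
  moreover have "cball x d \<subseteq> ball 0 1"
    using sub x by (force dest!: subsetD[OF sub])
  ultimately show "\<exists>d>0. cball x d \<subseteq> ball 0 1 \<and> uniform_limit (cball x d) (\<lambda>n q. \<Prod>k<n. 1 - q ^ (k + 1)) euler_prod sequentially"
    using uniform_limit_on_subset[OF _ sub] by blast
qed (auto intro!: holomorphic_intros)

lemma logderiv_euler_prod:
  assumes "norm q < 1"
  shows "(\<lambda>k. - of_nat (k + 1) * q ^ k / (1 - q ^ (k + 1))) sums (deriv euler_prod q / euler_prod q)"
proof -
  obtain r where r: "norm q < r" "r < 1" using dense assms by blast
  have "(\<lambda>k. deriv (\<lambda>q. 1 - q ^ (k + 1)) q / (1 - q ^ (k + 1))) sums (deriv euler_prod q / euler_prod q)"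
  proof (rule logderiv_prodinf_complex_uniform_limit[where A = "ball 0 r"])
    show "uniform_limit (ball 0 r) (\<lambda>n q. \<Prod>k<n. 1 - q ^ (k + 1)) euler_prod sequentially"
      using uniform_limit_on_subset[OF uniform_limit_euler_prod[OF r(2)]] ball_subset_cball by blast
  qed (use r assms euler_prod_nonzero in \<open>auto intro!: holomorphic_intros\<close>)
  moreover have "deriv (\<lambda>q. 1 - q ^ (k + 1)) q = - of_nat (k + 1) * q ^ k" for k
  proof (rule DERIV_imp_deriv)
    show "((\<lambda>q. 1 - q ^ (k + 1)) has_field_derivative - of_nat (k + 1) * q ^ k) (at q)"
      by (rule derivative_eq_intros refl | simp add: algebra_simps)+
  qed
  ultimately show ?thesis by simp
qed

lemma deriv_euler_prod_0: "deriv euler_prod 0 = -1"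
proof -
  have "(\<lambda>k. - of_nat (k + 1) * 0 ^ k / (1 - 0 ^ (k + 1))) sums (deriv euler_prod 0 / euler_prod 0)"
    by (rule logderiv_euler_prod) auto
  \<comment> \<open>Since \<open>0 ^ 0 = 1\<close>, the term with \<open>k = 0\<close> survives and
    equals -1; all others vanish.\<close>
  moreover have "(\<lambda>k. - of_nat (k + 1) * 0 ^ k / (1 - 0 ^ (k + 1))) sums (-1 :: complex)"
    using sums_If_finite_set[of "{0}" "\<lambda>k. - of_nat (k + 1) * 0 ^ k / (1 - 0 ^ (k + 1)) :: complex"]
      sums_finite[of "{0}" "\<lambda>k. - of_nat (k + 1) * 0 ^ k / (1 - 0 ^ (k + 1)) :: complex"]
    by auto
  ultimately show ?thesis using sums_unique2 by force
qed

text \<open>Among the first 2n factors of the Euler product, those with even exponent are the first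
  n factors of the product for \<open>q\<^sup>2\<close>; dividing them out leaves the odd
  exponents.\<close>

lemma euler_prod_odd:
  assumes "norm q < 1"
  shows "(\<lambda>n. \<Prod>k<n. 1 - q ^ (2 * k + 1)) \<longlonglongrightarrow> euler_prod q / euler_prod (q ^ 2)"
proof -
  have q2: "norm (q ^ 2) < 1"
    using assms by (simp add: norm_power power_less_one_iff abs_square_less_1)
  have "(\<Prod>k<2*n. 1 - q ^ (k + 1)) = (\<Prod>k<n. 1 - q ^ (2 * k + 1)) * (\<Prod>k<n. 1 - (q ^ 2) ^ (k + 1))" for n
  proof (induction n)
    case (Suc n)
    have "(\<Prod>k<2 * Suc n. 1 - q ^ (k + 1)) = 
        (\<Prod>k<2*n. 1 - q ^ (k + 1)) * ((1 - q ^ (2 * n + 1)) * (1 - q ^ (2 * n + 2)))"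
      by simp
    moreover have "q ^ (2 * n + 2) = (q ^ 2) ^ (n + 1)"
      by (simp add: power_mult power2_eq_square)
    ultimately show ?case using Suc.IH by simp
  qed simp
  moreover have "(\<lambda>n. \<Prod>k<2*n. 1 - q ^ (k + 1)) \<longlonglongrightarrow> euler_prod q"
    by (rule filterlim_compose[OF tendsto_euler_prod[OF assms], of "\<lambda>n. 2 * n"])
       (intro filterlim_subseq strict_monoI, simp)
  ultimately have "(\<lambda>n. ((\<Prod>k<n. 1 - q ^ (2 * k + 1)) * (\<Prod>k<n. 1 - (q ^ 2) ^ (k + 1))) / (\<Prod>k<n. 1 - (q ^ 2) ^ (k + 1))) 
        \<longlonglongrightarrow> euler_prod q / euler_prod (q ^ 2)"
    by (intro tendsto_divide tendsto_euler_prod) (use q2 euler_prod_nonzero in auto)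
  moreover have "(\<Prod>k<n. 1 - (q ^ 2) ^ (k + 1)) \<noteq> 0" for n
    using power_Suc_neq_1[OF q2] by (auto simp: prod_zero_iff)
  ultimately show ?thesis by (simp del: power_Suc)
qed

text \<open>The odd-exponent products of \<open>q\<close> and \<open>-q\<close> multiply, factor by
  factor, to that of \<open>q\<^sup>2\<close>, because
  \<open>(1 - x)(1 + x) = 1 - x\<^sup>2\<close>. Three uses of \<open>euler_prod_odd\<close> then
  determine the value at \<open>-q\<close>.\<close>

lemma euler_prod_minus:
  assumes "norm q < 1"
  shows "euler_prod (- q) = euler_prod (q ^ 2) ^ 3 / (euler_prod q * euler_prod (q ^ 4))"
proof -
  have q2: "norm (q ^ 2) < 1" and q4: "norm (q ^ 4) < 1"
    using assms by (auto simp: norm_power power_less_one_iff)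
  have "(\<lambda>n. (\<Prod>k<n. 1 - q ^ (2 * k + 1)) * (\<Prod>k<n. 1 - (- q) ^ (2 * k + 1))) \<longlonglongrightarrow>
     (euler_prod q / euler_prod (q ^ 2)) * (euler_prod (- q) / euler_prod ((- q) ^ 2))"
    by (intro tendsto_mult euler_prod_odd) (use assms in auto)
  moreover have "(\<Prod>k<n. 1 - q ^ (2 * k + 1)) * (\<Prod>k<n. 1 - (- q) ^ (2 * k + 1)) = 
      (\<Prod>k<n. 1 - (q ^ 2) ^ (2 * k + 1))" for n
    unfolding prod.distrib [symmetric] 
    by (intro prod.cong refl) (simp add: power_mult [symmetric] algebra_simps flip: power_add)
  moreover have "(\<lambda>n. \<Prod>k<n. 1 - (q ^ 2) ^ (2 * k + 1)) \<longlonglongrightarrow> euler_prod (q ^ 2) / euler_prod ((q ^ 2) ^ 2)"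
    by (intro euler_prod_odd q2)
  ultimately have "(euler_prod q / euler_prod (q ^ 2)) * (euler_prod (- q) / euler_prod (q ^ 2)) = 
      euler_prod (q ^ 2) / euler_prod (q ^ 4)"
    using LIMSEQ_unique by (auto simp: power_mult [symmetric])
  thus ?thesis using euler_prod_nonzero[OF assms] euler_prod_nonzero[OF q2] euler_prod_nonzero[OF q4]
    by (simp add: field_simps power3_eq_cube)
qed

section \<open>Quasi-modularity of the weight two Eisenstein series\<close>

definition lambert_sin :: "complex \<Rightarrow> complex \<Rightarrow> complex" where
  "lambert_sin q u = (\<Sum>n. q ^ (n + 1) / (1 - q ^ (n + 1)) *
     (exp (of_nat (n + 1) * u) - exp (- of_nat (n + 1) * u)))"

definition lambert_cos :: "complex \<Rightarrow> complex \<Rightarrow> complex" where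
  "lambert_cos q u = (\<Sum>n. q ^ (n + 1) / (1 - q ^ (n + 1)) * of_nat (n + 1) *
     (exp (of_nat (n + 1) * u) + exp (- of_nat (n + 1) * u)))"

text \<open>This is \<open>coth (u / 2)\<close> minus four times the sum of
  \<open>q^n / (1 - q^n) sinh (n u)\<close>: twice the Weierstrass zeta function of the lattice
  spanned by \<open>2 \<pi> \<i>\<close> and \<open>v\<close>, where \<open>q = exp v\<close>,
  corrected by a linear term so that \<open>2 \<pi> \<i>\<close> becomes a true period.\<close>

definition quasi_cot :: "complex \<Rightarrow> complex \<Rightarrow> complex" where
  "quasi_cot q u = (exp u + 1) / (exp u - 1) - 2 * lambert_sin q u"

lemma norm_one_minus_power_ge:
  assumes "norm (q::complex) < 1"
  shows "norm (1 - q ^ (n + 1)) \<ge> 1 - norm q"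
proof -
  have "norm q ^ (n + 1) \<le> norm q ^ 1"
    using assms by (intro power_decreasing) auto
  thus ?thesis using norm_triangle_ineq2[of 1 "q ^ (n + 1)"] by (simp add: norm_power norm_mult)
qed

lemma norm_lambert_coeff_le:
  assumes "norm (q::complex) < 1"
  shows "norm (q ^ (n + 1) / (1 - q ^ (n + 1))) \<le> norm q ^ (n + 1) / (1 - norm q)"
  unfolding norm_divide norm_power
  using norm_one_minus_power_ge[OF assms, of n] assms by (intro divide_left_mono frac_le) auto

lemma norm_exp_nat_le:
  assumes "\<bar>Re u\<bar> \<le> r"
  shows "norm (exp (of_nat n * u)) \<le> exp r ^ n" "norm (exp (- of_nat n * u)) \<le> exp r ^ n"
proof -
  have "real n * Re u \<le> real n * r" "- (real n * Re u) \<le> real n * r"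
    using assms mult_left_mono[of "Re u" r "real n"] mult_left_mono[of "- Re u" r "real n"] by auto
  thus "norm (exp (of_nat n * u)) \<le> exp r ^ n" "norm (exp (- of_nat n * u)) \<le> exp r ^ n"
    by (simp_all flip: exp_of_nat_mult)
qed

lemma summable_lambert_majorant:
  assumes "norm (q::complex) < 1" "norm q * exp r < 1"
  shows "summable (\<lambda>n. norm q ^ (n + 1) / (1 - norm q) * real (n + 1) * (2 * exp r ^ (n + 1)))"
proof -
  have "summable (\<lambda>n. real (Suc n) * (norm q * exp r) ^ n)"
    using assms geometric_deriv_sums[of "norm q * exp r"] by (auto simp: sums_iff)
  from summable_mult[OF this, of "2 * (norm q * exp r) / (1 - norm q)"]
  show ?thesis by (simp add: power_mult_distrib mult_ac)
qed

text \<open>On the strip of half-width \<open>r\<close> the differentiated series is dominated by a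
  series of type n x^n with \<open>x = norm q * exp r < 1\<close>, so termwise differentiation is
  allowed.\<close>

lemma lambert_sin_deriv:
  assumes q: "norm q < 1" and r: "norm q * exp r < 1" "\<bar>Re u\<bar> < r"
  shows "summable (\<lambda>n. q ^ (n + 1) / (1 - q ^ (n + 1)) *
           (exp (of_nat (n + 1) * u) - exp (- of_nat (n + 1) * u)))" (is ?A)
    and "(lambert_sin q has_field_derivative lambert_cos q u) (at u)" (is ?B)
proof -
  define S where "S = {u. \<bar>Re u\<bar> < r}"
  have S_eq: "S = {u. Re u < r} \<inter> {u. Re u > - r}" by (auto simp: S_def)
  have S: "convex S" "open S" "u \<in> S" "0 \<in> S"
    unfolding S_eq using r(2) 
    by (auto intro!: convex_Int convex_halfspace_Re_lt convex_halfspace_Re_gt open_halfspace_Re_lt open_halfspace_Re_gt)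
  define c where "c = (\<lambda>n. q ^ (n + 1) / (1 - q ^ (n + 1)))"
  have unif: "uniformly_convergent_on S (\<lambda>N u. \<Sum>n<N. c n * of_nat (n + 1) *
     (exp (of_nat (n + 1) * u) + exp (- of_nat (n + 1) * u)))"
  proof (rule Weierstrass_m_test'[OF _ summable_lambert_majorant[OF q r(1)]])
    fix n u assume "u \<in> S"
    hence "\<bar>Re u\<bar> \<le> r" by (simp add: S_def)
    hence "norm (exp (of_nat (n + 1) * u) + exp (- of_nat (n + 1) * u)) \<le> 2 * exp r ^ (n + 1)"
      using norm_exp_nat_le[of u r "n + 1"] norm_triangle_ineq[of "exp (of_nat (n + 1) * u)" "exp (- of_nat (n + 1) * u)"]
      by linarith
    thus "norm (c n * of_nat (n + 1) * (exp (of_nat (n + 1) * u) + exp (- of_nat (n + 1) * u)))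
       \<le> norm q ^ (n + 1) / (1 - norm q) * real (n + 1) * (2 * exp r ^ (n + 1))"
      using norm_lambert_coeff_le[OF q, of n] unfolding norm_mult c_def norm_of_nat
      using q by (intro mult_mono) auto
  qed
  have d: "((\<lambda>u. c n * (exp (of_nat (n + 1) * u) - exp (- of_nat (n + 1) * u))) has_field_derivative
        c n * of_nat (n + 1) * (exp (of_nat (n + 1) * u) + exp (- of_nat (n + 1) * u))) (at u within S)" for n u
    by (rule derivative_eq_intros refl | simp add: algebra_simps)+
  note * = has_field_derivative_series'[OF S(1) d unif S(4), of u]
  \<comment> \<open>All terms vanish at 0; this is the one point of convergence that termwise
    differentiation asks for.\<close>
  have "summable (\<lambda>n. c n * (exp (of_nat (n + 1) * 0) - exp (- of_nat (n + 1) * 0)))" by simp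
  note * = *[OF this]
  show ?A using *(1) S by (simp add: interior_open c_def)
  show ?B using *(2) S unfolding lambert_sin_def [abs_def] lambert_cos_def c_def by (simp add: interior_open)
qed

text \<open>For \<open>q = exp v\<close> one has \<open>norm q = exp (Re v)\<close>, so the Lambert
  series converge exactly as far as a strip of half-width \<open>r < - Re v\<close> reaches.\<close>

lemma exists_strip:
  assumes "\<bar>Re u\<bar> < - Re v"
  obtains r where "\<bar>Re u\<bar> < r" "norm (exp v) * exp r < 1" "norm (exp v) < 1"
proof -
  obtain r where "\<bar>Re u\<bar> < r" "r < - Re v" using dense[OF assms] by auto
  moreover have "norm (exp v) * exp r = exp (Re v + r)" by (simp add: exp_add)
  ultimately show ?thesis using that[of r] by auto
qed

lemma holomorphic_lambert_sin: "lambert_sin (exp v) holomorphic_on {u. \<bar>Re u\<bar> < - Re v}"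
proof -
  have "lambert_sin (exp v) field_differentiable at u" if "\<bar>Re u\<bar> < - Re v" for u
    using exists_strip[OF that] lambert_sin_deriv(2) unfolding field_differentiable_def by metis
  thus ?thesis by (auto simp: holomorphic_on_def intro: field_differentiable_at_within)
qed

lemma lambert_sin_minus:
  assumes "\<bar>Re u\<bar> < - Re v"
  shows "lambert_sin (exp v) (- u) = - lambert_sin (exp v) u"
proof -
  obtain r where r: "\<bar>Re u\<bar> < r" "norm (exp v) * exp r < 1" "norm (exp v) < 1"
    using exists_strip[OF assms] .
  show ?thesis
    unfolding lambert_sin_def suminf_minus[OF lambert_sin_deriv(1)[OF r(3,2,1)], symmetric]
    by (intro suminf_cong) (simp only: mult_minus_right mult_minus_left minus_minus right_diff_distrib minus_diff_eq)
qed

lemma quasi_cot_minus: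
  assumes "\<bar>Re u\<bar> < - Re v"
  shows "quasi_cot (exp v) (- u) = - quasi_cot (exp v) u"
proof (cases "exp u = 1")
  case False
  thus ?thesis
    using lambert_sin_minus[OF assms] by (simp add: quasi_cot_def exp_minus divide_simps) (simp add: algebra_simps)
\<comment> \<open>At a pole of the coth term the division by zero yields 0, so oddness persists
  there.\<close>
qed (use lambert_sin_minus[OF assms] in \<open>simp add: quasi_cot_def exp_minus\<close>)

lemma exp_nat_plus_2pi_i:
  "exp (of_nat n * (u + 2 * of_real pi * \<i>)) = exp (of_nat n * u)"
  "exp (- (of_nat n * (u + 2 * of_real pi * \<i>))) = exp (- (of_nat n * u))"
proof -
  have "exp (of_nat n * (u + 2 * of_real pi * \<i>)) = exp (u + 2 * of_real pi * \<i>) ^ n"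
    by (simp add: exp_of_nat_mult)
  also have "exp (u + 2 * of_real pi * \<i>) = exp u" by (simp add: exp_add)
  finally show "exp (of_nat n * (u + 2 * of_real pi * \<i>)) = exp (of_nat n * u)"
    by (simp add: exp_of_nat_mult)
  thus "exp (- (of_nat n * (u + 2 * of_real pi * \<i>))) = exp (- (of_nat n * u))"
    by (simp only: exp_minus)
qed

lemma quasi_cot_plus_2pi_i: "quasi_cot q (u + 2 * of_real pi * \<i>) = quasi_cot q u"
proof -
  have "lambert_sin q (u + 2 * of_real pi * \<i>) = lambert_sin q u"
    unfolding lambert_sin_def minus_mult_left [symmetric] exp_nat_plus_2pi_i by simp
  thus ?thesis using exp_nat_plus_2pi_i[of 1 u] by (simp add: quasi_cot_def)
qed

text \<open>Moving \<open>u\<close> by \<open>v\<close> multiplies \<open>exp u\<close> by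
  \<open>q\<close>, which cancels the denominators \<open>1 - q^n\<close>: the difference of the
  Lambert series is a sum of two geometric series, in \<open>q exp u\<close> and in
  \<open>exp (-u)\<close>, whence the bounds on \<open>Re u\<close>. Their values turn the coth term
  at \<open>u + v\<close> into the one at \<open>u\<close>, up to -2.\<close>

lemma quasi_cot_plus_period:
  assumes u: "0 < Re u" "Re u < - Re v"
  shows "quasi_cot (exp v) (u + v) = quasi_cot (exp v) u - 2"
proof -
  define q w where "q = exp v" and "w = exp u"
  have q: "norm q < 1" "q \<noteq> 0" and w: "norm w > 1" "norm (q * w) < 1" "w \<noteq> 0"
    using u by (auto simp: q_def w_def simp flip: exp_add)
  obtain r where r: "\<bar>Re u\<bar> < r" "norm q * exp r < 1"
    using exists_strip[of u v] u by (auto simp: q_def)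
  obtain r' where r': "\<bar>Re (u + v)\<bar> < r'" "norm q * exp r' < 1"
    using exists_strip[of "u + v" v] u by (auto simp: q_def)
  have "(\<lambda>n. q ^ (n + 1) / (1 - q ^ (n + 1)) * (exp (of_nat (n + 1) * u) - exp (- of_nat (n + 1) * u))
     - q ^ (n + 1) / (1 - q ^ (n + 1)) * (exp (of_nat (n + 1) * (u + v)) - exp (- of_nat (n + 1) * (u + v))))
     sums (lambert_sin q u - lambert_sin q (u + v))"
    unfolding lambert_sin_def
    by (intro sums_diff summable_sums lambert_sin_deriv(1)[OF q(1) r(2,1)] lambert_sin_deriv(1)[OF q(1) r'(2,1)])
  moreover have "q ^ (n + 1) / (1 - q ^ (n + 1)) * (exp (of_nat (n + 1) * u) - exp (- of_nat (n + 1) * u))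
     - q ^ (n + 1) / (1 - q ^ (n + 1)) * (exp (of_nat (n + 1) * (u + v)) - exp (- of_nat (n + 1) * (u + v)))
     = (q * w) ^ (n + 1) + (1 / w) ^ (n + 1)" for n
  proof -
    define Q W where "Q = q ^ (n + 1)" and "W = w ^ (n + 1)"
    have e: "exp (of_nat (n + 1) * u) = W" "exp (- of_nat (n + 1) * u) = 1 / W"
      "exp (of_nat (n + 1) * (u + v)) = Q * W" "exp (- of_nat (n + 1) * (u + v)) = 1 / (Q * W)"
      unfolding Q_def W_def q_def w_def minus_mult_left [symmetric] exp_minus exp_of_nat_mult
      by (simp_all add: exp_add power_mult_distrib field_simps)
    have "Q \<noteq> 0" "Q \<noteq> 1" "W \<noteq> 0" 
      using q w power_Suc_neq_1[of q n] by (auto simp: Q_def W_def)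
    hence "Q / (1 - Q) * (W - 1 / W) - Q / (1 - Q) * (Q * W - 1 / (Q * W)) = Q * W + 1 / W"
      by (simp add: divide_simps) (simp add: algebra_simps power2_eq_square)
    thus ?thesis unfolding e Q_def [symmetric] 
      by (simp add: Q_def W_def power_mult_distrib power_one_over)
  qed
  moreover have "(\<lambda>n. (q * w) ^ (n + 1) + (1 / w) ^ (n + 1)) sums (q * w * (1 / (1 - q * w)) + 1 / w * (1 / (1 - 1 / w)))"
    unfolding power_add power_one_right mult.commute[of "_ ^ _"]
    by (intro sums_add sums_mult geometric_sums) (use w in \<open>auto simp: norm_divide\<close>)
  ultimately have diff: "lambert_sin q u - lambert_sin q (u + v) = q * w * (1 / (1 - q * w)) + 1 / w * (1 / (1 - 1 / w))"
    using sums_unique2 by simp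
  have "1 - q * w \<noteq> 0" "1 - w \<noteq> 0" "w - 1 \<noteq> 0" "q * w - 1 \<noteq> 0" using w by auto
  hence "(q * w + 1) / (q * w - 1) + 2 * (lambert_sin q u - lambert_sin q (u + v)) = (w + 1) / (w - 1) - 2"
    unfolding diff using w by (simp add: divide_simps) (simp add: algebra_simps power2_eq_square)
  thus ?thesis
    unfolding quasi_cot_def exp_add q_def [symmetric] w_def [symmetric] 
    by (simp only: mult.commute[of w q]) (simp add: algebra_simps)
qed

lemma coth_expansion_limit:
  "((\<lambda>u::complex. ((exp u + 1) / (exp u - 1) - 2 / u) / u) \<longlongrightarrow> 1 / 6) (at 0)"
proof -
  \<comment> \<open>Taylor remainder of exp of order \<open>k\<close>, divided by
    \<open>u ^ k\<close>; its limit at 0 is the next coefficient \<open>1 / fact k\<close>.\<close>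
  define E where "E = (\<lambda>k (u::complex). (exp u - (\<Sum>n<k. u ^ n /\<^sub>R fact n)) / u ^ k)"
  have E: "(E k \<longlongrightarrow> 1 / fact k) (at 0)" for k
  proof -
    have "(\<lambda>n. (inverse (fact (n + k)) :: complex) * u ^ n) sums E k u" if "u \<noteq> 0" for u
    proof -
      have "(\<lambda>n. u ^ (n + k) /\<^sub>R fact (n + k)) sums (exp u - (\<Sum>n<k. u ^ n /\<^sub>R fact n))"
        using exp_converges[of u] by (rule sums_split_initial_segment)
      from sums_divide[OF this, of "u ^ k"] show ?thesis
        using that by (simp add: E_def power_add scaleR_conv_of_real field_simps)
    qed
    from powser_limit_0_strong[OF zero_less_one this] show ?thesis by (simp add: field_simps)
  qed
  \<comment> \<open>Obtained by inserting \<open>exp u = 1 + u + u\<^sup>2/2 + u^3 E 3 u\<close> in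
    the numerator and \<open>exp u - 1 = u E 1 u\<close> in the denominator and cancelling
    \<open>u^3\<close>.\<close>
  have "((\<lambda>u. (u * E 3 u + 1 / 2 - 2 * E 3 u) / E 1 u) \<longlongrightarrow> (0 * (1 / fact 3) + 1 / 2 - 2 * (1 / fact 3)) / (1 / fact 1)) (at 0)"
    by (intro tendsto_intros E) auto
  hence "((\<lambda>u. (u * E 3 u + 1 / 2 - 2 * E 3 u) / E 1 u) \<longlongrightarrow> 1 / 6) (at 0)"
    by (simp add: fact_numeral)
  moreover have "\<forall>\<^sub>F u in at 0. (u * E 3 u + 1 / 2 - 2 * E 3 u) / E 1 u = ((exp u + 1) / (exp u - 1) - 2 / u) / u"
  proof -
    have "\<forall>\<^sub>F u::complex in at 0. u \<in> ball 0 1 - {0}" by (intro eventually_at_in_open) auto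
    thus ?thesis
    proof eventually_elim
      case (elim u)
      have "exp u \<noteq> 1"
      proof
        assume "exp u = 1"
        hence "exp u = exp 0" by simp
        hence "u = 0" using elim 
          abs_Im_le_cmod[of u] pi_gt3 by (intro exp_complex_eqI[of u 0]) auto
        thus False using elim by simp
      qed
      moreover have "u \<noteq> 0" using elim by auto
      moreover have E31: "E 3 u = (exp u - 1 - u - u^2 / 2) / u ^ 3" "E 1 u = (exp u - 1) / u"
        by (simp_all add: E_def eval_nat_numeral scaleR_conv_of_real field_simps)
      ultimately show ?case unfolding E31
        by (simp add: divide_simps) (simp add: algebra_simps power2_eq_square power3_eq_cube)
    qed
  qed
  ultimately show ?thesis by (rule Lim_transform_eventually)
qed


text \<open>The generating function of the divisor sums, so \<open>1 / 6 - 4 * lambert_E q\<close>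
  is one sixth of the Eisenstein series of weight two.\<close>

definition lambert_E :: "complex \<Rightarrow> complex" where
  "lambert_E q = (\<Sum>n. of_nat (n + 1) * q ^ (n + 1) / (1 - q ^ (n + 1)))"

text \<open>The coefficient of \<open>u\<close> after the pole: 1/6 from coth, and
  \<open>-2 * lambert_cos q 0 = -4 * lambert_E q\<close> from the Lambert series.\<close>

lemma quasi_cot_limit:
  assumes "Re v < 0"
  shows "((\<lambda>u. (quasi_cot (exp v) u - 2 / u) / u) \<longlongrightarrow> 1 / 6 - 4 * lambert_E (exp v)) (at 0)"
proof -
  obtain r where r: "\<bar>Re 0\<bar> < r" "norm (exp v) * exp r < 1" "norm (exp v) < 1"
    using exists_strip[of 0 v] assms by auto
  have "summable (\<lambda>n. norm (of_nat (n + 1) * exp v ^ (n + 1) / (1 - exp v ^ (n + 1))))"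
  proof (rule summable_comparison_test'[where N = 0])
    show "summable (\<lambda>n. norm (exp v) ^ (n + 1) / (1 - norm (exp v)) * real (n + 1) * (2 * exp 0 ^ (n + 1)))"
      using r by (intro summable_lambert_majorant) auto
    fix n
    have "norm (of_nat (n + 1) * (exp v ^ (n + 1) / (1 - exp v ^ (n + 1)))) \<le>
        real (n + 1) * (norm (exp v) ^ (n + 1) / (1 - norm (exp v)))"
      unfolding norm_mult norm_of_nat by (intro mult_left_mono norm_lambert_coeff_le r(3)) auto
    also have "\<dots> * 1 \<le> real (n + 1) * (norm (exp v) ^ (n + 1) / (1 - norm (exp v))) * 2"
      by (intro mult_left_mono) (use r(3) in auto)
    also have "\<dots> = norm (exp v) ^ (n + 1) / (1 - norm (exp v)) * real (n + 1) * (2 * exp 0 ^ (n + 1))"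
      by simp
    finally show "norm (norm (of_nat (n + 1) * exp v ^ (n + 1) / (1 - exp v ^ (n + 1)))) \<le>
        norm (exp v) ^ (n + 1) / (1 - norm (exp v)) * real (n + 1) * (2 * exp 0 ^ (n + 1))" by simp
  qed
  hence sm: "summable (\<lambda>n. of_nat (n + 1) * exp v ^ (n + 1) / (1 - exp v ^ (n + 1)))"
    by (rule summable_norm_cancel)
  have "lambert_cos (exp v) 0 = 2 * lambert_E (exp v)"
    unfolding lambert_E_def lambert_cos_def suminf_mult[OF sm, symmetric]
    by (intro suminf_cong) simp
  hence "(lambert_sin (exp v) has_field_derivative 2 * lambert_E (exp v)) (at 0)"
    using lambert_sin_deriv(2)[OF r(3,2,1)] by simp
  hence "((\<lambda>u. lambert_sin (exp v) u / u) \<longlongrightarrow> 2 * lambert_E (exp v)) (at 0)"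
    by (simp add: has_field_derivative_iff lambert_sin_def)
  from tendsto_diff[OF coth_expansion_limit tendsto_mult[OF tendsto_const[of 2] this]]
  have "((\<lambda>u. ((exp u + 1) / (exp u - 1) - 2 / u) / u - 2 * (lambert_sin (exp v) u / u)) \<longlongrightarrow> 1 / 6 - 4 * lambert_E (exp v)) (at 0)"
    by simp
  moreover have "(\<lambda>u. ((exp u + 1) / (exp u - 1) - 2 / u) / u - 2 * (lambert_sin (exp v) u / u)) =
      (\<lambda>u. (quasi_cot (exp v) u - 2 / u) / u)"
    by (auto simp: fun_eq_iff quasi_cot_def diff_divide_distrib)
  ultimately show ?thesis by simp
qed

section \<open>The lattice of \<open>\<tau>\<close> compared with that of
  \<open>-1/\<tau>\<close>\<close>

context
  fixes \<tau> v v' :: complex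
  assumes tau: "Im \<tau> > 0"
  defines "v \<equiv> 2 * of_real pi * \<i> * \<tau>"
  defines "v' \<equiv> - (2 * of_real pi * \<i>) / \<tau>"
begin

lemma Re_periods: "Re v < 0" "Re v' < 0"
proof -
  show "Re v < 0" using tau by (simp add: v_def)
  have "Re v' = - 2 * pi * Im \<tau> / (norm \<tau>)\<^sup>2"
    by (simp add: v'_def Re_divide cmod_def)
  moreover have "2 * pi * Im \<tau> / (norm \<tau>)\<^sup>2 > 0"
    using tau by (intro divide_pos_pos mult_pos_pos) auto
  ultimately show "Re v' < 0" by simp
qed

lemma tau_nonzero: "\<tau> \<noteq> 0" using tau by auto

text \<open>For \<open>u = 2 \<pi> \<i> x + v y\<close> with real x, y one has
  \<open>Re u = y Re v\<close> and \<open>Re (u / \<tau>) = - x Re v'\<close>. The cell is therefore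
  \<open>|x| < 1\<close>, \<open>|y| < 1\<close>: there both Lambert series converge, and 0 is its
  only lattice point.\<close>

definition period_cell where
  "period_cell = {u. \<bar>Re u\<bar> < - Re v \<and> \<bar>Re (u / \<tau>)\<bar> < - Re v'}"

text \<open>Division by \<open>\<tau>\<close> maps the lattice of \<open>2 \<pi> \<i>\<close>,
  \<open>v\<close> onto that of \<open>2 \<pi> \<i>\<close>, \<open>v'\<close>, so both terms have
  the poles \<open>2 / u\<close>. The linear term absorbs both quasi-periods: it grows by
  \<open>2 / \<tau>\<close> along \<open>2 \<pi> \<i>\<close> and by 2 along \<open>v\<close>. The
  value at 0 fills the removable singularity of an odd function.\<close>

definition quasi_cot_defect where
  "quasi_cot_defect u = (if u = 0 then 0 else
     quasi_cot (exp v') (u / \<tau>) / \<tau> - quasi_cot (exp v) u - u / (of_real pi * \<i> * \<tau>))"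

lemma open_strip: "open {u. \<bar>Re (u * c)\<bar> < b}"
  by (intro open_Collect_less continuous_intros)

lemma convex_strip: "convex {u. \<bar>Re (u * c)\<bar> < b}"
proof (rule convexI)
  fix x y u w :: real and x' y' :: complex
  assume *: "x' \<in> {u. \<bar>Re (u * c)\<bar> < b}" "y' \<in> {u. \<bar>Re (u * c)\<bar> < b}" "0 \<le> u" "0 \<le> w" "u + w = 1"
  have "Re ((u *\<^sub>R x' + w *\<^sub>R y') * c) = u * Re (x' * c) + w * Re (y' * c)"
    by (simp add: algebra_simps)
  moreover have "Re (x' * c) \<in> {-b<..<b}" "Re (y' * c) \<in> {-b<..<b}"
    using *(1,2) by (auto simp only: mem_Collect_eq abs_less_iff greaterThanLessThan_iff minus_less_iff)
  ultimately have "Re ((u *\<^sub>R x' + w *\<^sub>R y') * c) \<in> {-b<..<b}"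
    using convexD[of "{-b<..<b}" "Re (x' * c)" "Re (y' * c)" u w] *(3-5) by simp
  thus "u *\<^sub>R x' + w *\<^sub>R y' \<in> {u. \<bar>Re (u * c)\<bar> < b}" 
    by (auto simp only: mem_Collect_eq abs_less_iff greaterThanLessThan_iff minus_less_iff)
qed

lemma period_cell_Int: "period_cell = {u. \<bar>Re (u * 1)\<bar> < - Re v} \<inter> {u. \<bar>Re (u * (1 / \<tau>))\<bar> < - Re v'}"
  by (auto simp: period_cell_def)

lemma open_period_cell: "open period_cell"
  unfolding period_cell_Int by (intro open_Int open_strip)

lemma convex_period_cell: "convex period_cell"
  unfolding period_cell_Int by (intro convex_Int convex_strip)

lemma period_v_div: "v / \<tau> = 2 * of_real pi * \<i>" "2 * of_real pi * \<i> / \<tau> = - v'"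
  using tau_nonzero by (simp_all add: v_def v'_def)

lemma defect_plus_2pi_i:
  assumes "\<bar>Re u\<bar> < - Re v" "0 < Re (u / \<tau>)" "Re (u / \<tau>) < - Re v'"
  shows "quasi_cot_defect (u - 2 * of_real pi * \<i>) = quasi_cot_defect u"
proof -
  have "u \<noteq> 0" "u \<noteq> 2 * of_real pi * \<i>" using assms period_v_div by auto
  moreover have "(u - 2 * of_real pi * \<i>) / \<tau> = u / \<tau> + v'"
    by (simp add: diff_divide_distrib period_v_div)
  moreover have "quasi_cot (exp v) (u - 2 * of_real pi * \<i>) = quasi_cot (exp v) u"
    using quasi_cot_plus_2pi_i[of "exp v" "u - 2 * of_real pi * \<i>"] by simp
  moreover have "(2 * of_real pi * \<i>) / (of_real pi * \<i> * \<tau>) = 2 / \<tau>" by simp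
  ultimately show ?thesis
    using quasi_cot_plus_period[OF assms(2,3)]
    by (simp add: quasi_cot_defect_def diff_divide_distrib period_v_div)
qed

lemma defect_plus_v:
  assumes "0 < Re u" "Re u < - Re v" "\<bar>Re (u / \<tau>)\<bar> < - Re v'"
  shows "quasi_cot_defect (u + v) = quasi_cot_defect u"
proof -
  have "u \<noteq> 0" "u + v \<noteq> 0" using assms by (auto simp: eq_neg_iff_add_eq_0 [symmetric])
  moreover have "(u + v) / \<tau> = u / \<tau> + 2 * of_real pi * \<i>"
    by (simp add: add_divide_distrib period_v_div)
  moreover have "v / (of_real pi * \<i> * \<tau>) = 2" using tau_nonzero by (simp add: v_def)
  ultimately show ?thesis
    using quasi_cot_plus_period[OF assms(1,2)] quasi_cot_plus_2pi_i[of "exp v'" "u / \<tau>"] 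
    by (simp add: quasi_cot_defect_def add_divide_distrib)
qed

lemma uminus_in_period_cell: "u \<in> period_cell \<Longrightarrow> - u \<in> period_cell"
  by (auto simp: period_cell_def)

lemma defect_minus:
  assumes "u \<in> period_cell"
  shows "quasi_cot_defect (- u) = - quasi_cot_defect u"
  using assms quasi_cot_minus[of u v] quasi_cot_minus[of "u / \<tau>" v']
  by (simp add: quasi_cot_defect_def period_cell_def)

text \<open>Takes the place of a periodic extension to the plane, as the series converge only in
  strips. A change of sign makes a coordinate nonnegative, and then at most one translation halves
  its range; the two directions are treated in turn, since a shift by one period leaves the other
  coordinate alone.\<close>

lemma reduce_period_cell:
  assumes "u \<in> period_cell"
  shows "\<exists>u'\<in>period_cell. \<bar>Re u'\<bar> \<le> - Re v / 2 \<and> \<bar>Re (u' / \<tau>)\<bar> \<le> - Re v' / 2 \<and>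
     norm (quasi_cot_defect u') = norm (quasi_cot_defect u)"
proof -
  have 1: "\<exists>u'\<in>period_cell. \<bar>Re u'\<bar> \<le> - Re v / 2 \<and> norm (quasi_cot_defect u') = norm (quasi_cot_defect u)"
    if u: "u \<in> period_cell" "Re u \<ge> 0" for u
  proof (cases "Re u \<le> - Re v / 2")
    case False
    have "Re ((u + v) / \<tau>) = Re (u / \<tau>)" by (simp add: add_divide_distrib period_v_div)
    thus ?thesis using False u Re_periods defect_plus_v[of u]
      by (intro bexI[of _ "u + v"]) (auto simp: period_cell_def)
  qed (use u in \<open>intro bexI[of _ u]; simp\<close>)
  have 2: "\<exists>u'\<in>period_cell. \<bar>Re u'\<bar> \<le> - Re v / 2 \<and> norm (quasi_cot_defect u') = norm (quasi_cot_defect u)"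
    if u: "u \<in> period_cell" for u
    using 1[of u] 1[of "-u"] u uminus_in_period_cell[OF u] defect_minus[OF u] by (cases "Re u \<ge> 0") auto
  have 3: "\<exists>u'\<in>period_cell. \<bar>Re u'\<bar> \<le> - Re v / 2 \<and> \<bar>Re (u' / \<tau>)\<bar> \<le> - Re v' / 2 \<and> norm (quasi_cot_defect u') = norm (quasi_cot_defect u)"
    if u: "u \<in> period_cell" "\<bar>Re u\<bar> \<le> - Re v / 2" "Re (u / \<tau>) \<ge> 0" for u
  proof (cases "Re (u / \<tau>) \<le> - Re v' / 2")
    case False
    have "Re ((u - 2 * of_real pi * \<i>) / \<tau>) = Re (u / \<tau>) + Re v'"
      by (simp add: diff_divide_distrib period_v_div)
    thus ?thesis using False u Re_periods defect_plus_2pi_i[of u]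
      by (intro bexI[of _ "u - 2 * of_real pi * \<i>"]) (auto simp: period_cell_def)
  qed (use u in \<open>intro bexI[of _ u]; simp\<close>)
  obtain w where w: "w \<in> period_cell" "\<bar>Re w\<bar> \<le> - Re v / 2" "norm (quasi_cot_defect w) = norm (quasi_cot_defect u)"
    using 2[OF assms] by blast
  show ?thesis
    using 3[of w] 3[of "-w"] w uminus_in_period_cell[OF w(1)] defect_minus[OF w(1)] by (cases "Re (w / \<tau>) \<ge> 0") auto
qed

text \<open>The poles of the two coth terms are the multiples of \<open>2 \<pi> \<i>\<close> and of
  \<open>v\<close>, and a nonzero multiple has a coordinate of absolute value at least 1.\<close>

lemma exp_neq_1_period_cell:
  assumes "u \<in> period_cell" "u \<noteq> 0"
  shows "exp u \<noteq> 1" "exp (u / \<tau>) \<noteq> 1"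
proof -
  show "exp u \<noteq> 1"
  proof
    assume "exp u = 1"
    then obtain n :: int where "Re u = 0" "Im u = of_int (2 * n) * pi"
      using exp_eq_1 by blast
    hence n: "u = of_int (2 * n) * of_real pi * \<i>" by (simp add: complex_eq_iff)
    hence "u / \<tau> = - of_int n * v'" by (simp add: v'_def)
    hence "\<bar>of_int n * Re v'\<bar> < - Re v'" using assms by (simp add: period_cell_def)
    hence "\<bar>real_of_int n\<bar> < 1" using Re_periods by (simp add: abs_mult)
    hence "n = 0" by linarith
    thus False using n assms by simp
  qed
  show "exp (u / \<tau>) \<noteq> 1"
  proof
    assume "exp (u / \<tau>) = 1"
    then obtain n :: int where "Re (u / \<tau>) = 0" "Im (u / \<tau>) = of_int (2 * n) * pi"
      using exp_eq_1 by blast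
    hence n: "u / \<tau> = of_int (2 * n) * of_real pi * \<i>" by (simp only: complex_eq_iff) simp
    hence "u = of_int n * v" using tau_nonzero by (simp add: v_def field_simps)
    hence "\<bar>of_int n * Re v\<bar> < - Re v" using assms by (simp add: period_cell_def)
    hence "\<bar>real_of_int n\<bar> < 1" using Re_periods by (simp add: abs_mult)
    hence "n = 0" by linarith
    thus False using n assms tau_nonzero by simp
  qed
qed

text \<open>The poles cancel, because \<open>2 / (u / \<tau>) / \<tau> = 2 / u\<close>. Once the
  defect is known to vanish, the vanishing of this limit is the law for the Eisenstein
  series.\<close>

lemma defect_limit:
  "((\<lambda>u. quasi_cot_defect u / u) \<longlongrightarrow> (1 / 6 - 4 * lambert_E (exp v')) / \<tau> ^ 2 -
      (1 / 6 - 4 * lambert_E (exp v)) - 1 / (of_real pi * \<i> * \<tau>)) (at 0)"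
proof -
  have "filterlim (\<lambda>u. u / \<tau>) (at 0) (at 0)"
    using tau_nonzero by (auto simp: filterlim_at eventually_at_filter intro!: tendsto_eq_intros)
  from filterlim_compose[OF quasi_cot_limit[OF Re_periods(2)] this]
  have "((\<lambda>u. ((quasi_cot (exp v') (u / \<tau>) - 2 / (u / \<tau>)) / (u / \<tau>)) / \<tau> ^ 2 - 
     (quasi_cot (exp v) u - 2 / u) / u - 1 / (of_real pi * \<i> * \<tau>)) \<longlongrightarrow>
    (1 / 6 - 4 * lambert_E (exp v')) / \<tau> ^ 2 - (1 / 6 - 4 * lambert_E (exp v)) - 1 / (of_real pi * \<i> * \<tau>)) (at 0)"
    by (intro tendsto_intros quasi_cot_limit Re_periods) (use tau_nonzero in auto)
  moreover have "\<forall>\<^sub>F u in at 0. ((quasi_cot (exp v') (u / \<tau>) - 2 / (u / \<tau>)) / (u / \<tau>)) / \<tau> ^ 2 - 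
     (quasi_cot (exp v) u - 2 / u) / u - 1 / (of_real pi * \<i> * \<tau>) = quasi_cot_defect u / u"
    using tau_nonzero by (auto simp: eventually_at_filter quasi_cot_defect_def divide_simps power2_eq_square) 
      (simp add: algebra_simps)
  ultimately show ?thesis by (rule Lim_transform_eventually)
qed

lemma holomorphic_defect: "quasi_cot_defect holomorphic_on period_cell"
proof (rule no_isolated_singularity'[where K = "{0}"])
  have "((\<lambda>u. u * (quasi_cot_defect u / u)) \<longlongrightarrow> 0 * ((1 / 6 - 4 * lambert_E (exp v')) / \<tau> ^ 2 -
      (1 / 6 - 4 * lambert_E (exp v)) - 1 / (of_real pi * \<i> * \<tau>))) (at 0)"
    by (intro tendsto_intros defect_limit)
  moreover have "\<forall>\<^sub>F u in at 0. u * (quasi_cot_defect u / u) = quasi_cot_defect u"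
    by (simp add: eventually_at_filter)
  ultimately have "(quasi_cot_defect \<longlongrightarrow> 0) (at 0)"
    using Lim_transform_eventually by fastforce
  thus "(quasi_cot_defect \<longlongrightarrow> quasi_cot_defect z) (at z within period_cell)" if "z \<in> {0}" for z
    using that by (auto simp: quasi_cot_defect_def intro: tendsto_within_subset)
  have "(\<lambda>u. ((exp (u / \<tau>) + 1) / (exp (u / \<tau>) - 1) - 2 * (lambert_sin (exp v') \<circ> (\<lambda>u. u / \<tau>)) u) / \<tau>
     - ((exp u + 1) / (exp u - 1) - 2 * lambert_sin (exp v) u) - u / (of_real pi * \<i> * \<tau>)) holomorphic_on period_cell - {0}"
    by (intro holomorphic_intros holomorphic_on_compose_gen[OF _ holomorphic_lambert_sin]
        holomorphic_on_subset[OF holomorphic_lambert_sin])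
       (use tau_nonzero exp_neq_1_period_cell in \<open>auto simp: period_cell_def\<close>)
  thus "quasi_cot_defect holomorphic_on period_cell - {0}"
    by (rule holomorphic_transform) (auto simp: quasi_cot_defect_def quasi_cot_def)
qed (auto intro: open_period_cell)

text \<open>The halved cell \<open>K\<close> is compact and lies in the open cell, and the norm
  takes no other values on the cell than on \<open>K\<close>. So the maximum is attained at an
  interior point, the defect is constant, and its value at 0 is 0.\<close>

lemma defect_eq_0:
  assumes "u \<in> period_cell"
  shows "quasi_cot_defect u = 0"
proof -
  define K where "K = {u. \<bar>Re u\<bar> \<le> - Re v / 2 \<and> \<bar>Re (u / \<tau>)\<bar> \<le> - Re v' / 2}"
  have K_sub: "K \<subseteq> period_cell" using Re_periods by (auto simp: K_def period_cell_def)
  have "closed K" unfolding K_def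
    by (intro closed_Collect_conj closed_Collect_le continuous_intros) (use tau_nonzero in auto)
  moreover have "bounded K"
  proof -
    have "norm u \<le> - Re v / 2 + (- Re v' / 2 * (norm \<tau>)^2 + - Re v / 2 * \<bar>Re \<tau>\<bar>) / Im \<tau>" if "u \<in> K" for u
    proof -
      have "Re (u / \<tau>) * (norm \<tau>)^2 = Re u * Re \<tau> + Im u * Im \<tau>"
        using tau_nonzero by (simp add: Re_divide cmod_def complex_eq_iff)
      hence "\<bar>Im u\<bar> * Im \<tau> = \<bar>Re (u / \<tau>) * (norm \<tau>)^2 - Re u * Re \<tau>\<bar>" using tau by (simp add: abs_mult)
      also have "\<dots> \<le> \<bar>Re (u / \<tau>)\<bar> * (norm \<tau>)^2 + \<bar>Re u\<bar> * \<bar>Re \<tau>\<bar>"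
        by (rule order.trans[OF abs_triangle_ineq4]) (simp add: abs_mult)
      also have "\<dots> \<le> - Re v' / 2 * (norm \<tau>)^2 + - Re v / 2 * \<bar>Re \<tau>\<bar>"
        using that by (intro add_mono mult_right_mono) (auto simp: K_def)
      finally have "\<bar>Im u\<bar> \<le> (- Re v' / 2 * (norm \<tau>)^2 + - Re v / 2 * \<bar>Re \<tau>\<bar>) / Im \<tau>"
        using tau by (simp add: field_simps)
      thus ?thesis using that cmod_le[of u] by (auto simp: K_def)
    qed
    thus ?thesis by (auto simp: bounded_iff)
  qed
  ultimately have "compact K" by (simp add: compact_eq_bounded_closed)
  moreover have "0 \<in> K" using Re_periods by (auto simp: K_def)
  moreover have "continuous_on K (\<lambda>u. norm (quasi_cot_defect u))"
    using K_sub by (intro continuous_intros holomorphic_on_imp_continuous_on holomorphic_on_subset[OF holomorphic_defect])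
  ultimately obtain u0 where u0: "u0 \<in> K" "\<And>u. u \<in> K \<Longrightarrow> norm (quasi_cot_defect u) \<le> norm (quasi_cot_defect u0)"
    using continuous_attains_sup[of K "\<lambda>u. norm (quasi_cot_defect u)"] by auto
  have "quasi_cot_defect constant_on period_cell"
  proof (rule maximum_modulus_principle[OF holomorphic_defect])
    show "norm (quasi_cot_defect z) \<le> norm (quasi_cot_defect u0)" if "z \<in> period_cell" for z
      using reduce_period_cell[OF that] u0(2) by (fastforce simp: K_def)
  qed (use u0 K_sub open_period_cell convex_connected[OF convex_period_cell] in auto)
  moreover have "0 \<in> period_cell" using Re_periods by (auto simp: period_cell_def)
  ultimately have "quasi_cot_defect u = quasi_cot_defect 0" 
    using assms unfolding constant_on_def by metis
  thus ?thesis by (simp add: quasi_cot_defect_def)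
qed

lemma lambert_E_transform_aux:
  "(1 / 6 - 4 * lambert_E (exp v')) / \<tau> ^ 2 = 1 / 6 - 4 * lambert_E (exp v) + 1 / (of_real pi * \<i> * \<tau>)"
proof -
  have "\<forall>\<^sub>F u in at 0. u \<in> period_cell - {0}" 
    using open_period_cell Re_periods by (intro eventually_at_in_open) (auto simp: period_cell_def)
  hence "\<forall>\<^sub>F u in at 0. quasi_cot_defect u / u = 0"
    by eventually_elim (use defect_eq_0 in auto)
  hence "((\<lambda>u. quasi_cot_defect u / u) \<longlongrightarrow> 0) (at 0)" by (rule tendsto_eventually)
  from tendsto_unique[OF _ defect_limit this] show ?thesis by (simp add: algebra_simps)
qed

end

lemma lambert_E_transform:
  assumes "Im \<tau> > 0"
  shows "1 / 6 - 4 * lambert_E (exp (2 * of_real pi * \<i> * (- 1 / \<tau>))) =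
     \<tau> ^ 2 * (1 / 6 - 4 * lambert_E (exp (2 * of_real pi * \<i> * \<tau>))) + \<tau> / (of_real pi * \<i>)"
proof -
  have *: "\<tau> \<noteq> 0" using assms by auto
  have "x = \<tau> ^ 2 * y + \<tau> / (of_real pi * \<i>)" if "x / \<tau> ^ 2 = y + 1 / (of_real pi * \<i> * \<tau>)" for x y
    using that * by (simp add: divide_simps power2_eq_square split: if_splits) (simp add: algebra_simps)
  from this[OF lambert_E_transform_aux[OF assms]] show ?thesis by simp
qed

section \<open>The Dedekind eta function\<close>

definition nome :: "complex \<Rightarrow> complex" where
  "nome \<tau> = exp (2 * of_real pi * \<i> * \<tau>)"

lemma nome_nonzero [simp]: "nome \<tau> \<noteq> 0"
  by (simp add: nome_def)

lemma norm_nome: "norm (nome \<tau>) = exp (- (2 * pi * Im \<tau>))"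
  by (simp add: nome_def)

lemma norm_nome_less_1: "Im \<tau> > 0 \<Longrightarrow> norm (nome \<tau>) < 1"
  by (simp add: norm_nome)

lemma nome_of_nat_mult: "nome (of_nat k * \<tau>) = nome \<tau> ^ k"
  by (simp add: nome_def flip: exp_of_nat_mult) (simp add: mult_ac)

lemma nome_numeral_mult: "nome (numeral k * \<tau>) = nome \<tau> ^ numeral k"
  using nome_of_nat_mult[of "numeral k"] by simp

lemma nome_deriv: "(nome has_field_derivative 2 * of_real pi * \<i> * nome \<tau>) (at \<tau> within A)"
  unfolding nome_def [abs_def] by (auto intro!: derivative_eq_intros)

lemma holomorphic_nome [holomorphic_intros]: "f holomorphic_on A \<Longrightarrow> (\<lambda>x. nome (f x)) holomorphic_on A"
  unfolding nome_def by (intro holomorphic_intros)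

lemma in_upper_half_plane [simp]: "\<tau> \<in> upper_half_plane \<longleftrightarrow> Im \<tau> > 0"
  by (simp add: upper_half_plane_def)

lemma open_upper_half_plane: "open upper_half_plane"
  by (simp add: upper_half_plane_def open_halfspace_Im_gt)

lemma convex_upper_half_plane: "convex upper_half_plane"
  by (simp add: upper_half_plane_def convex_halfspace_Im_gt)

lemma dedekind_eta_eq: "dedekind_eta \<tau> = exp (2 * of_real pi * \<i> * \<tau> / 24) * euler_prod (nome \<tau>)"
proof -
  have "exp (2 * of_real pi * \<i> * of_nat (n + 1) * \<tau>) = nome \<tau> ^ (n + 1)" for n
    using nome_of_nat_mult[of "n + 1" \<tau>] by (simp only: nome_def mult_ac)
  thus ?thesis unfolding dedekind_eta_def euler_prod_def by (simp only:)
qed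

lemma dedekind_eta_nonzero: "Im \<tau> > 0 \<Longrightarrow> dedekind_eta \<tau> \<noteq> 0"
  by (simp add: dedekind_eta_eq euler_prod_nonzero norm_nome_less_1)

lemma holomorphic_on_nome_compose:
  assumes "F holomorphic_on ball 0 1"
  shows "(\<lambda>\<tau>. F (nome \<tau>)) holomorphic_on upper_half_plane"
  using holomorphic_on_compose_gen[OF holomorphic_nome[OF holomorphic_on_ident] assms, of upper_half_plane]
  by (force simp: o_def norm_nome_less_1)

text \<open>The logarithmic derivative of eta is \<open>\<pi> \<i> / 12\<close> times the Eisenstein
  series of weight two.\<close>

lemma dedekind_eta_deriv:
  assumes "Im \<tau> > 0"
  shows "(dedekind_eta has_field_derivative
     of_real pi * \<i> / 2 * (1 / 6 - 4 * lambert_E (nome \<tau>)) * dedekind_eta \<tau>) (at \<tau>)"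
proof -
  have q: "norm (nome \<tau>) < 1" using norm_nome_less_1[OF assms] .
  have "(euler_prod has_field_derivative deriv euler_prod (nome \<tau>)) (at (nome \<tau>))"
    using q by (intro holomorphic_derivI[OF holomorphic_euler_prod]) auto
  from DERIV_chain2[OF this nome_deriv]
  have *: "((\<lambda>\<tau>. euler_prod (nome \<tau>)) has_field_derivative 
     deriv euler_prod (nome \<tau>) * (2 * of_real pi * \<i> * nome \<tau>)) (at \<tau>)" .
  have "(\<lambda>k. - nome \<tau> * (- of_nat (k + 1) * nome \<tau> ^ k / (1 - nome \<tau> ^ (k + 1)))) 
      sums (- nome \<tau> * (deriv euler_prod (nome \<tau>) / euler_prod (nome \<tau>)))"
    by (intro sums_mult logderiv_euler_prod q)
  moreover have "(\<lambda>k. - nome \<tau> * (- of_nat (k + 1) * nome \<tau> ^ k / (1 - nome \<tau> ^ (k + 1)))) = 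
      (\<lambda>k. of_nat (k + 1) * nome \<tau> ^ (k + 1) / (1 - nome \<tau> ^ (k + 1)))"
  proof -
    have "- c * (- k * p / z) = k * (p * c) / z" for c k p z :: complex by (simp add: field_simps)
    thus ?thesis by (simp only: power_add power_one_right)
  qed
  ultimately have L: "lambert_E (nome \<tau>) = - nome \<tau> * (deriv euler_prod (nome \<tau>) / euler_prod (nome \<tau>))"
    unfolding lambert_E_def by (simp only: sums_iff)
  have "(dedekind_eta has_field_derivative (2 * of_real pi * \<i> / 24) * exp (2 * of_real pi * \<i> * \<tau> / 24) *
     euler_prod (nome \<tau>) + exp (2 * of_real pi * \<i> * \<tau> / 24) * (deriv euler_prod (nome \<tau>) * (2 * of_real pi * \<i> * nome \<tau>))) (at \<tau>)"
    unfolding dedekind_eta_eq [abs_def] by (rule derivative_eq_intros * refl | simp)+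
  also have "(2 * of_real pi * \<i> / 24) * exp (2 * of_real pi * \<i> * \<tau> / 24) *
     euler_prod (nome \<tau>) + exp (2 * of_real pi * \<i> * \<tau> / 24) * (deriv euler_prod (nome \<tau>) * (2 * of_real pi * \<i> * nome \<tau>))
    = of_real pi * \<i> / 2 * (1 / 6 - 4 * lambert_E (nome \<tau>)) * dedekind_eta \<tau>"
    using euler_prod_nonzero[OF q] unfolding L dedekind_eta_eq by (simp add: field_simps)
  finally show ?thesis .
qed

lemma Im_minus_inverse: "Im (- 1 / \<tau>) = Im \<tau> / (norm \<tau>)\<^sup>2"
  by (simp add: Im_divide cmod_def)

lemma Im_minus_inverse_pos: "Im \<tau> > 0 \<Longrightarrow> Im (- 1 / \<tau>) > 0"
  unfolding Im_minus_inverse by (intro divide_pos_pos) auto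

text \<open>The quotient of the two sides has derivative zero by the law for the Eisenstein series,
  and the constant is found at the fixed point \<open>\<i>\<close>.\<close>

theorem dedekind_eta_minus_inverse:
  assumes tau: "Im \<tau> > 0"
  shows "dedekind_eta (- 1 / \<tau>) = csqrt (- \<i> * \<tau>) * dedekind_eta \<tau>"
proof -
  define h where "h = (\<lambda>\<tau>. dedekind_eta (- 1 / \<tau>) / (csqrt (- \<i> * \<tau>) * dedekind_eta \<tau>))"
  have "(h has_field_derivative 0) (at t within upper_half_plane)" if "t \<in> upper_half_plane" for t
  proof -
    from that have t: "Im t > 0" "t \<noteq> 0" by auto
    define G where "G = (\<lambda>\<tau>. 1 / 6 - 4 * lambert_E (nome \<tau>))"
    have G: "G (- 1 / t) = t ^ 2 * G t + t / (of_real pi * \<i>)"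
      unfolding G_def nome_def by (rule lambert_E_transform[OF t(1)])
    have "((\<lambda>t. - 1 / t) has_field_derivative 1 / t ^ 2) (at t)"
      using t by (auto intro!: derivative_eq_intros simp: power2_eq_square)
    from DERIV_chain2[OF dedekind_eta_deriv[OF Im_minus_inverse_pos[OF t(1)]] this]
    have d1: "((\<lambda>t. dedekind_eta (- 1 / t)) has_field_derivative
       of_real pi * \<i> / 2 * G (- 1 / t) * dedekind_eta (- 1 / t) * (1 / t ^ 2)) (at t)"
      by (simp add: G_def)
    have "- \<i> * t \<notin> \<real>\<^sub>\<le>\<^sub>0" using t by (auto simp: complex_nonpos_Reals_iff)
    hence "(csqrt has_field_derivative inverse (2 * csqrt (- \<i> * t))) (at (- \<i> * t))"
      by (rule has_field_derivative_csqrt)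
    moreover have "((\<lambda>t. - \<i> * t) has_field_derivative - \<i>) (at t)"
      by (auto intro!: derivative_eq_intros)
    ultimately have "((\<lambda>t. csqrt (- \<i> * t)) has_field_derivative inverse (2 * csqrt (- \<i> * t)) * (- \<i>)) (at t)"
      by (rule DERIV_chain2)
    hence d2: "((\<lambda>t. csqrt (- \<i> * t)) has_field_derivative 1 / (2 * csqrt (- \<i> * t)) * (- \<i>)) (at t)"
      by (simp only: inverse_eq_divide)
    have nz: "csqrt (- \<i> * t) \<noteq> 0" "dedekind_eta t \<noteq> 0" using t dedekind_eta_nonzero by auto
    have d3: "(dedekind_eta has_field_derivative of_real pi * \<i> / 2 * G t * dedekind_eta t) (at t)"
      using dedekind_eta_deriv[OF t(1)] by (simp add: G_def)
    have d23: "((\<lambda>t. csqrt (- \<i> * t) * dedekind_eta t) has_field_derivative 1 / (2 * csqrt (- \<i> * t)) * (- \<i>) * dedekind_eta t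
         + csqrt (- \<i> * t) * (of_real pi * \<i> / 2 * G t * dedekind_eta t)) (at t)"
      using DERIV_mult'[OF d2 d3] by (simp only: add.commute)
    have *: "(h has_field_derivative ((of_real pi * \<i> / 2 * G (- 1 / t) * dedekind_eta (- 1 / t) * (1 / t ^ 2)) *
        (csqrt (- \<i> * t) * dedekind_eta t) - dedekind_eta (- 1 / t) * (1 / (2 * csqrt (- \<i> * t)) * (- \<i>) * dedekind_eta t
         + csqrt (- \<i> * t) * (of_real pi * \<i> / 2 * G t * dedekind_eta t))) / 
        ((csqrt (- \<i> * t) * dedekind_eta t) * (csqrt (- \<i> * t) * dedekind_eta t))) (at t)"
      unfolding h_def using nz
      by (intro DERIV_divide d1 d23) auto
    define s where "s = csqrt (- \<i> * t)"
    have s: "s ^ 2 = - \<i> * t" by (simp add: s_def)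
    \<comment> \<open>The inhomogeneous term of the law for \<open>G\<close> contributes
      \<open>1 / (2 t)\<close>, which is the logarithmic derivative of
      \<open>csqrt (- \<i> * t)\<close>.\<close>
    have "(of_real pi * \<i> / 2 * (t ^ 2 * G t + t / (of_real pi * \<i>)) * (1 / t ^ 2)) * s = 
        1 / (2 * s) * (- \<i>) + s * (of_real pi * \<i> / 2 * G t)"
    proof -
      have "of_real pi * \<i> / 2 * (t ^ 2 * G t + t / (of_real pi * \<i>)) * (1 / t ^ 2) = of_real pi * \<i> / 2 * G t + 1 / (2 * t)"
        using t by (simp add: field_simps power2_eq_square)
      moreover have "s / (2 * t) = 1 / (2 * s) * (- \<i>)"
        using s t nz(1)[folded s_def] by (simp add: divide_simps power2_eq_square)
      ultimately show ?thesis by (simp add: algebra_simps)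
    qed
    hence "(of_real pi * \<i> / 2 * G (- 1 / t) * dedekind_eta (- 1 / t) * (1 / t ^ 2)) *
        (csqrt (- \<i> * t) * dedekind_eta t) - dedekind_eta (- 1 / t) * (1 / (2 * csqrt (- \<i> * t)) * (- \<i>) * dedekind_eta t
         + csqrt (- \<i> * t) * (of_real pi * \<i> / 2 * G t * dedekind_eta t)) = 0"
      unfolding G s_def [symmetric] by algebra
    with * have "(h has_field_derivative 0) (at t)" by (simp only: div_0)
    thus ?thesis by (rule has_field_derivative_at_within)
  qed
  from has_field_derivative_zero_constant[OF convex_upper_half_plane this]
  obtain c where c: "\<And>t. Im t > 0 \<Longrightarrow> h t = c" by auto
  have "h \<i> = 1" using dedekind_eta_nonzero[of \<i>] by (simp add: h_def)
  hence "h \<tau> = 1" using c[of \<i>] c[OF tau] by simp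
  thus ?thesis using dedekind_eta_nonzero[OF tau] tau by (auto simp: h_def divide_simps split: if_splits)
qed

lemma csqrt_of_nat_mult:
  assumes "Im \<tau> > 0"
  shows "csqrt (- \<i> * (of_nat k * \<tau>)) = of_real (sqrt k) * csqrt (- \<i> * \<tau>)"
proof (rule csqrt_unique)
  have "(complex_of_real (sqrt (real k)))\<^sup>2 = of_nat k"
    by (simp flip: of_real_power)
  thus "(of_real (sqrt k) * csqrt (- \<i> * \<tau>))\<^sup>2 = - \<i> * (of_nat k * \<tau>)"
    by (simp add: power_mult_distrib)
  have "cmod (\<i> * \<tau>) + Im \<tau> > 0"
    using assms by (intro add_nonneg_pos) auto
  thus "0 < Re (of_real (sqrt k) * csqrt (- \<i> * \<tau>)) \<or> Re (of_real (sqrt k) * csqrt (- \<i> * \<tau>)) = 0 \<and> 0 \<le> Im (of_real (sqrt k) * csqrt (- \<i> * \<tau>))"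
    using csqrt_principal[of "- \<i> * \<tau>"]
    by (cases "k = 0") (auto simp: zero_less_mult_iff)
qed

lemma dedekind_eta_minus_inverse_of_nat:
  assumes "Im \<tau> > 0" "k > 0"
  shows "dedekind_eta (- 1 / (of_nat k * \<tau>)) = of_real (sqrt k) * csqrt (- \<i> * \<tau>) * dedekind_eta (of_nat k * \<tau>)"
  using dedekind_eta_minus_inverse[of "of_nat k * \<tau>"] csqrt_of_nat_mult[of \<tau> k] assms by simp

section \<open>Functions permuted by Atkin-Lehner involutions\<close>

text \<open>The inversions enlarge the imaginary part inside the circles about 0 and 1/2 of squared
  radius 1/6 and 1/12. The integer translates of these discs cover every line at height below 1/5,
  with a margin that gives a fixed factor of growth.\<close>

lemma atkin_lehner_raises_Im:
  assumes "Im \<tau> > 0" "Im \<tau> < 1 / 5"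
  obtains k :: int where
    "Im (- 1 / (6 * (\<tau> + of_int k))) \<ge> 11 / 10 * Im \<tau>"
  | k :: int where "Im (1 / 2 - 1 / (12 * (\<tau> + of_int k - 1 / 2))) \<ge> 11 / 10 * Im \<tau>"
proof -
  \<comment> \<open>Puts x between -1/3 and 2/3, hence within 1/3 of 0 or within 1/6 of 1/2. With y
    below 1/5 the denominators are at most \<open>6 (1/9 + 1/25)\<close> and
    \<open>12 (1/36 + 1/25)\<close>, both below 10/11; this fixes the constants 1/5 and
    11/10.\<close>
  define k where "k = - \<lfloor>Re \<tau> + 1 / 3\<rfloor>"
  define x y where "x = Re \<tau> + k" and "y = Im \<tau>"
  have x: "- 1 / 3 \<le> x" "x \<le> 2 / 3" by (auto simp: x_def k_def) linarith+
  have y: "y > 0" "y < 1 / 5" using assms by (auto simp: y_def)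
  have y2: "y * y < 1 / 5 * (1 / 5)" using y by (intro mult_strict_mono) auto
  have I1: "Im (- 1 / (6 * (\<tau> + of_int k))) = y / (6 * (x\<^sup>2 + y\<^sup>2))"
  proof -
    have "(norm (6 * (\<tau> + of_int k)))\<^sup>2 = 6 * (6 * (x\<^sup>2 + y\<^sup>2))"
      unfolding cmod_power2 by (simp add: x_def y_def power2_eq_square algebra_simps)
    moreover have "Im (6 * (\<tau> + of_int k)) = 6 * y" by (simp add: y_def)
    ultimately show ?thesis unfolding Im_minus_inverse by (simp only: mult_divide_mult_cancel_left[of 6] zero_neq_numeral not_False_eq_True)
  qed
  have I2: "Im (1 / 2 - 1 / (12 * (\<tau> + of_int k - 1 / 2))) = y / (12 * ((x - 1 / 2)\<^sup>2 + y\<^sup>2))"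
  proof -
    have "(norm (12 * (\<tau> + of_int k - 1 / 2)))\<^sup>2 = 12 * (12 * ((x - 1 / 2)\<^sup>2 + y\<^sup>2))"
      unfolding cmod_power2 by (simp add: x_def y_def power2_eq_square algebra_simps)
    moreover have "Im (12 * (\<tau> + of_int k - 1 / 2)) = 12 * y" by (simp add: y_def)
    moreover have "Im (1 / 2 - 1 / (12 * (\<tau> + of_int k - 1 / 2))) = Im (- 1 / (12 * (\<tau> + of_int k - 1 / 2)))"
      by simp
    ultimately show ?thesis unfolding Im_minus_inverse
      by (simp only: mult_divide_mult_cancel_left[of 12] zero_neq_numeral not_False_eq_True)
  qed
  show ?thesis
  proof (cases "x \<le> 1 / 3")
    case True
    hence "x\<^sup>2 \<le> (1 / 3)\<^sup>2" using x by (intro abs_le_square_iff[THEN iffD1]) auto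
    hence "6 * (x\<^sup>2 + y\<^sup>2) \<le> 10 / 11" using y2 by (simp add: power2_eq_square)
    moreover have "6 * (x\<^sup>2 + y\<^sup>2) > 0" using y by (simp add: add_nonneg_pos)
    ultimately have "11 / 10 * y \<le> y / (6 * (x\<^sup>2 + y\<^sup>2))"
      using y mult_left_mono[of "6 * (x\<^sup>2 + y\<^sup>2)" "10 / 11" "11 / 10 * y"] by (simp add: field_simps)
    thus ?thesis by (intro that(1)[of k]) (simp only: I1 y_def [symmetric])
  next
    case False
    hence "\<bar>x - 1 / 2\<bar> \<le> \<bar>1 / 6\<bar>" using x by linarith
    hence "(x - 1 / 2)\<^sup>2 \<le> (1 / 6)\<^sup>2" by (simp only: abs_le_square_iff)
    hence "12 * ((x - 1 / 2)\<^sup>2 + y\<^sup>2) \<le> 10 / 11" using y2 by (simp add: power2_eq_square)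
    moreover have "12 * ((x - 1 / 2)\<^sup>2 + y\<^sup>2) > 0" using y by (simp add: add_nonneg_pos)
    ultimately have "11 / 10 * y \<le> y / (12 * ((x - 1 / 2)\<^sup>2 + y\<^sup>2))"
      using y mult_left_mono[of "12 * ((x - 1 / 2)\<^sup>2 + y\<^sup>2)" "10 / 11" "11 / 10 * y"] by (simp add: field_simps)
    thus ?thesis by (intro that(2)[of k]) (simp only: I2 y_def [symmetric])
  qed
qed

lemma nome_plus_of_int: "nome (\<tau> + of_int k) = nome \<tau>"
proof -
  have "exp (2 * of_real pi * \<i> * of_int k) = 1"
    using exp_integer_2pi[of "of_int k"] by (simp add: mult_ac)
  thus ?thesis by (simp add: nome_def distrib_left exp_add)
qed

definition W6 :: "complex \<Rightarrow> complex" where "W6 \<tau> = - 1 / (6 * \<tau>)"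

text \<open>The Atkin-Lehner involution of level 6 with matrix rows (3, -2) and (6, -3), of
  determinant 3, written as an inversion about the cusp 1/2.\<close>

definition W3 :: "complex \<Rightarrow> complex" where "W3 \<tau> = 1 / 2 - 1 / (12 * (\<tau> - 1 / 2))"

lemma W6_W6: "\<tau> \<noteq> 0 \<Longrightarrow> W6 (W6 \<tau>) = \<tau>"
  by (simp add: W6_def)

lemma W3_W3:
  assumes "\<tau> \<noteq> 1 / 2"
  shows "W3 (W3 \<tau>) = \<tau>"
proof -
  have "1 / 2 - 1 / (12 * (1 / 2 - 1 / (12 * s) - 1 / 2)) = 1 / 2 + s" if "s \<noteq> 0" for s :: complex
    using that by simp
  from this[of "\<tau> - 1 / 2"] show ?thesis using assms by (simp only: W3_def) simp
qed

lemma Im_W6_pos: "Im \<tau> > 0 \<Longrightarrow> Im (W6 \<tau>) > 0"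
  using Im_minus_inverse_pos[of "6 * \<tau>"] by (simp add: W6_def)

lemma Im_W3_pos: "Im \<tau> > 0 \<Longrightarrow> Im (W3 \<tau>) > 0"
  using Im_minus_inverse_pos[of "12 * (\<tau> - 1 / 2)"] by (simp add: W3_def)

lemma nome_surj:
  assumes "q \<in> ball 0 1" "q \<noteq> 0"
  obtains \<tau> where "Im \<tau> > 0" "nome \<tau> = q"
proof -
  define \<tau> where "\<tau> = Ln q / (2 * of_real pi * \<i>)"
  have q: "nome \<tau> = q" using assms by (simp add: \<tau>_def nome_def)
  moreover have "norm (nome \<tau>) < 1" using q assms by simp
  hence "Im \<tau> > 0" by (simp add: norm_nome zero_less_mult_iff)
  ultimately show ?thesis using that by blast
qed

text \<open>
  Valence argument in its simplest form: since every orbit of the two involutions and of the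
  translations meets the half-plane above height 1/5, the maximum modulus of a family that is
  permuted by the involutions is attained on a compact disc in the nome.
\<close>

lemma atkin_lehner_family_constant:
  fixes \<Phi> :: "'i \<Rightarrow> complex \<Rightarrow> complex"
  assumes I: "finite I" "I \<noteq> {}"
    and holo: "\<And>i. i \<in> I \<Longrightarrow> \<Phi> i holomorphic_on ball 0 1"
    and w6: "\<And>i. i \<in> I \<Longrightarrow> \<exists>j\<in>I. \<forall>\<tau>. Im \<tau> > 0 \<longrightarrow> \<Phi> i (nome (W6 \<tau>)) = \<Phi> j (nome \<tau>)"
    and w3: "\<And>i. i \<in> I \<Longrightarrow> \<exists>j\<in>I. \<forall>\<tau>. Im \<tau> > 0 \<longrightarrow> \<Phi> i (nome (W3 \<tau>)) = \<Phi> j (nome \<tau>)"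
  shows "\<exists>i\<in>I. \<Phi> i constant_on ball 0 1"
proof -
  \<comment> \<open>The absolute value of the nome at height 1/5.\<close>
  define r where "r = exp (- (2 * pi / 5))"
  have r: "r < 1" "r > 0" by (auto simp: r_def)
  have sub: "cball 0 r \<subseteq> (ball 0 1 :: complex set)" using r by auto
  have "\<exists>q\<in>cball 0 r. \<forall>q'\<in>cball 0 r. norm (\<Phi> i q') \<le> norm (\<Phi> i q)" if "i \<in> I" for i
    using r sub
    by (intro continuous_attains_sup continuous_intros holomorphic_on_imp_continuous_on
          holomorphic_on_subset[OF holo[OF that]]) auto
  then obtain x where x: "\<And>i. i \<in> I \<Longrightarrow> x i \<in> cball 0 r"
    "\<And>i q. i \<in> I \<Longrightarrow> q \<in> cball 0 r \<Longrightarrow> norm (\<Phi> i q) \<le> norm (\<Phi> i (x i))" by metis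
  define M where "M = Max ((\<lambda>i. norm (\<Phi> i (x i))) ` I)"
  have M: "norm (\<Phi> i q) \<le> M" if "i \<in> I" "norm q \<le> r" for i q
    using x(2)[of i q] that I by (auto simp: M_def intro: order.trans[OF _ Max_ge])
  have "M \<in> (\<lambda>i. norm (\<Phi> i (x i))) ` I" unfolding M_def using I by (intro Max_in) auto
  then obtain i0 where i0: "i0 \<in> I" "norm (\<Phi> i0 (x i0)) = M" by auto
  \<comment> \<open>Here \<open>n\<close> bounds the number of involutions needed: each raises the
    imaginary part by the factor 11/10 and replaces \<open>\<Phi> i\<close> by another member of the
    family.\<close>
  have bound: "norm (\<Phi> i (nome \<tau>)) \<le> M" 
    if "i \<in> I" "Im \<tau> > 0" "Im \<tau> * (11 / 10) ^ n \<ge> 1 / 5" for i \<tau> n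
    using that
  proof (induction n arbitrary: i \<tau>)
    case 0
    thus ?case by (intro M) (auto simp: norm_nome r_def)
  next
    case (Suc n)
    show ?case
    proof (cases "Im \<tau> < 1 / 5")
      case False
      thus ?thesis using Suc.prems by (intro M) (auto simp: norm_nome r_def)
    next
      case True
      have step: "norm (\<Phi> i (nome \<tau>)) \<le> M" 
        if W: "W \<in> {W6, W3}" and k: "Im (W (\<tau> + of_int k)) \<ge> 11 / 10 * Im \<tau>" for W k
      proof -
        let ?s = "\<tau> + of_int k"
        have s: "Im (W ?s) > 0" using k Suc.prems(2) by linarith
        have "?s \<noteq> 0" "?s \<noteq> 1 / 2" using Suc.prems(2) by (auto simp: complex_eq_iff)
        hence WW: "W (W ?s) = ?s" using W by (auto simp: W6_W6 W3_W3)
        obtain j where j: "j \<in> I" "\<And>\<tau>. Im \<tau> > 0 \<Longrightarrow> \<Phi> i (nome (W \<tau>)) = \<Phi> j (nome \<tau>)"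
          using w6[OF Suc.prems(1)] w3[OF Suc.prems(1)] W by auto
        have "1 / 5 \<le> (11 / 10 * Im \<tau>) * (11 / 10) ^ n" using Suc.prems(3) by (simp add: mult_ac)
        also have "\<dots> \<le> Im (W ?s) * (11 / 10) ^ n" using k by (intro mult_right_mono) auto
        finally have "norm (\<Phi> j (nome (W ?s))) \<le> M" by (intro Suc.IH j s)
        also have "\<Phi> j (nome (W ?s)) = \<Phi> i (nome \<tau>)"
          using j(2)[OF s] WW by (simp add: nome_plus_of_int)
        finally show ?thesis .
      qed
      from atkin_lehner_raises_Im[OF Suc.prems(2) True] show ?thesis
        using step[of W6] step[of W3] by (auto simp: W6_def W3_def)
    qed
  qed
  have global: "norm (\<Phi> i0 q) \<le> norm (\<Phi> i0 (x i0))" if "q \<in> ball 0 1" for q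
  proof (cases "q = 0")
    case False
    obtain \<tau> where \<tau>: "Im \<tau> > 0" "nome \<tau> = q" using nome_surj \<open>q \<in> ball 0 1\<close> False by blast
    moreover obtain n where "1 / 5 / Im \<tau> < (11 / 10) ^ n"
      using real_arch_pow[of "11 / 10"] by auto
    ultimately show ?thesis
      using bound[of i0 \<tau> n] i0 by (simp add: field_simps)
  qed (use M i0 r in auto)
  have "\<Phi> i0 constant_on ball 0 1"
    by (rule maximum_modulus_principle[where U = "ball 0 1" and \<xi> = "x i0"])
       (use global holo[OF i0(1)] x(1)[OF i0(1)] sub in auto)
  thus ?thesis using i0 by blast
qed

text \<open>The nome takes every value of the disc except 0; the cusp itself is reached by
  continuity.\<close>

lemma const_on_disc_transfer:
  assumes "F holomorphic_on ball 0 1" "\<And>\<tau>. Im \<tau> > 0 \<Longrightarrow> F (nome \<tau>) = c" "q \<in> ball 0 1"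
  shows "F q = c"
proof -
  have "continuous_on (ball 0 1) F" using assms(1) by (rule holomorphic_on_imp_continuous_on)
  moreover have punctured: "F x = c" if "x \<in> ball 0 1 - {0}" for x
    using nome_surj[of x] assms(2) that by auto
  moreover have "F 0 = c"
  proof -
    have "(F \<longlongrightarrow> F 0) (at 0)"
      using calculation(1) by (simp add: continuous_on_eq_continuous_at isCont_def)
    moreover have "\<forall>\<^sub>F x in at 0. x \<in> ball 0 1 - {0::complex}" by (intro eventually_at_in_open) auto
    hence "(F \<longlongrightarrow> c) (at 0)"
      by (intro tendsto_eventually, eventually_elim) (use punctured in auto)
    ultimately show ?thesis by (rule tendsto_unique[rotated]) auto
  qed
  ultimately show ?thesis using assms(3) by (cases "q = 0") auto
qed

text \<open>The involutions act on the labels as a Klein four-group: \<open>W6\<close> exchanges 0,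
  1 and 2, 3, while \<open>W3\<close> exchanges 0, 2 and 1, 3. A constant member passes its value to
  the others along \<open>W6\<close>, \<open>W3\<close> and their composite. The functions may
  coincide, so shorter orbits are covered. One value at the cusp then decides all four.\<close>

lemma atkin_lehner_orbit_constant:
  fixes F0 F1 F2 F3 :: "complex \<Rightarrow> complex"
  assumes "F0 holomorphic_on ball 0 1" "F1 holomorphic_on ball 0 1" "F2 holomorphic_on ball 0 1" "F3 holomorphic_on ball 0 1"
    and w6: "\<And>\<tau>. Im \<tau> > 0 \<Longrightarrow> F0 (nome (W6 \<tau>)) = F1 (nome \<tau>)"
    "\<And>\<tau>. Im \<tau> > 0 \<Longrightarrow> F2 (nome (W6 \<tau>)) = F3 (nome \<tau>)"
    and w3: "\<And>\<tau>. Im \<tau> > 0 \<Longrightarrow> F0 (nome (W3 \<tau>)) = F2 (nome \<tau>)"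
    "\<And>\<tau>. Im \<tau> > 0 \<Longrightarrow> F1 (nome (W3 \<tau>)) = F3 (nome \<tau>)"
    and F: "F \<in> {F0, F1, F2, F3}" "G \<in> {F0, F1, F2, F3}" and q: "q \<in> ball 0 1" "q' \<in> ball 0 1"
  shows "F q = G q'"
proof -
  have nz: "\<tau> \<noteq> 0" "\<tau> \<noteq> 1 / 2" if "Im \<tau> > 0" for \<tau> :: complex using that by (auto simp: complex_eq_iff)
  have w6': "F1 (nome (W6 \<tau>)) = F0 (nome \<tau>)" "F3 (nome (W6 \<tau>)) = F2 (nome \<tau>)" if "Im \<tau> > 0" for \<tau>
    using w6[OF Im_W6_pos[OF that]] W6_W6[OF nz(1)[OF that]] by simp_all
  have w3': "F2 (nome (W3 \<tau>)) = F0 (nome \<tau>)" "F3 (nome (W3 \<tau>)) = F1 (nome \<tau>)" if "Im \<tau> > 0" for \<tau>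
    using w3[OF Im_W3_pos[OF that]] W3_W3[OF nz(2)[OF that]] by simp_all
  note holo = assms(1-4)
  have "\<exists>H\<in>{F0, F1, F2, F3}. (\<lambda>q. H q) constant_on ball 0 1"
    by (rule atkin_lehner_family_constant) (use w6 w6' w3 w3' holo in auto)
  then obtain H c where H: "H \<in> {F0, F1, F2, F3}" "\<And>q. q \<in> ball 0 1 \<Longrightarrow> H q = c"
    by (elim bexE) (auto simp only: constant_on_def)
  have Hc: "H (nome \<tau>) = c" if "Im \<tau> > 0" for \<tau> 
    using H(2) norm_nome_less_1[OF that] by simp
  have "F0 (nome \<tau>) = c \<and> F1 (nome \<tau>) = c \<and> F2 (nome \<tau>) = c \<and> F3 (nome \<tau>) = c" if t: "Im \<tau> > 0" for \<tau>
    using H(1) Hc[OF t] Hc[OF Im_W6_pos[OF t]] Hc[OF Im_W3_pos[OF t]] Hc[OF Im_W6_pos[OF Im_W3_pos[OF t]]]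
      w6[OF t] w6'[OF t] w3[OF t] w3'[OF t] w6[OF Im_W3_pos[OF t]] w6'[OF Im_W3_pos[OF t]] by auto
  hence "K q = c" if "K \<in> {F0, F1, F2, F3}" "q \<in> ball 0 1" for K q
    using that const_on_disc_transfer[of K c q] holo by auto
  thus ?thesis using F q by metis
qed

section \<open>Eta quotients of weight one and level six\<close>

text \<open>These are the eta quotients as functions of the nome, with the leading power of
  \<open>q\<close> removed. They are holomorphic without zeros on the whole disc and have value 1 at
  the cusp.\<close>

definition A_hat :: "complex \<Rightarrow> complex" where
  "A_hat q = euler_prod (q ^ 2) * euler_prod (q ^ 3) ^ 6 / (euler_prod q ^ 2 * euler_prod (q ^ 6) ^ 3)"
definition B_hat :: "complex \<Rightarrow> complex" where
  "B_hat q = euler_prod q ^ 6 * euler_prod (q ^ 6) / (euler_prod (q ^ 2) ^ 3 * euler_prod (q ^ 3) ^ 2)"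
definition C_hat :: "complex \<Rightarrow> complex" where
  "C_hat q = euler_prod q * euler_prod (q ^ 6) ^ 6 / (euler_prod (q ^ 2) ^ 2 * euler_prod (q ^ 3) ^ 3)"
definition D_hat :: "complex \<Rightarrow> complex" where
  "D_hat q = euler_prod (q ^ 2) ^ 6 * euler_prod (q ^ 3) / (euler_prod q ^ 3 * euler_prod (q ^ 6) ^ 2)"

definition form_A where "form_A \<tau> = A_hat (nome \<tau>)"
definition form_B where "form_B \<tau> = B_hat (nome \<tau>)"
text \<open>The only one of the four whose eta exponents leave a power of \<open>q\<close>:
  \<open>(1 + 6 * 6 - 2 * 2 - 3 * 3) / 24 = 1\<close>. This is its zero at infinity.\<close>

definition form_C where "form_C \<tau> = nome \<tau> * C_hat (nome \<tau>)"
definition form_D where "form_D \<tau> = D_hat (nome \<tau>)"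

lemma power_in_unit_disc: "q \<in> ball 0 1 \<Longrightarrow> n > 0 \<Longrightarrow> q ^ n \<in> ball (0::complex) 1"
  by (simp add: norm_power power_less_one_iff)

lemma holomorphic_euler_prod_power:
  assumes "n > 0"
  shows "(\<lambda>q. euler_prod (q ^ n)) holomorphic_on ball 0 1"
proof -
  have "(\<lambda>q. q ^ n) holomorphic_on ball 0 1" by (intro holomorphic_intros)
  from holomorphic_on_compose_gen[OF this holomorphic_euler_prod] show ?thesis
    using power_in_unit_disc[OF _ assms] by (auto simp: o_def image_subset_iff)
qed

lemma euler_prod_power_nonzero: "q \<in> ball 0 1 \<Longrightarrow> n > 0 \<Longrightarrow> euler_prod (q ^ n) \<noteq> 0"
  using power_in_unit_disc[of q n] by (intro euler_prod_nonzero) auto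

lemma holomorphic_hats:
  "A_hat holomorphic_on ball 0 1" "B_hat holomorphic_on ball 0 1"
  "C_hat holomorphic_on ball 0 1" "D_hat holomorphic_on ball 0 1"
  unfolding A_hat_def [abs_def] B_hat_def [abs_def] C_hat_def [abs_def] D_hat_def [abs_def]
  using euler_prod_power_nonzero euler_prod_nonzero
  by (auto intro!: holomorphic_intros holomorphic_euler_prod_power holomorphic_euler_prod)

lemma hats_nonzero:
  assumes "q \<in> ball 0 1"
  shows "A_hat q \<noteq> 0" "B_hat q \<noteq> 0" "C_hat q \<noteq> 0" "D_hat q \<noteq> 0"
  using euler_prod_power_nonzero[OF assms] euler_prod_nonzero[of q] assms
  by (auto simp: A_hat_def B_hat_def C_hat_def D_hat_def)

lemma hats_0 [simp]: "A_hat 0 = 1" "B_hat 0 = 1" "C_hat 0 = 1" "D_hat 0 = 1"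
  by (simp_all add: A_hat_def B_hat_def C_hat_def D_hat_def)

lemma forms_nonzero:
  assumes "Im \<tau> > 0"
  shows "form_A \<tau> \<noteq> 0" "form_B \<tau> \<noteq> 0" "form_C \<tau> \<noteq> 0" "form_D \<tau> \<noteq> 0"
  using hats_nonzero[of "nome \<tau>"] norm_nome_less_1[OF assms]
  by (auto simp: form_A_def form_B_def form_C_def form_D_def)

lemma holomorphic_forms:
  "form_A holomorphic_on upper_half_plane" "form_B holomorphic_on upper_half_plane"
  "form_C holomorphic_on upper_half_plane" "form_D holomorphic_on upper_half_plane"
  unfolding form_A_def [abs_def] form_B_def [abs_def] form_C_def [abs_def] form_D_def [abs_def]
  by (intro holomorphic_intros holomorphic_on_nome_compose holomorphic_hats)+

lemma euler_prod_nome_power: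
  "euler_prod (nome \<tau> ^ k) = dedekind_eta (of_nat k * \<tau>) / exp (2 * of_real pi * \<i> * \<tau> / 24) ^ k"
proof -
  have "exp (2 * of_real pi * \<i> * (of_nat k * \<tau>) / 24) = exp (2 * of_real pi * \<i> * \<tau> / 24) ^ k"
    by (simp flip: exp_of_nat_mult) (simp add: mult_ac)
  thus ?thesis by (simp add: dedekind_eta_eq nome_of_nat_mult)
qed

lemma nome_eq_exp_power_24: "nome \<tau> = exp (2 * of_real pi * \<i> * \<tau> / 24) ^ 24"
  by (simp add: nome_def mult_ac flip: exp_of_nat_mult)

abbreviation eta_mult :: "nat \<Rightarrow> complex \<Rightarrow> complex" where
  "eta_mult k \<tau> \<equiv> dedekind_eta (of_nat k * \<tau>)"

lemma eta_mult_nonzero: "Im \<tau> > 0 \<Longrightarrow> k > 0 \<Longrightarrow> eta_mult k \<tau> \<noteq> 0"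
  by (intro dedekind_eta_nonzero) simp

lemma forms_eta_quotient:
  assumes "Im \<tau> > 0"
  shows "form_A \<tau> = eta_mult 2 \<tau> * eta_mult 3 \<tau> ^ 6 / (eta_mult 1 \<tau> ^ 2 * eta_mult 6 \<tau> ^ 3)"
    and "form_B \<tau> = eta_mult 1 \<tau> ^ 6 * eta_mult 6 \<tau> / (eta_mult 2 \<tau> ^ 3 * eta_mult 3 \<tau> ^ 2)"
    and "form_C \<tau> = eta_mult 1 \<tau> * eta_mult 6 \<tau> ^ 6 / (eta_mult 2 \<tau> ^ 2 * eta_mult 3 \<tau> ^ 3)"
    and "form_D \<tau> = eta_mult 2 \<tau> ^ 6 * eta_mult 3 \<tau> / (eta_mult 1 \<tau> ^ 3 * eta_mult 6 \<tau> ^ 2)"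
proof -
  define x where "x = exp (2 * of_real pi * \<i> * \<tau> / 24)"
  have x: "x \<noteq> 0" by (simp add: x_def)
  note E = euler_prod_nome_power[of \<tau> 1, simplified power_one_right] euler_prod_nome_power[of \<tau> 2]
    euler_prod_nome_power[of \<tau> 3] euler_prod_nome_power[of \<tau> 6] 
  note nz = eta_mult_nonzero[OF assms, of 1] eta_mult_nonzero[OF assms, of 2] eta_mult_nonzero[OF assms, of 3] eta_mult_nonzero[OF assms, of 6]
  show "form_A \<tau> = eta_mult 2 \<tau> * eta_mult 3 \<tau> ^ 6 / (eta_mult 1 \<tau> ^ 2 * eta_mult 6 \<tau> ^ 3)"
    unfolding form_A_def A_hat_def E x_def [symmetric] using x nz 
    by (simp add: divide_simps power_mult_distrib flip: power_mult power_add)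
  show "form_B \<tau> = eta_mult 1 \<tau> ^ 6 * eta_mult 6 \<tau> / (eta_mult 2 \<tau> ^ 3 * eta_mult 3 \<tau> ^ 2)"
    unfolding form_B_def B_hat_def E x_def [symmetric] using x nz 
    by (simp add: divide_simps power_mult_distrib flip: power_mult power_add)
  show "form_C \<tau> = eta_mult 1 \<tau> * eta_mult 6 \<tau> ^ 6 / (eta_mult 2 \<tau> ^ 2 * eta_mult 3 \<tau> ^ 3)"
    unfolding form_C_def C_hat_def E unfolding nome_eq_exp_power_24 x_def [symmetric] using x nz 
    by (simp add: divide_simps power_mult_distrib flip: power_mult power_add) (simp flip: power_Suc)
  show "form_D \<tau> = eta_mult 2 \<tau> ^ 6 * eta_mult 3 \<tau> / (eta_mult 1 \<tau> ^ 3 * eta_mult 6 \<tau> ^ 2)"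
    unfolding form_D_def D_hat_def E x_def [symmetric] using x nz 
    by (simp add: divide_simps power_mult_distrib flip: power_mult power_add)
qed

text \<open>A shift by 1/2 negates the nome, and \<open>euler_prod_minus\<close> rewrites the
  factors with odd exponent, which brings in the multiples 4 and 12. About the centre 1/2 the map
  \<open>W3\<close> is \<open>\<sigma> \<mapsto> -1/(12 \<sigma>)\<close>, and this exchanges
  \<open>eta_mult k\<close> with \<open>eta_mult (12 / k)\<close>.\<close>

lemma forms_eta_quotient_shifted:
  assumes "Im \<sigma> > 0"
  shows "form_A (\<sigma> + 1 / 2) = eta_mult 1 \<sigma> ^ 2 * eta_mult 4 \<sigma> ^ 2 * eta_mult 6 \<sigma> ^ 15 /
           (eta_mult 2 \<sigma> ^ 5 * eta_mult 3 \<sigma> ^ 6 * eta_mult 12 \<sigma> ^ 6)"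
    and "form_B (\<sigma> + 1 / 2) = eta_mult 2 \<sigma> ^ 15 * eta_mult 3 \<sigma> ^ 2 * eta_mult 12 \<sigma> ^ 2 /
           (eta_mult 1 \<sigma> ^ 6 * eta_mult 4 \<sigma> ^ 6 * eta_mult 6 \<sigma> ^ 5)"
    and "form_C (\<sigma> + 1 / 2) = - (eta_mult 2 \<sigma> * eta_mult 3 \<sigma> ^ 3 * eta_mult 12 \<sigma> ^ 3 /
           (eta_mult 1 \<sigma> * eta_mult 4 \<sigma> * eta_mult 6 \<sigma> ^ 3))"
    and "form_D (\<sigma> + 1 / 2) = eta_mult 1 \<sigma> ^ 3 * eta_mult 4 \<sigma> ^ 3 * eta_mult 6 \<sigma> /
           (eta_mult 2 \<sigma> ^ 3 * eta_mult 3 \<sigma> * eta_mult 12 \<sigma>)"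
proof -
  define x where "x = exp (2 * of_real pi * \<i> * \<sigma> / 24)"
  have x: "x \<noteq> 0" by (simp add: x_def)
  define p where "p = nome \<sigma>"
  have p: "norm p < 1" "norm (p ^ 3) < 1"
    using norm_nome_less_1[OF assms] by (auto simp: p_def norm_power power_less_one_iff)
  have n: "nome (\<sigma> + 1 / 2) = - p" by (simp add: nome_def p_def distrib_left exp_add)
  have pw: "(- p) ^ 2 = p ^ 2" "(- p) ^ 3 = - (p ^ 3)" "(- p) ^ 6 = p ^ 6" 
    "(p ^ 3) ^ 2 = p ^ 6" "(p ^ 3) ^ 4 = p ^ 12" by (auto simp flip: power_mult)
  note E = euler_prod_nome_power[of \<sigma> 1, simplified power_one_right] euler_prod_nome_power[of \<sigma> 2]
    euler_prod_nome_power[of \<sigma> 3] euler_prod_nome_power[of \<sigma> 4] euler_prod_nome_power[of \<sigma> 6] euler_prod_nome_power[of \<sigma> 12]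
  note E = E[folded p_def x_def]
  note nz = eta_mult_nonzero[OF assms, of 1] eta_mult_nonzero[OF assms, of 2] eta_mult_nonzero[OF assms, of 3]
    eta_mult_nonzero[OF assms, of 4] eta_mult_nonzero[OF assms, of 6] eta_mult_nonzero[OF assms, of 12]
  note M = euler_prod_minus[OF p(1)] euler_prod_minus[OF p(2), unfolded pw]
  have p24: "p = x ^ 24" using nome_eq_exp_power_24[of \<sigma>] by (simp add: p_def x_def)
  show "form_A (\<sigma> + 1 / 2) = eta_mult 1 \<sigma> ^ 2 * eta_mult 4 \<sigma> ^ 2 * eta_mult 6 \<sigma> ^ 15 /
           (eta_mult 2 \<sigma> ^ 5 * eta_mult 3 \<sigma> ^ 6 * eta_mult 12 \<sigma> ^ 6)"
    unfolding form_A_def A_hat_def n pw M E using x nz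
    by (simp add: divide_simps power_mult_distrib power_divide flip: power_mult power_add) algebra
  show "form_B (\<sigma> + 1 / 2) = eta_mult 2 \<sigma> ^ 15 * eta_mult 3 \<sigma> ^ 2 * eta_mult 12 \<sigma> ^ 2 /
           (eta_mult 1 \<sigma> ^ 6 * eta_mult 4 \<sigma> ^ 6 * eta_mult 6 \<sigma> ^ 5)"
    unfolding form_B_def B_hat_def n pw M E using x nz
    by (simp add: divide_simps power_mult_distrib power_divide flip: power_mult power_add) algebra
  show "form_D (\<sigma> + 1 / 2) = eta_mult 1 \<sigma> ^ 3 * eta_mult 4 \<sigma> ^ 3 * eta_mult 6 \<sigma> /
           (eta_mult 2 \<sigma> ^ 3 * eta_mult 3 \<sigma> * eta_mult 12 \<sigma>)"
    unfolding form_D_def D_hat_def n pw M E using x nz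
    by (simp add: divide_simps power_mult_distrib power_divide flip: power_mult power_add) algebra
  show "form_C (\<sigma> + 1 / 2) = - (eta_mult 2 \<sigma> * eta_mult 3 \<sigma> ^ 3 * eta_mult 12 \<sigma> ^ 3 /
           (eta_mult 1 \<sigma> * eta_mult 4 \<sigma> * eta_mult 6 \<sigma> ^ 3))"
    unfolding form_C_def C_hat_def n pw M E unfolding p24 using x nz
    by (simp add: divide_simps power_mult_distrib power_divide flip: power_mult power_add) algebra
qed


lemma of_real_sqrt_numerals:
  "complex_of_real (sqrt 4) = 2" "complex_of_real (sqrt 6) = of_real (sqrt 2) * of_real (sqrt 3)"
  "complex_of_real (sqrt 12) = 2 * of_real (sqrt 3)"
proof -
  have "sqrt 4 = 2" using real_sqrt_abs[of 2] by simp
  moreover have "sqrt 6 = sqrt 2 * sqrt 3" "sqrt 12 = sqrt 4 * sqrt 3" 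
    using real_sqrt_mult[of 2 3] real_sqrt_mult[of 4 3] by simp_all
  ultimately show "complex_of_real (sqrt 4) = 2" "complex_of_real (sqrt 6) = of_real (sqrt 2) * of_real (sqrt 3)"
    "complex_of_real (sqrt 12) = 2 * of_real (sqrt 3)" by simp_all
qed

lemma eta_mult_inversion:
  assumes "Im \<tau> > 0" "k * l = n" "n > 0"
  shows "eta_mult k (- 1 / (of_nat n * \<tau>)) = of_real (sqrt l) * csqrt (- \<i> * \<tau>) * eta_mult l \<tau>"
proof -
  have "of_nat k * (- 1 / (of_nat n * \<tau>)) = - 1 / (of_nat l * \<tau>)"
    using assms by (auto simp flip: assms(2))
  thus ?thesis using dedekind_eta_minus_inverse_of_nat[of \<tau> l] assms by (auto simp: zero_less_mult_iff)
qed

abbreviation "\<rho> \<equiv> complex_of_real (sqrt 3)"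

lemma rho_sq: "\<rho> ^ 2 = 3" "\<rho> \<noteq> 0"
  by (simp_all flip: of_real_power)

lemma powers_via_square:
  fixes x :: complex
  shows "x ^ 3 = x\<^sup>2 * x" "x ^ 5 = (x\<^sup>2) ^ 2 * x" "x ^ 6 = (x\<^sup>2) ^ 3" "x ^ 8 = (x\<^sup>2) ^ 4" "x ^ 15 = (x\<^sup>2) ^ 7 * x"
  by (simp_all add: eval_nat_numeral)

text \<open>\<open>eta_mult k\<close> goes to a multiple of \<open>eta_mult (6 / k)\<close>, which
  exchanges the eta exponents of A with those of D and those of B with those of C. The root
  \<open>csqrt (- \<i> * \<tau>)\<close> enters squared because the weight is one.\<close>

lemma forms_W6:
  assumes "Im \<tau> > 0"
  shows "form_A (W6 \<tau>) = 4 / \<rho> * (- \<i> * \<tau>) * form_D \<tau>"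
    and "form_B (W6 \<tau>) = 12 * \<rho> * (- \<i> * \<tau>) * form_C \<tau>"
    and "form_C (W6 \<tau>) = 1 / (2 * \<rho>) * (- \<i> * \<tau>) * form_B \<tau>"
    and "form_D (W6 \<tau>) = 3 * \<rho> / 2 * (- \<i> * \<tau>) * form_A \<tau>"
proof -
  define s where "s = csqrt (- \<i> * \<tau>)"
  have s: "- \<i> * \<tau> = s ^ 2" "s \<noteq> 0" using assms by (auto simp: s_def)
  \<comment> \<open>Opaque names for the square roots of 2 and 3, so that the claims become
    polynomial identities modulo \<open>t\<^sup>2 = 2\<close> and
    \<open>r\<^sup>2 = 3\<close>.\<close>
  define t where "t = complex_of_real (sqrt 2)"
  have t: "t ^ 2 = 2" "t \<noteq> 0" by (simp_all add: t_def flip: of_real_power)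
  define r where "r = \<rho>"
  have r: "r ^ 2 = 3" "r \<noteq> 0" using rho_sq by (simp_all add: r_def)
  have E: "eta_mult 1 (W6 \<tau>) = t * r * s * eta_mult 6 \<tau>" "eta_mult 2 (W6 \<tau>) = r * s * eta_mult 3 \<tau>"
    "eta_mult 3 (W6 \<tau>) = t * s * eta_mult 2 \<tau>" "eta_mult 6 (W6 \<tau>) = s * eta_mult 1 \<tau>"
    using eta_mult_inversion[OF assms, of 1 6 6] eta_mult_inversion[OF assms, of 2 3 6]
      eta_mult_inversion[OF assms, of 3 2 6] eta_mult_inversion[OF assms, of 6 1 6]
    by (simp_all add: W6_def s_def t_def r_def of_real_sqrt_numerals)
  define e1 e2 e3 e6 where "e1 = eta_mult 1 \<tau>" and "e2 = eta_mult 2 \<tau>" and "e3 = eta_mult 3 \<tau>" and "e6 = eta_mult 6 \<tau>"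
  note e = this
  have nz: "e1 \<noteq> 0" "e2 \<noteq> 0" "e3 \<noteq> 0" "e6 \<noteq> 0" 
    using assms unfolding e by (intro eta_mult_nonzero; simp)+
  note Q = forms_eta_quotient[OF Im_W6_pos[OF assms], unfolded E, folded e] forms_eta_quotient[OF assms, folded e]
  have "r ^ 3 = 3 * r" "r ^ 6 = 27" "t ^ 3 = 2 * t" "t ^ 6 = 8"
    unfolding powers_via_square r t by simp_all
  note pw = this
  show "form_A (W6 \<tau>) = 4 / \<rho> * (- \<i> * \<tau>) * form_D \<tau>"
    unfolding Q s r_def [symmetric] using nz s(2) r t pw by (simp add: divide_simps power_mult_distrib) algebra
  show "form_B (W6 \<tau>) = 12 * \<rho> * (- \<i> * \<tau>) * form_C \<tau>"
    unfolding Q s r_def [symmetric] using nz s(2) r t pw by (simp add: divide_simps power_mult_distrib) algebra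
  show "form_C (W6 \<tau>) = 1 / (2 * \<rho>) * (- \<i> * \<tau>) * form_B \<tau>"
    unfolding Q s r_def [symmetric] using nz s(2) r t pw by (simp add: divide_simps power_mult_distrib) algebra
  show "form_D (W6 \<tau>) = 3 * \<rho> / 2 * (- \<i> * \<tau>) * form_A \<tau>"
    unfolding Q s r_def [symmetric] using nz s(2) r t pw by (simp add: divide_simps power_mult_distrib) algebra
qed

text \<open>The inversion by 12 of the shifted eta quotients exchanges A with B and C with D; the
  sign in the last two comes from the factor \<open>q\<close> of C, which the shift negates.\<close>

lemma forms_W3_aux:
  assumes "Im \<sigma> > 0"
  defines "\<tau> \<equiv> \<sigma> + 1 / 2"
  shows "form_A (W3 \<tau>) = 2 / \<rho> * (- \<i> * \<sigma>) * form_B \<tau>"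
    and "form_B (W3 \<tau>) = 6 * \<rho> * (- \<i> * \<sigma>) * form_A \<tau>"
    and "form_C (W3 \<tau>) = - (2 / \<rho>) * (- \<i> * \<sigma>) * form_D \<tau>"
    and "form_D (W3 \<tau>) = - (6 * \<rho>) * (- \<i> * \<sigma>) * form_C \<tau>"
proof -
  define s where "s = csqrt (- \<i> * \<sigma>)"
  have s: "- \<i> * \<sigma> = s ^ 2" "s \<noteq> 0" using assms by (auto simp: s_def)
  define t where "t = complex_of_real (sqrt 2)"
  have t: "t ^ 2 = 2" "t \<noteq> 0" by (simp_all add: t_def flip: of_real_power)
  define r where "r = \<rho>"
  have r: "r ^ 2 = 3" "r \<noteq> 0" using rho_sq by (simp_all add: r_def)
  define \<sigma>' where "\<sigma>' = - 1 / (12 * \<sigma>)"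
  have \<sigma>': "Im \<sigma>' > 0" "W3 \<tau> = \<sigma>' + 1 / 2"
    using Im_minus_inverse_pos[of "12 * \<sigma>"] assms by (simp_all add: \<sigma>'_def W3_def)
  have E: "eta_mult 1 \<sigma>' = 2 * r * s * eta_mult 12 \<sigma>" "eta_mult 2 \<sigma>' = t * r * s * eta_mult 6 \<sigma>"
    "eta_mult 3 \<sigma>' = 2 * s * eta_mult 4 \<sigma>" "eta_mult 4 \<sigma>' = r * s * eta_mult 3 \<sigma>" 
    "eta_mult 6 \<sigma>' = t * s * eta_mult 2 \<sigma>" "eta_mult 12 \<sigma>' = s * eta_mult 1 \<sigma>"
    using eta_mult_inversion[OF assms(1), of 1 12 12] eta_mult_inversion[OF assms(1), of 2 6 12]
      eta_mult_inversion[OF assms(1), of 3 4 12] eta_mult_inversion[OF assms(1), of 4 3 12]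
      eta_mult_inversion[OF assms(1), of 6 2 12] eta_mult_inversion[OF assms(1), of 12 1 12]
    by (simp_all add: \<sigma>'_def s_def t_def r_def of_real_sqrt_numerals)
  define e1 e2 e3 e4 e6 e12 where "e1 = eta_mult 1 \<sigma>" and "e2 = eta_mult 2 \<sigma>" and "e3 = eta_mult 3 \<sigma>"
    and "e4 = eta_mult 4 \<sigma>" and "e6 = eta_mult 6 \<sigma>" and "e12 = eta_mult 12 \<sigma>"
  note e = this
  have nz: "e1 \<noteq> 0" "e2 \<noteq> 0" "e3 \<noteq> 0" "e4 \<noteq> 0" "e6 \<noteq> 0" "e12 \<noteq> 0" 
    using assms unfolding e by (intro eta_mult_nonzero; simp)+
  note Q = forms_eta_quotient_shifted[OF \<sigma>'(1), folded \<sigma>'(2), unfolded E, folded e] 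
    forms_eta_quotient_shifted[OF assms(1), folded \<tau>_def e]
  have "r ^ 3 = 3 * r" "r ^ 5 = 9 * r" "r ^ 6 = 27" "r ^ 8 = 81" "r ^ 15 = 2187 * r" "t ^ 3 = 2 * t" "t ^ 5 = 4 * t" "t ^ 15 = 128 * t"
    unfolding powers_via_square r t by simp_all
  note pw = this
  show "form_A (W3 \<tau>) = 2 / \<rho> * (- \<i> * \<sigma>) * form_B \<tau>"
    unfolding Q s r_def [symmetric] using nz s(2) r t pw by (simp add: divide_simps power_mult_distrib)
  show "form_B (W3 \<tau>) = 6 * \<rho> * (- \<i> * \<sigma>) * form_A \<tau>"
    unfolding Q s r_def [symmetric] using nz s(2) r t pw by (simp add: divide_simps power_mult_distrib)
  show "form_C (W3 \<tau>) = - (2 / \<rho>) * (- \<i> * \<sigma>) * form_D \<tau>"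
    unfolding Q s r_def [symmetric] using nz s(2) r t pw by (simp add: divide_simps power_mult_distrib) (simp add: power2_eq_square power3_eq_cube)
  show "form_D (W3 \<tau>) = - (6 * \<rho>) * (- \<i> * \<sigma>) * form_C \<tau>"
    unfolding Q s r_def [symmetric] using nz s(2) r t pw by (simp add: divide_simps power_mult_distrib) (simp add: power2_eq_square power3_eq_cube)
qed

lemma forms_W3:
  assumes "Im \<tau> > 0"
  shows "form_A (W3 \<tau>) = 2 / \<rho> * (- \<i> * (\<tau> - 1 / 2)) * form_B \<tau>"
    and "form_B (W3 \<tau>) = 6 * \<rho> * (- \<i> * (\<tau> - 1 / 2)) * form_A \<tau>"
    and "form_C (W3 \<tau>) = - (2 / \<rho>) * (- \<i> * (\<tau> - 1 / 2)) * form_D \<tau>"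
    and "form_D (W3 \<tau>) = - (6 * \<rho>) * (- \<i> * (\<tau> - 1 / 2)) * form_C \<tau>"
  using forms_W3_aux[of "\<tau> - 1 / 2"] assms by simp_all

section \<open>Logarithmic derivatives\<close>

text \<open>Makes division by \<open>form_C\<close> possible: a numerator that vanishes at the cusp
  gives up the factor \<open>q\<close>, and the value of the quotient there is a derivative.\<close>

lemma removable_zero:
  assumes "N holomorphic_on ball 0 1" "N 0 = 0"
  obtains G where "G holomorphic_on ball 0 1" "\<And>q. N q = q * G q" "G 0 = deriv N 0"
proof -
  define G where "G = (\<lambda>q. if q = 0 then deriv N 0 else (N q - N 0) / (q - 0))"
  have "G holomorphic_on ball 0 1" unfolding G_def using assms by (intro pole_lemma) auto
  moreover have "N q = q * G q" for q using assms by (auto simp: G_def)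
  moreover have "G 0 = deriv N 0" by (simp add: G_def)
  ultimately show ?thesis using that by blast
qed

text \<open>Starting from \<open>(D - A - C) / C\<close>, the factors in \<open>forms_W6\<close> and
  \<open>forms_W3\<close> produce the other three quotients. Their numerators encode the same linear
  relations, so one common constant settles everything.\<close>

lemma forms_relations:
  assumes tau: "Im \<tau> > 0"
  shows "form_A \<tau> = form_B \<tau> + 8 * form_C \<tau>" "form_D \<tau> = form_A \<tau> + form_C \<tau>"
proof -
  define N where "N = (\<lambda>q. D_hat q - A_hat q - q * C_hat q)"
  have N0: "N 0 = 0" by (simp add: N_def)
  have "N holomorphic_on ball 0 1" unfolding N_def by (intro holomorphic_intros holomorphic_hats)
  then obtain G where G: "G holomorphic_on ball 0 1" "\<And>q. N q = q * G q"
    using removable_zero[where N = N, OF _ N0] by blast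
  define F0 F1 F2 F3 where "F0 = (\<lambda>q. G q / C_hat q)"
    and "F1 = (\<lambda>q. (9 * A_hat q - 8 * D_hat q - B_hat q) / B_hat q)"
    and "F2 = (\<lambda>q. (9 * (q * C_hat q) + B_hat q - D_hat q) / D_hat q)"
    and "F3 = (\<lambda>q. (B_hat q + 8 * (q * C_hat q) - A_hat q) / A_hat q)"
  have F: "F0 (nome \<tau>) = (form_D \<tau> - form_A \<tau> - form_C \<tau>) / form_C \<tau>"
    "F1 (nome \<tau>) = (9 * form_A \<tau> - 8 * form_D \<tau> - form_B \<tau>) / form_B \<tau>"
    "F2 (nome \<tau>) = (9 * form_C \<tau> + form_B \<tau> - form_D \<tau>) / form_D \<tau>"
    "F3 (nome \<tau>) = (form_B \<tau> + 8 * form_C \<tau> - form_A \<tau>) / form_A \<tau>" for \<tau>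
    using G(2)[of "nome \<tau>"]
    by (simp_all add: F0_def F1_def F2_def F3_def form_A_def form_B_def form_C_def form_D_def N_def)
  have const: "F q = H q'" if "F \<in> {F0, F1, F2, F3}" "H \<in> {F0, F1, F2, F3}" "q \<in> ball 0 1" "q' \<in> ball 0 1" for F H q q'
  proof (rule atkin_lehner_orbit_constant[OF _ _ _ _ _ _ _ _ that])
    show "F0 holomorphic_on ball 0 1" "F1 holomorphic_on ball 0 1" "F2 holomorphic_on ball 0 1" "F3 holomorphic_on ball 0 1"
      unfolding F0_def F1_def F2_def F3_def using hats_nonzero 
      by (auto intro!: holomorphic_intros holomorphic_hats G)
    fix \<tau> :: complex assume t: "Im \<tau> > 0"
    have nz: "\<tau> \<noteq> 0" "\<tau> - 1 / 2 \<noteq> 0" using t by (auto simp: complex_eq_iff)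
    define s where "s = \<tau> - 1 / 2"
    define r where "r = \<rho>"
    have r: "r ^ 2 = 3" "r \<noteq> 0" using rho_sq by (simp_all add: r_def)
    note nz = nz[folded s_def] forms_nonzero[OF t]
    note W6 = forms_W6[OF t, folded r_def] and W3 = forms_W3[OF t, folded r_def s_def]
    show "F0 (nome (W6 \<tau>)) = F1 (nome \<tau>)"
      unfolding F W6 using nz r by (simp add: divide_simps) algebra
    show "F2 (nome (W6 \<tau>)) = F3 (nome \<tau>)"
      unfolding F W6 using nz r by (simp add: divide_simps) algebra
    show "F0 (nome (W3 \<tau>)) = F2 (nome \<tau>)"
      unfolding F W3 using nz r by (simp add: divide_simps) algebra
    show "F1 (nome (W3 \<tau>)) = F3 (nome \<tau>)"
      unfolding F W3 using nz r by (simp add: divide_simps) algebra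
  qed
  \<comment> \<open>\<open>A_hat\<close> and \<open>B_hat\<close> both have value 1 at the cusp, so
    the common constant is 0.\<close>
  have "F3 0 = 0" by (simp add: F3_def)
  hence "F1 (nome \<tau>) = 0" "F3 (nome \<tau>) = 0"
    using const[of F1 F3 "nome \<tau>" 0] const[of F3 F3 "nome \<tau>" 0] norm_nome_less_1[OF tau] by auto
  hence *: "9 * form_A \<tau> - 8 * form_D \<tau> - form_B \<tau> = 0" "form_B \<tau> + 8 * form_C \<tau> - form_A \<tau> = 0"
    using forms_nonzero[OF tau] by (auto simp: F)
  from *(2) show "form_A \<tau> = form_B \<tau> + 8 * form_C \<tau>" by algebra
  with *(1) have "8 * form_D \<tau> = 8 * (form_A \<tau> + form_C \<tau>)" by algebra
  thus "form_D \<tau> = form_A \<tau> + form_C \<tau>" by (simp only: mult_cancel_left) simp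
qed

section \<open>Logarithmic derivatives under the involutions, and the derivative of
  \<open>f\<close>\<close>

definition dlog :: "(complex \<Rightarrow> complex) \<Rightarrow> complex \<Rightarrow> complex" where
  "dlog X \<tau> = deriv X \<tau> / X \<tau>"

text \<open>Logarithmic differentiation of the weight one law: the constant \<open>c\<close> drops
  out, the factor \<open>\<tau> - s\<close> leaves the summand \<open>1 / (\<tau> - s)\<close>, and
  division by the derivative of \<open>W\<close> gives the front factor.\<close>

lemma dlog_inversion:
  assumes X: "X holomorphic_on upper_half_plane" and Y: "Y holomorphic_on upper_half_plane"
    and XY: "\<And>\<tau>. Im \<tau> > 0 \<Longrightarrow> X (W \<tau>) = c * (\<tau> - s) * Y \<tau>"
    and W: "\<And>\<tau>. W \<tau> = s - 1 / (n * (\<tau> - s))" "n \<noteq> 0" "\<And>\<tau>. Im \<tau> > 0 \<Longrightarrow> Im (W \<tau>) > 0"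
    and tau: "Im \<tau> > 0" "\<tau> \<noteq> s" and nz: "X (W \<tau>) \<noteq> 0" "Y \<tau> \<noteq> 0"
  shows "dlog X (W \<tau>) = n * (\<tau> - s)\<^sup>2 * (dlog Y \<tau> + 1 / (\<tau> - s))"
proof -
  have "((\<lambda>\<tau>. s - 1 / (n * (\<tau> - s))) has_field_derivative n / ((n * (\<tau> - s)) * (n * (\<tau> - s)))) (at \<tau>)"
    using tau(2) W(2) by (auto intro!: derivative_eq_intros)
  also have "n / ((n * (\<tau> - s)) * (n * (\<tau> - s))) = 1 / (n * (\<tau> - s)\<^sup>2)"
    using W(2) by (simp add: power2_eq_square)
  finally have dW: "(W has_field_derivative 1 / (n * (\<tau> - s)\<^sup>2)) (at \<tau>)" by (simp flip: W(1))
  have "(X has_field_derivative deriv X (W \<tau>)) (at (W \<tau>))"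
    using W(3)[OF tau(1)] by (intro holomorphic_derivI[OF X open_upper_half_plane]) auto
  from DERIV_chain2[OF this dW] 
  have 1: "((\<lambda>\<tau>. X (W \<tau>)) has_field_derivative deriv X (W \<tau>) * (1 / (n * (\<tau> - s)\<^sup>2))) (at \<tau>)" .
  have dY: "(Y has_field_derivative deriv Y \<tau>) (at \<tau>)"
    using tau by (intro holomorphic_derivI[OF Y open_upper_half_plane]) auto
  have "((\<lambda>\<tau>. c * (\<tau> - s) * Y \<tau>) has_field_derivative (c * Y \<tau> + c * (\<tau> - s) * deriv Y \<tau>)) (at \<tau>)"
    by (rule derivative_eq_intros dY refl | simp)+
  hence "((\<lambda>\<tau>. X (W \<tau>)) has_field_derivative (c * Y \<tau> + c * (\<tau> - s) * deriv Y \<tau>)) (at \<tau>)"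
    by (rule has_field_derivative_transform_within_open[OF _ open_upper_half_plane]) (use XY tau in auto)
  from DERIV_unique[OF 1 this] have eq: "deriv X (W \<tau>) * (1 / (n * (\<tau> - s)\<^sup>2)) = c * Y \<tau> + c * (\<tau> - s) * deriv Y \<tau>" .
  define t where "t = \<tau> - s"
  have t: "t \<noteq> 0" using tau by (simp add: t_def)
  have X': "deriv X (W \<tau>) = n * t\<^sup>2 * (c * Y \<tau> + c * t * deriv Y \<tau>)"
    using eq t W(2) unfolding t_def [symmetric] by (simp add: field_simps)
  have "c \<noteq> 0" using XY[OF tau(1)] nz by auto
  thus ?thesis unfolding dlog_def X' XY[OF tau(1)] t_def [symmetric] using t nz(2)
    by (simp add: field_simps power2_eq_square)
qed

lemma dlog_forms_W6:
  assumes t: "Im \<tau> > 0"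
  shows "dlog form_A (W6 \<tau>) = 6 * \<tau>\<^sup>2 * (dlog form_D \<tau> + 1 / \<tau>)"
    and "dlog form_B (W6 \<tau>) = 6 * \<tau>\<^sup>2 * (dlog form_C \<tau> + 1 / \<tau>)"
    and "dlog form_C (W6 \<tau>) = 6 * \<tau>\<^sup>2 * (dlog form_B \<tau> + 1 / \<tau>)"
    and "dlog form_D (W6 \<tau>) = 6 * \<tau>\<^sup>2 * (dlog form_A \<tau> + 1 / \<tau>)"
proof -
  have W: "W6 \<tau> = 0 - 1 / (6 * (\<tau> - 0))" for \<tau> by (simp add: W6_def)
  have nz: "\<tau> \<noteq> 0" using t by auto
  note D = dlog_inversion[where W = W6 and s = 0 and n = 6, OF _ _ _ W _ Im_W6_pos t nz, simplified]
  note nzs = forms_nonzero[OF t] forms_nonzero[OF Im_W6_pos[OF t]]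
  show "dlog form_A (W6 \<tau>) = 6 * \<tau>\<^sup>2 * (dlog form_D \<tau> + 1 / \<tau>)"
    by (rule D[where c = "4 / \<rho> * (- \<i>)"]) (use nzs in \<open>auto simp: forms_W6 intro: holomorphic_forms\<close>)
  show "dlog form_B (W6 \<tau>) = 6 * \<tau>\<^sup>2 * (dlog form_C \<tau> + 1 / \<tau>)"
    by (rule D[where c = "12 * \<rho> * (- \<i>)"]) (use nzs in \<open>auto simp: forms_W6 intro: holomorphic_forms\<close>)
  show "dlog form_C (W6 \<tau>) = 6 * \<tau>\<^sup>2 * (dlog form_B \<tau> + 1 / \<tau>)"
    by (rule D[where c = "1 / (2 * \<rho>) * (- \<i>)"]) (use nzs in \<open>auto simp: forms_W6 intro: holomorphic_forms\<close>)
  show "dlog form_D (W6 \<tau>) = 6 * \<tau>\<^sup>2 * (dlog form_A \<tau> + 1 / \<tau>)"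
    by (rule D[where c = "3 * \<rho> / 2 * (- \<i>)"]) (use nzs in \<open>auto simp: forms_W6 intro: holomorphic_forms\<close>)
qed

lemma dlog_forms_W3:
  assumes t: "Im \<tau> > 0"
  defines "\<sigma> \<equiv> \<tau> - 1 / 2"
  shows "dlog form_A (W3 \<tau>) = 12 * \<sigma>\<^sup>2 * (dlog form_B \<tau> + 1 / \<sigma>)"
    and "dlog form_B (W3 \<tau>) = 12 * \<sigma>\<^sup>2 * (dlog form_A \<tau> + 1 / \<sigma>)"
    and "dlog form_C (W3 \<tau>) = 12 * \<sigma>\<^sup>2 * (dlog form_D \<tau> + 1 / \<sigma>)"
    and "dlog form_D (W3 \<tau>) = 12 * \<sigma>\<^sup>2 * (dlog form_C \<tau> + 1 / \<sigma>)"
proof -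
  have nz: "\<tau> \<noteq> 1 / 2" using t by (auto simp: complex_eq_iff)
  note D = dlog_inversion[where W = W3 and s = "1 / 2" and n = 12, OF _ _ _ W3_def _ Im_W3_pos t nz, folded \<sigma>_def]
  note nzs = forms_nonzero[OF t] forms_nonzero[OF Im_W3_pos[OF t]]
  show "dlog form_A (W3 \<tau>) = 12 * \<sigma>\<^sup>2 * (dlog form_B \<tau> + 1 / \<sigma>)"
    by (rule D[where c = "2 / \<rho> * (- \<i>)"]) (use nzs in \<open>auto simp: forms_W3 intro: holomorphic_forms\<close>)
  show "dlog form_B (W3 \<tau>) = 12 * \<sigma>\<^sup>2 * (dlog form_A \<tau> + 1 / \<sigma>)"
    by (rule D[where c = "6 * \<rho> * (- \<i>)"]) (use nzs in \<open>auto simp: forms_W3 intro: holomorphic_forms\<close>)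
  show "dlog form_C (W3 \<tau>) = 12 * \<sigma>\<^sup>2 * (dlog form_D \<tau> + 1 / \<sigma>)"
    by (rule D[where c = "- (2 / \<rho>) * (- \<i>)"]) (use nzs in \<open>auto simp: forms_W3 intro: holomorphic_forms\<close>)
  show "dlog form_D (W3 \<tau>) = 12 * \<sigma>\<^sup>2 * (dlog form_C \<tau> + 1 / \<sigma>)"
    by (rule D[where c = "- (6 * \<rho>) * (- \<i>)"]) (use nzs in \<open>auto simp: forms_W3 intro: holomorphic_forms\<close>)
qed

abbreviation "\<kappa> \<equiv> 2 * complex_of_real pi * \<i>"

lemma deriv_nome_compose:
  assumes "F holomorphic_on ball 0 1" "Im \<tau> > 0"
  shows "((\<lambda>\<tau>. F (nome \<tau>)) has_field_derivative \<kappa> * (nome \<tau> * deriv F (nome \<tau>))) (at \<tau>)"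
proof -
  have "(F has_field_derivative deriv F (nome \<tau>)) (at (nome \<tau>))"
    using norm_nome_less_1[OF assms(2)] by (intro holomorphic_derivI[OF assms(1)]) auto
  from DERIV_chain2[OF this nome_deriv] show ?thesis by (simp add: mult_ac)
qed

lemma dlog_nome_compose:
  assumes "F holomorphic_on ball 0 1" "Im \<tau> > 0"
  shows "dlog (\<lambda>\<tau>. F (nome \<tau>)) \<tau> = \<kappa> * (nome \<tau> * (deriv F (nome \<tau>) / F (nome \<tau>)))"
  using DERIV_imp_deriv[OF deriv_nome_compose[OF assms]] by (simp add: dlog_def)

lemma dlog_forms:
  assumes "Im \<tau> > 0"
  shows "dlog form_A \<tau> = \<kappa> * (nome \<tau> * (deriv A_hat (nome \<tau>) / A_hat (nome \<tau>)))"
    and "dlog form_B \<tau> = \<kappa> * (nome \<tau> * (deriv B_hat (nome \<tau>) / B_hat (nome \<tau>)))"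
    and "dlog form_C \<tau> = \<kappa> * (1 + nome \<tau> * (deriv C_hat (nome \<tau>) / C_hat (nome \<tau>)))"
    and "dlog form_D \<tau> = \<kappa> * (nome \<tau> * (deriv D_hat (nome \<tau>) / D_hat (nome \<tau>)))"
proof -
  show "dlog form_A \<tau> = \<kappa> * (nome \<tau> * (deriv A_hat (nome \<tau>) / A_hat (nome \<tau>)))"
    "dlog form_B \<tau> = \<kappa> * (nome \<tau> * (deriv B_hat (nome \<tau>) / B_hat (nome \<tau>)))"
    "dlog form_D \<tau> = \<kappa> * (nome \<tau> * (deriv D_hat (nome \<tau>) / D_hat (nome \<tau>)))"
    unfolding form_A_def [abs_def] form_B_def [abs_def] form_D_def [abs_def]
    by (intro dlog_nome_compose holomorphic_hats assms)+
  have "(form_C has_field_derivative \<kappa> * nome \<tau> * C_hat (nome \<tau>) + nome \<tau> * (\<kappa> * (nome \<tau> * deriv C_hat (nome \<tau>)))) (at \<tau>)"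
    unfolding form_C_def [abs_def]
    by (rule derivative_eq_intros nome_deriv deriv_nome_compose holomorphic_hats assms refl | simp)+
  from DERIV_imp_deriv[OF this] show "dlog form_C \<tau> = \<kappa> * (1 + nome \<tau> * (deriv C_hat (nome \<tau>) / C_hat (nome \<tau>)))"
    using forms_nonzero(3)[OF assms] by (simp add: dlog_def form_C_def field_simps)
qed

text \<open>The left side is the logarithmic derivative of \<open>f = A / B\<close>; the
  inhomogeneous terms cancel in the difference, so it has weight two. Its quotient by
  \<open>C D\<close> is fixed by \<open>W3\<close>, which exchanges A with B and C with D, and
  \<open>W6\<close> turns it into a quotient by \<open>A B\<close>.\<close>

lemma dlog_A_minus_dlog_B:
  assumes tau: "Im \<tau> > 0"
  shows "dlog form_A \<tau> - dlog form_B \<tau> = 8 * \<kappa> * form_C \<tau> * form_D \<tau>"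
proof -
  \<comment> \<open>In \<open>F0\<close> the factor \<open>q\<close> of both logarithmic derivatives
    cancels the one of \<open>form_C\<close>; in \<open>F1\<close> the summand -1 is the logarithmic
    derivative of that factor.\<close>
  define F0 F1 where "F0 = (\<lambda>q. (deriv A_hat q / A_hat q - deriv B_hat q / B_hat q) / (C_hat q * D_hat q))"
    and "F1 = (\<lambda>q. - 8 * (q * (deriv D_hat q / D_hat q - deriv C_hat q / C_hat q) - 1) / (A_hat q * B_hat q))"
  have F: "F0 (nome \<tau>) = (dlog form_A \<tau> - dlog form_B \<tau>) / (\<kappa> * form_C \<tau> * form_D \<tau>)"
    "F1 (nome \<tau>) = - 8 * (dlog form_D \<tau> - dlog form_C \<tau>) / (\<kappa> * form_A \<tau> * form_B \<tau>)" if t: "Im \<tau> > 0" for \<tau>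
  proof -
    have "F0 (nome \<tau>) = (\<kappa> * nome \<tau>) * (deriv A_hat (nome \<tau>) / A_hat (nome \<tau>) - deriv B_hat (nome \<tau>) / B_hat (nome \<tau>)) /
       ((\<kappa> * nome \<tau>) * (C_hat (nome \<tau>) * D_hat (nome \<tau>)))" by (simp add: F0_def)
    thus "F0 (nome \<tau>) = (dlog form_A \<tau> - dlog form_B \<tau>) / (\<kappa> * form_C \<tau> * form_D \<tau>)"
      unfolding dlog_forms[OF t] form_C_def form_D_def by (simp only: right_diff_distrib mult.assoc)
    have "F1 (nome \<tau>) = \<kappa> * (- 8 * (nome \<tau> * (deriv D_hat (nome \<tau>) / D_hat (nome \<tau>) - deriv C_hat (nome \<tau>) / C_hat (nome \<tau>)) - 1)) / 
      (\<kappa> * (A_hat (nome \<tau>) * B_hat (nome \<tau>)))" by (simp add: F1_def)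
    also have "\<kappa> * (- 8 * (nome \<tau> * (deriv D_hat (nome \<tau>) / D_hat (nome \<tau>) - deriv C_hat (nome \<tau>) / C_hat (nome \<tau>)) - 1)) = 
       - 8 * (dlog form_D \<tau> - dlog form_C \<tau>)" unfolding dlog_forms[OF t] by algebra
    finally show "F1 (nome \<tau>) = - 8 * (dlog form_D \<tau> - dlog form_C \<tau>) / (\<kappa> * form_A \<tau> * form_B \<tau>)"
      unfolding form_A_def form_B_def by (simp only: mult.assoc)
  qed
  have const: "F q = H q'" if "F \<in> {F0, F1, F0, F1}" "H \<in> {F0, F1, F0, F1}" "q \<in> ball 0 1" "q' \<in> ball 0 1" for F H q q'
  proof (rule atkin_lehner_orbit_constant[OF _ _ _ _ _ _ _ _ that])
    show "F0 holomorphic_on ball 0 1" "F1 holomorphic_on ball 0 1"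
      unfolding F0_def F1_def using hats_nonzero 
      by (auto intro!: holomorphic_intros holomorphic_hats)
    thus "F0 holomorphic_on ball 0 1" "F1 holomorphic_on ball 0 1" .
    fix \<tau> :: complex assume t: "Im \<tau> > 0"
    have nz: "\<tau> \<noteq> 0" "\<tau> - 1 / 2 \<noteq> 0" using t by (auto simp: complex_eq_iff)
    define s where "s = \<tau> - 1 / 2"
    define r where "r = \<rho>"
    have r: "r ^ 2 = 3" "r \<noteq> 0" using rho_sq by (simp_all add: r_def)
    define k where "k = \<kappa>"
    have k: "k \<noteq> 0" by (simp add: k_def)
    define j where "j = \<i>"
    have j: "j ^ 2 = - 1" by (simp add: j_def)
    note nz = nz[folded s_def] forms_nonzero[OF t]
    note W6 = forms_W6[OF t, folded r_def j_def] dlog_forms_W6[OF t] and W3 = forms_W3[OF t, folded r_def s_def j_def] dlog_forms_W3[OF t, folded s_def]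
    note F6 = F[OF Im_W6_pos[OF t], folded k_def] and F3 = F[OF Im_W3_pos[OF t], folded k_def] and F = F[OF t, folded k_def]
    show "F0 (nome (W6 \<tau>)) = F1 (nome \<tau>)"
      unfolding F F6 W6 using nz r k j by (simp add: divide_simps) algebra
    thus "F0 (nome (W6 \<tau>)) = F1 (nome \<tau>)" .
    show "F0 (nome (W3 \<tau>)) = F0 (nome \<tau>)"
      unfolding F F3 W3 using nz r k j by (simp add: divide_simps) algebra
    show "F1 (nome (W3 \<tau>)) = F1 (nome \<tau>)"
      unfolding F F3 W3 using nz r k j by (simp add: divide_simps) algebra
  qed
  have "F1 0 = 8" by (simp add: F1_def)
  hence "F0 (nome \<tau>) = 8" using const[of F0 F1 "nome \<tau>" 0] norm_nome_less_1[OF tau] by auto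
  thus ?thesis using forms_nonzero[OF tau] unfolding F[OF tau] by (simp add: field_simps)
qed

section \<open>A weight four form from the product of the four forms\<close>

text \<open>Adding up exponents, this is the square of \<open>\<eta>(\<tau>) \<eta>(2\<tau>)
  \<eta>(3\<tau>) \<eta>(6\<tau>)\<close>: weight four, with a simple zero in the nome at
  infinity.\<close>

definition form_E :: "complex \<Rightarrow> complex" where
  "form_E \<tau> = form_A \<tau> * form_B \<tau> * form_C \<tau> * form_D \<tau>"

definition dlog_E :: "complex \<Rightarrow> complex" where
  "dlog_E \<tau> = dlog form_A \<tau> + dlog form_B \<tau> + dlog form_C \<tau> + dlog form_D \<tau>"

text \<open>The logarithmic derivative U of a form of weight k is only quasi-modular, but
  \<open>U' - U\<^sup>2 / k\<close> is modular of weight four; here k = 4.\<close>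

definition form_Q :: "complex \<Rightarrow> complex" where
  "form_Q \<tau> = deriv dlog_E \<tau> - dlog_E \<tau> ^ 2 / 4"

definition hat_V :: "complex \<Rightarrow> complex" where
  "hat_V q = deriv A_hat q / A_hat q + deriv B_hat q / B_hat q + deriv C_hat q / C_hat q + deriv D_hat q / D_hat q"

text \<open>\<open>dlog_E\<close> divided by \<open>\<kappa>\<close>, as a function of the nome; the
  1 stems from the factor \<open>q\<close> of \<open>form_C\<close>.\<close>

definition hat_U :: "complex \<Rightarrow> complex" where
  "hat_U q = 1 + q * hat_V q"

lemma holomorphic_hat_V: "hat_V holomorphic_on ball 0 1"
  unfolding hat_V_def [abs_def] using hats_nonzero
  by (auto intro!: holomorphic_intros holomorphic_hats)

lemma holomorphic_hat_U: "hat_U holomorphic_on ball 0 1"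
  unfolding hat_U_def [abs_def] by (intro holomorphic_intros holomorphic_hat_V)

lemma dlog_E_hat: "Im \<tau> > 0 \<Longrightarrow> dlog_E \<tau> = \<kappa> * hat_U (nome \<tau>)"
  unfolding dlog_E_def dlog_forms hat_U_def hat_V_def by algebra

lemma dlog_E_deriv:
  assumes "Im \<tau> > 0"
  shows "(dlog_E has_field_derivative \<kappa> ^ 2 * (nome \<tau> * deriv hat_U (nome \<tau>))) (at \<tau>)"
proof -
  have "((\<lambda>\<tau>. \<kappa> * hat_U (nome \<tau>)) has_field_derivative \<kappa> * (\<kappa> * (nome \<tau> * deriv hat_U (nome \<tau>)))) (at \<tau>)"
    by (intro DERIV_cmult deriv_nome_compose holomorphic_hat_U assms)
  hence "(dlog_E has_field_derivative \<kappa> * (\<kappa> * (nome \<tau> * deriv hat_U (nome \<tau>)))) (at \<tau>)"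
    by (rule has_field_derivative_transform_within_open[OF _ open_upper_half_plane]) 
       (use assms dlog_E_hat in auto)
  thus ?thesis by (simp add: power2_eq_square mult_ac)
qed

lemma dlog_E_deriv': "Im \<tau> > 0 \<Longrightarrow> (dlog_E has_field_derivative deriv dlog_E \<tau>) (at \<tau>)"
  using dlog_E_deriv[of \<tau>] DERIV_imp_deriv by metis

text \<open>Differentiating the law for \<open>dlog_E\<close> yields the extra terms
  \<open>2 n\<^sup>2 t\<^sup>3 U + 4 n\<^sup>2 t\<^sup>2\<close>, with
  \<open>t = \<tau> - s\<close>, and a quarter of the square yields the same ones.\<close>

lemma form_Q_inversion:
  assumes U: "\<And>\<tau>. Im \<tau> > 0 \<Longrightarrow> dlog_E (W \<tau>) = n * (\<tau> - s)\<^sup>2 * dlog_E \<tau> + 4 * n * (\<tau> - s)"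
    and W: "\<And>\<tau>. W \<tau> = s - 1 / (n * (\<tau> - s))" "n \<noteq> 0" "\<And>\<tau>. Im \<tau> > 0 \<Longrightarrow> Im (W \<tau>) > 0"
    and tau: "Im \<tau> > 0" "\<tau> \<noteq> s"
  shows "form_Q (W \<tau>) = n\<^sup>2 * (\<tau> - s) ^ 4 * form_Q \<tau>"
proof -
  have "((\<lambda>\<tau>. s - 1 / (n * (\<tau> - s))) has_field_derivative n / ((n * (\<tau> - s)) * (n * (\<tau> - s)))) (at \<tau>)"
    using tau(2) W(2) by (auto intro!: derivative_eq_intros)
  also have "n / ((n * (\<tau> - s)) * (n * (\<tau> - s))) = 1 / (n * (\<tau> - s)\<^sup>2)"
    using W(2) by (simp add: power2_eq_square)
  finally have dW: "(W has_field_derivative 1 / (n * (\<tau> - s)\<^sup>2)) (at \<tau>)" by (simp flip: W(1))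
  from DERIV_chain2[OF dlog_E_deriv'[OF W(3)[OF tau(1)]] dW] 
  have 1: "((\<lambda>\<tau>. dlog_E (W \<tau>)) has_field_derivative deriv dlog_E (W \<tau>) * (1 / (n * (\<tau> - s)\<^sup>2))) (at \<tau>)" .
  have "((\<lambda>\<tau>. n * (\<tau> - s)\<^sup>2 * dlog_E \<tau> + 4 * n * (\<tau> - s)) has_field_derivative 
      2 * n * (\<tau> - s) * dlog_E \<tau> + n * (\<tau> - s)\<^sup>2 * deriv dlog_E \<tau> + 4 * n) (at \<tau>)"
    by (rule derivative_eq_intros dlog_E_deriv' tau refl | simp)+
  hence "((\<lambda>\<tau>. dlog_E (W \<tau>)) has_field_derivative 
     2 * n * (\<tau> - s) * dlog_E \<tau> + n * (\<tau> - s)\<^sup>2 * deriv dlog_E \<tau> + 4 * n) (at \<tau>)"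
    by (rule has_field_derivative_transform_within_open[OF _ open_upper_half_plane]) (use U tau in auto)
  from DERIV_unique[OF 1 this] have eq: "deriv dlog_E (W \<tau>) * (1 / (n * (\<tau> - s)\<^sup>2)) =
     2 * n * (\<tau> - s) * dlog_E \<tau> + n * (\<tau> - s)\<^sup>2 * deriv dlog_E \<tau> + 4 * n" .
  define t where "t = \<tau> - s"
  have t: "t \<noteq> 0" using tau by (simp add: t_def)
  have X': "deriv dlog_E (W \<tau>) = n * t\<^sup>2 * (2 * n * t * dlog_E \<tau> + n * t\<^sup>2 * deriv dlog_E \<tau> + 4 * n)"
    using eq t W(2) unfolding t_def [symmetric] by (simp add: field_simps)
  show ?thesis unfolding form_Q_def X' U[OF tau(1)] t_def [symmetric] by algebra
qed

lemma dlog_E_W6: "Im \<tau> > 0 \<Longrightarrow> dlog_E (W6 \<tau>) = 6 * (\<tau> - 0)\<^sup>2 * dlog_E \<tau> + 4 * 6 * (\<tau> - 0)"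
proof -
  assume "Im \<tau> > 0"
  moreover from this have "\<tau> \<noteq> 0" by auto
  ultimately show ?thesis
    unfolding dlog_E_def by (simp add: dlog_forms_W6 divide_simps power2_eq_square) algebra
qed

lemma dlog_E_W3: "Im \<tau> > 0 \<Longrightarrow> dlog_E (W3 \<tau>) = 12 * (\<tau> - 1 / 2)\<^sup>2 * dlog_E \<tau> + 4 * 12 * (\<tau> - 1 / 2)"
proof -
  assume t: "Im \<tau> > 0"
  define s where "s = \<tau> - 1 / 2"
  have "s \<noteq> 0" using t by (auto simp: s_def complex_eq_iff)
  thus ?thesis
    unfolding dlog_E_def dlog_forms_W3[OF t] s_def [symmetric] by (simp add: divide_simps power2_eq_square) algebra
qed

lemma form_Q_W6: "Im \<tau> > 0 \<Longrightarrow> form_Q (W6 \<tau>) = 36 * \<tau> ^ 4 * form_Q \<tau>"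
  using form_Q_inversion[of W6 6 0 \<tau>, OF dlog_E_W6 _ _ Im_W6_pos] by (force simp: W6_def)

lemma form_Q_W3: "Im \<tau> > 0 \<Longrightarrow> form_Q (W3 \<tau>) = 144 * (\<tau> - 1 / 2) ^ 4 * form_Q \<tau>"
  using form_Q_inversion[of W3 12 "1 / 2" \<tau>, OF dlog_E_W3 W3_def _ Im_W3_pos] by (force simp: complex_eq_iff)

lemma euler_prod_power_deriv_0:
  "(euler_prod has_field_derivative -1) (at 0)"
  "n > 1 \<Longrightarrow> ((\<lambda>q. euler_prod (q ^ n)) has_field_derivative 0) (at 0)"
proof -
  have *: "(euler_prod has_field_derivative deriv euler_prod 0) (at 0)"
    by (rule holomorphic_derivI[OF holomorphic_euler_prod]) auto
  thus 1: "(euler_prod has_field_derivative -1) (at 0)" by (simp add: deriv_euler_prod_0)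
  assume n: "n > 1"
  hence z: "(0::complex) ^ (n - 1) = 0" "(0::complex) ^ n = 0" by (auto simp: power_0_left)
  have "((\<lambda>q::complex. q ^ n) has_field_derivative of_nat n * 0 ^ (n - 1)) (at 0)"
    by (auto intro!: derivative_eq_intros)
  hence 2: "((\<lambda>q::complex. q ^ n) has_field_derivative 0) (at 0)" by (simp only: z mult_zero_right)
  have "(euler_prod has_field_derivative -1) (at (0 ^ n))" using 1 by (simp only: z)
  from DERIV_chain2[OF this 2] show "((\<lambda>q. euler_prod (q ^ n)) has_field_derivative 0) (at 0)" by simp
qed

lemma hats_deriv_0:
  "(A_hat has_field_derivative 2) (at 0)" "(B_hat has_field_derivative -6) (at 0)"
  "(C_hat has_field_derivative -1) (at 0)" "(D_hat has_field_derivative 3) (at 0)"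
  unfolding A_hat_def [abs_def] B_hat_def [abs_def] C_hat_def [abs_def] D_hat_def [abs_def]
  by (rule derivative_eq_intros euler_prod_power_deriv_0 refl | simp)+

text \<open>\<open>A D\<close> and \<open>B C\<close> each get the same factor under
  \<open>W6\<close>, and \<open>W3\<close> exchanges them up to that factor and sign, so the sum of
  their squares transforms like \<open>form_Q\<close> and \<open>form_E\<close>. The multiple -1/4
  cancels the value at the cusp, and division by \<open>form_E\<close>, which vanishes only there,
  leaves an invariant function.\<close>

lemma form_Q_eq:
  assumes tau: "Im \<tau> > 0"
  shows "form_Q \<tau> = \<kappa> ^ 2 * (3 / 2 * form_E \<tau> - (form_A \<tau> ^ 2 * form_D \<tau> ^ 2 + form_B \<tau> ^ 2 * form_C \<tau> ^ 2) / 4)"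
proof -
  \<comment> \<open>\<open>form_Q / \<kappa>\<^sup>2\<close> plus a quarter of the sum of squares;
    at the cusp it is -1/4 + 1/4.\<close>
  define N where "N = (\<lambda>q. q * deriv hat_U q - hat_U q ^ 2 / 4 + (A_hat q ^ 2 * D_hat q ^ 2 + q ^ 2 * B_hat q ^ 2 * C_hat q ^ 2) / 4)"
  have hN: "N holomorphic_on ball 0 1"
    unfolding N_def by (intro holomorphic_intros holomorphic_hats holomorphic_hat_U) auto
  have "N 0 = 0" by (simp add: N_def hat_U_def)
  then obtain G where G: "G holomorphic_on ball 0 1" "\<And>q. N q = q * G q" "G 0 = deriv N 0"
    using removable_zero[OF hN] by blast
  have dh: "deriv A_hat 0 = 2" "deriv B_hat 0 = - 6" "deriv C_hat 0 = - 1" "deriv D_hat 0 = 3"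
    by (intro DERIV_imp_deriv hats_deriv_0)+
  have "(hat_V has_field_derivative deriv hat_V 0) (at 0)"
    by (rule holomorphic_derivI[OF holomorphic_hat_V]) auto
  hence "(hat_U has_field_derivative hat_V 0) (at 0)"
    unfolding hat_U_def [abs_def] by (auto intro!: derivative_eq_intros)
  moreover have hat_U_0: "hat_U 0 = 1" by (simp add: hat_U_def)
  moreover have "hat_V 0 = - 2" by (simp add: hat_V_def dh)
  ultimately have dU: "(hat_U has_field_derivative - 2) (at 0)" by simp
  have "deriv hat_U holomorphic_on ball 0 1" by (intro holomorphic_deriv holomorphic_hat_U) auto
  hence "(deriv hat_U has_field_derivative deriv (deriv hat_U) 0) (at 0)"
    by (rule holomorphic_derivI) auto
  \<comment> \<open>\<open>hat_U' = -2\<close> contributes -2 and, through the square, +1;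
    \<open>A_hat\<^sup>2 D_hat\<^sup>2\<close> has slope \<open>2 (2 + 3) = 10\<close>, and a
    quarter of it gives 5/2.\<close>
  hence "(N has_field_derivative 3 / 2) (at 0)"
    unfolding N_def using DERIV_imp_deriv[OF dU] hat_U_0
    by (auto intro!: derivative_eq_intros dU hats_deriv_0)
  hence G0: "G 0 = 3 / 2" using G(3) DERIV_imp_deriv by metis
  define F where "F = (\<lambda>q. G q / (A_hat q * B_hat q * C_hat q * D_hat q))"
  have F: "F (nome \<tau>) = (form_Q \<tau> / \<kappa> ^ 2 + (form_A \<tau> ^ 2 * form_D \<tau> ^ 2 + form_B \<tau> ^ 2 * form_C \<tau> ^ 2) / 4) / form_E \<tau>"
    if t: "Im \<tau> > 0" for \<tau>
  proof -
    have "form_Q \<tau> = \<kappa> ^ 2 * (nome \<tau> * deriv hat_U (nome \<tau>) - hat_U (nome \<tau>) ^ 2 / 4)"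
      unfolding form_Q_def dlog_E_hat[OF t] DERIV_imp_deriv[OF dlog_E_deriv[OF t]] by algebra
    hence "form_Q \<tau> / \<kappa> ^ 2 = nome \<tau> * deriv hat_U (nome \<tau>) - hat_U (nome \<tau>) ^ 2 / 4"
      by simp
    hence "form_Q \<tau> / \<kappa> ^ 2 + (form_A \<tau> ^ 2 * form_D \<tau> ^ 2 + form_B \<tau> ^ 2 * form_C \<tau> ^ 2) / 4 = N (nome \<tau>)"
      by (simp add: N_def form_A_def form_B_def form_C_def form_D_def power_mult_distrib mult_ac)
    thus ?thesis
      by (simp add: F_def G(2) form_E_def form_A_def form_B_def form_C_def form_D_def)
  qed
  have const: "H q = K q'" if "H \<in> {F, F, F, F}" "K \<in> {F, F, F, F}" "q \<in> ball 0 1" "q' \<in> ball 0 1" for H K q q'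
  proof (rule atkin_lehner_orbit_constant[OF _ _ _ _ _ _ _ _ that])
    show hF: "F holomorphic_on ball 0 1"
      unfolding F_def using hats_nonzero by (auto intro!: holomorphic_intros holomorphic_hats G)
    show "F holomorphic_on ball 0 1" "F holomorphic_on ball 0 1" "F holomorphic_on ball 0 1" by (fact hF)+
    fix \<tau> :: complex assume t: "Im \<tau> > 0"
    have nz: "\<tau> \<noteq> 0" "\<tau> - 1 / 2 \<noteq> 0" using t by (auto simp: complex_eq_iff)
    define s where "s = \<tau> - 1 / 2"
    define r where "r = \<rho>"
    have r: "r ^ 2 = 3" "r \<noteq> 0" using rho_sq by (simp_all add: r_def)
    define j where "j = \<i>"
    have j: "j ^ 2 = - 1" by (simp add: j_def)
    have jj: "j * (j * z) = - z" "j * j = - 1" for z by (simp_all add: j_def)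
    define k where "k = \<kappa>"
    have k: "k \<noteq> 0" by (simp add: k_def)
    note nz = nz[folded s_def] forms_nonzero[OF t]
    note W6 = forms_W6[OF t, folded r_def j_def] form_Q_W6[OF t] 
      and W3 = forms_W3[OF t, folded r_def s_def j_def] form_Q_W3[OF t, folded s_def]
    note F6 = F[OF Im_W6_pos[OF t], folded k_def] and F3 = F[OF Im_W3_pos[OF t], folded k_def] and F = F[OF t, folded k_def]
    have E6: "form_E (W6 \<tau>) = 36 * \<tau> ^ 4 * form_E \<tau>"
      unfolding form_E_def W6 using r j by (simp add: divide_simps) (simp add: jj power4_eq_xxxx mult_ac)
    have X6: "form_A (W6 \<tau>) ^ 2 * form_D (W6 \<tau>) ^ 2 + form_B (W6 \<tau>) ^ 2 * form_C (W6 \<tau>) ^ 2 =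
       36 * \<tau> ^ 4 * (form_A \<tau> ^ 2 * form_D \<tau> ^ 2 + form_B \<tau> ^ 2 * form_C \<tau> ^ 2)"
      unfolding W6 using r j by (simp add: power_mult_distrib power_divide divide_simps) (simp add: algebra_simps)
    have E3: "form_E (W3 \<tau>) = 144 * s ^ 4 * form_E \<tau>"
      unfolding form_E_def W3 using r j by (simp add: divide_simps) (simp add: jj power4_eq_xxxx mult_ac)
    have X3: "form_A (W3 \<tau>) ^ 2 * form_D (W3 \<tau>) ^ 2 + form_B (W3 \<tau>) ^ 2 * form_C (W3 \<tau>) ^ 2 =
       144 * s ^ 4 * (form_A \<tau> ^ 2 * form_D \<tau> ^ 2 + form_B \<tau> ^ 2 * form_C \<tau> ^ 2)"
      unfolding W3 using r j by (simp add: power_mult_distrib power_divide divide_simps) (simp add: algebra_simps)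
    have E: "form_E \<tau> \<noteq> 0" using nz by (simp add: form_E_def)
    have cancel: "(x * Q / z + x * Y / 4) / (x * e) = (Q / z + Y / 4) / e" if "x \<noteq> 0" for x Q z Y e :: complex
    proof -
      have "(x * Q / z + x * Y / 4) / (x * e) = (x * (Q / z + Y / 4)) / (x * e)" by (simp add: distrib_left)
      thus ?thesis using that by simp
    qed
    have c: "36 * \<tau> ^ 4 \<noteq> 0" "144 * s ^ 4 \<noteq> 0" using nz by auto
    show w6: "F (nome (W6 \<tau>)) = F (nome \<tau>)"
      unfolding F F6 E6 X6 W6(5) by (rule cancel[OF c(1)])
    show "F (nome (W6 \<tau>)) = F (nome \<tau>)" by (fact w6)
    show w3: "F (nome (W3 \<tau>)) = F (nome \<tau>)"
      unfolding F F3 E3 X3 W3(5) by (rule cancel[OF c(2)])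
    show "F (nome (W3 \<tau>)) = F (nome \<tau>)" by (fact w3)
  qed
  have "F 0 = 3 / 2" by (simp add: F_def G0)
  hence "F (nome \<tau>) = 3 / 2" using const[of F F "nome \<tau>" 0] norm_nome_less_1[OF tau] by auto
  hence "form_Q \<tau> / \<kappa> ^ 2 + (form_A \<tau> ^ 2 * form_D \<tau> ^ 2 + form_B \<tau> ^ 2 * form_C \<tau> ^ 2) / 4 = 3 / 2 * form_E \<tau>"
    using forms_nonzero[OF tau] unfolding F[OF tau] by (simp add: form_E_def divide_simps)
  hence "form_Q \<tau> / \<kappa> ^ 2 = 3 / 2 * form_E \<tau> - (form_A \<tau> ^ 2 * form_D \<tau> ^ 2 + form_B \<tau> ^ 2 * form_C \<tau> ^ 2) / 4"
    by (simp only: eq_diff_eq)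
  thus ?thesis by (subst (asm) divide_eq_eq) (auto simp: mult_ac)
qed

section \<open>Jacobi triple product\<close>

text \<open>The q-Pochhammer symbol with base \<open>q\<^sup>2\<close>, as the triple product is
  written in the nome whose squares appear in the Euler factors.\<close>

definition qpoch :: "complex \<Rightarrow> nat \<Rightarrow> complex" where
  "qpoch q n = (\<Prod>k<n. 1 - (q\<^sup>2) ^ (k + 1))"

definition gauss_binomial :: "complex \<Rightarrow> nat \<Rightarrow> nat \<Rightarrow> complex" where
  "gauss_binomial q n k = (if k \<le> n then qpoch q n / (qpoch q k * qpoch q (n - k)) else 0)"

lemma norm_square_less_1: "norm q < 1 \<Longrightarrow> norm (q\<^sup>2 :: complex) < 1"
  by (simp add: norm_power power_less_one_iff)

lemma qpoch_nonzero: "norm q < 1 \<Longrightarrow> qpoch q n \<noteq> 0"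
  using power_Suc_neq_1[OF norm_square_less_1] by (auto simp: qpoch_def)

lemma qpoch_Suc: "qpoch q (Suc n) = qpoch q n * (1 - q ^ (2 * Suc n))"
  unfolding qpoch_def prod.lessThan_Suc by (simp only: power_mult Suc_eq_plus1)

lemma qpoch_0 [simp]: "qpoch q 0 = 1" by (simp add: qpoch_def)

lemma tendsto_qpoch: "norm q < 1 \<Longrightarrow> qpoch q \<longlonglongrightarrow> euler_prod (q\<^sup>2)"
  unfolding qpoch_def [abs_def] by (intro tendsto_euler_prod norm_square_less_1)

lemma gauss_binomial_0: "norm q < 1 \<Longrightarrow> gauss_binomial q n 0 = 1"
  using qpoch_nonzero[of q n] by (simp add: gauss_binomial_def)

text \<open>The q-Pascal rule for base \<open>q\<^sup>2\<close>; out of range the coefficient is 0,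
  which covers the edge \<open>k = n\<close>.\<close>

lemma gauss_binomial_Suc:
  assumes "norm q < 1" "k \<le> n"
  shows "gauss_binomial q (Suc n) (Suc k) = gauss_binomial q n k + q ^ (2 * Suc k) * gauss_binomial q n (Suc k)"
proof (cases "k = n")
  case True
  thus ?thesis using qpoch_nonzero[OF assms(1)] by (simp add: gauss_binomial_def)
next
  case False
  with assms obtain d where d: "n = Suc (k + d)" by (auto dest!: le_neq_implies_less less_imp_Suc_add)
  have nz: "qpoch q m \<noteq> 0" for m using qpoch_nonzero[OF assms(1)] .
  have "1 - q ^ (2 * Suc m) \<noteq> 0" for m using nz[of "Suc m"] unfolding qpoch_Suc by auto
  note nz' = nz this
  define x y c where "x = q ^ (2 * Suc k)" and "y = q ^ (2 * Suc d)" and "c = qpoch q n / (qpoch q k * qpoch q d)"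
  have xy: "q ^ (2 * Suc n) = x * y"
    unfolding x_def y_def power_add [symmetric] by (simp add: d)
  have nz'': "1 - x \<noteq> 0" "1 - y \<noteq> 0" using nz'(2) by (simp_all add: x_def y_def)
  have "gauss_binomial q (Suc n) (Suc k) = qpoch q (Suc n) / (qpoch q (Suc k) * qpoch q (Suc d))"
    "gauss_binomial q n k = qpoch q n / (qpoch q k * qpoch q (Suc d))"
    "gauss_binomial q n (Suc k) = qpoch q n / (qpoch q (Suc k) * qpoch q d)"
    using d by (simp_all add: gauss_binomial_def)
  hence "gauss_binomial q (Suc n) (Suc k) = c * ((1 - x * y) / ((1 - x) * (1 - y)))"
    "gauss_binomial q n k = c * (1 / (1 - y))" "gauss_binomial q n (Suc k) = c * (1 / (1 - x))"
    unfolding qpoch_Suc xy unfolding x_def [symmetric] y_def [symmetric] by (simp_all add: c_def mult_ac)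
  moreover have "(1 - x * y) / ((1 - x) * (1 - y)) = 1 / (1 - y) + x * (1 / (1 - x))" 
    using nz'' by (simp add: divide_simps) (simp add: algebra_simps)
  ultimately show ?thesis by (simp only: x_def [symmetric] distrib_left mult.left_commute)
qed

text \<open>Induction that splits off the factor with \<open>k = 0\<close>, so the hypothesis is
  used at \<open>x * q\<^sup>2\<close>; comparing coefficients is the q-Pascal rule.\<close>

lemma q_binomial_theorem:
  assumes "norm q < 1"
  shows "(\<Prod>k<n. 1 + x * q ^ (2 * k)) = (\<Sum>k\<le>n. gauss_binomial q n k * q ^ (k * (k - 1)) * x ^ k)"
proof (induction n arbitrary: x)
  case 0
  thus ?case by (simp add: gauss_binomial_def)
next
  case (Suc n)
  define t where "t = (\<lambda>k. gauss_binomial q n k * q ^ (k * (k - 1)) * (x * q\<^sup>2) ^ k)"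
  have step: "gauss_binomial q (Suc n) (Suc k) * q ^ (Suc k * (Suc k - 1)) * x ^ Suc k = t (Suc k) + x * t k"
    if "k \<le> n" for k
  proof -
    have e: "k * (k - 1) + 2 * k = Suc k * (Suc k - 1)" by (cases k) auto
    have "x * t k = gauss_binomial q n k * (q ^ (k * (k - 1)) * q ^ (2 * k)) * x ^ Suc k"
      unfolding t_def power_mult_distrib power_mult [of q 2 k] power_Suc by (simp only: mult_ac)
    also have "\<dots> = gauss_binomial q n k * q ^ (Suc k * (Suc k - 1)) * x ^ Suc k"
      unfolding power_add [symmetric] e ..
    finally have 1: "x * t k = gauss_binomial q n k * q ^ (Suc k * (Suc k - 1)) * x ^ Suc k" .
    have 2: "t (Suc k) = q ^ (2 * Suc k) * gauss_binomial q n (Suc k) * q ^ (Suc k * (Suc k - 1)) * x ^ Suc k"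
      unfolding t_def power_mult_distrib power_mult [symmetric] by (simp only: mult_ac)
    show ?thesis unfolding 1 2 gauss_binomial_Suc[OF assms that] by (simp only: distrib_right add_ac)
  qed
  have "(\<Prod>k<Suc n. 1 + x * q ^ (2 * k)) = (1 + x) * (\<Prod>k<n. 1 + (x * q\<^sup>2) * q ^ (2 * k))"
    unfolding prod.lessThan_Suc_shift by (simp add: power_add power2_eq_square mult_ac)
  also have "(\<Prod>k<n. 1 + (x * q\<^sup>2) * q ^ (2 * k)) = sum t {..n}"
    using Suc.IH[of "x * q\<^sup>2"] by (simp add: t_def)
  also have "(1 + x) * sum t {..n} = (\<Sum>k\<le>n. t k) + (\<Sum>k\<le>n. x * t k)"
    by (simp add: distrib_right sum_distrib_left sum.distrib)
  also have "(\<Sum>k\<le>n. t k) = (\<Sum>k\<le>Suc n. t k)" by (simp add: t_def gauss_binomial_def)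
  also have "\<dots> = t 0 + (\<Sum>k\<le>n. t (Suc k))" by (rule sum.atMost_Suc_shift)
  also have "t 0 + (\<Sum>k\<le>n. t (Suc k)) + (\<Sum>k\<le>n. x * t k) = 1 + (\<Sum>k\<le>n. t (Suc k) + x * t k)"
    by (simp add: sum.distrib t_def gauss_binomial_0[OF assms])
  also have "(\<Sum>k\<le>n. t (Suc k) + x * t k) =
      (\<Sum>k\<le>n. gauss_binomial q (Suc n) (Suc k) * q ^ (Suc k * (Suc k - 1)) * x ^ Suc k)"
    by (intro sum.cong refl, rule step [symmetric]) simp
  also have "1 + \<dots> = (\<Sum>k\<le>Suc n. gauss_binomial q (Suc n) k * q ^ (k * (k - 1)) * x ^ k)"
    unfolding sum.atMost_Suc_shift by (simp add: gauss_binomial_0[OF assms])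
  finally show ?case .
qed

text \<open>The bilateral theta series with the terms of index k and -k taken together.\<close>

definition theta_term :: "complex \<Rightarrow> complex \<Rightarrow> nat \<Rightarrow> complex" where
  "theta_term q w k = (if k = 0 then 1 else q ^ (k\<^sup>2) * (w ^ k + inverse w ^ k))"

lemma sum_split_lessThan: "(\<Sum>k<m + (p::nat). g k) = (\<Sum>k<m. g k) + (\<Sum>k<p. g (m + k) :: complex)"
  by (induction p) (simp_all add: add_ac)

lemma prod_split_lessThan: "(\<Prod>k<m + (p::nat). g k) = (\<Prod>k<m. g k) * (\<Prod>k<p. g (m + k) :: complex)"
  by (induction p) (simp_all add: mult_ac)

text \<open>The q-binomial theorem with 2m factors, centred: the upper half of the factors carries
  \<open>w\<close>, the lower half, after extraction of monomials, its inverse.\<close>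

lemma finite_triple_product:
  assumes q: "norm q < 1" "q \<noteq> 0" and w: "w \<noteq> 0"
  shows "(\<Prod>k<m. (1 + w * q ^ (2 * k + 1)) * (1 + inverse w * q ^ (2 * k + 1))) =
     (\<Sum>i\<le>m. gauss_binomial q (2 * m) (m + i) * theta_term q w i)"
proof -
  \<comment> \<open>Chosen so that
    \<open>x * q ^ (2 * (m + k)) = w * q ^ (2 * k + 1)\<close>.\<close>
  define x where "x = w * q / q ^ (2 * m)"
  define g where "g = (\<lambda>k. q ^ m\<^sup>2 / w ^ m * (gauss_binomial q (2 * m) k * q ^ (k * (k - 1)) * x ^ k))"
  have sq: "(\<Prod>k<m. w / q ^ (2 * k + 1)) = w ^ m / q ^ (m\<^sup>2)"
  proof (induction m)
    case (Suc m)
    have "(Suc m)\<^sup>2 = m\<^sup>2 + (2 * m + 1)" by (simp add: power2_eq_square)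
    thus ?case unfolding prod.lessThan_Suc Suc.IH by (simp add: power_add mult_ac)
  qed simp
  have "(\<Prod>k<m. 1 + x * q ^ (2 * k)) = (\<Prod>k<m. 1 + x * q ^ (2 * (m - Suc k)))"
    by (rule prod.nat_diff_reindex [symmetric])
  also have "\<dots> = (\<Prod>k<m. (w / q ^ (2 * k + 1)) * (1 + inverse w * q ^ (2 * k + 1)))"
  proof (intro prod.cong refl)
    fix k assume "k \<in> {..<m}"
    hence "2 * m = 2 * (m - Suc k) + (2 * k + 1) + 1" by auto
    hence "q ^ (2 * m) = q ^ (2 * (m - Suc k)) * q ^ (2 * k + 1) * q" by (metis power_add power_one_right)
    hence "x * q ^ (2 * (m - Suc k)) = w / q ^ (2 * k + 1)" using q by (simp add: x_def)
    thus "1 + x * q ^ (2 * (m - Suc k)) = (w / q ^ (2 * k + 1)) * (1 + inverse w * q ^ (2 * k + 1))"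
      using q w by (simp add: field_simps)
  qed
  also have "\<dots> = w ^ m / q ^ (m\<^sup>2) * (\<Prod>k<m. 1 + inverse w * q ^ (2 * k + 1))"
    by (simp only: prod.distrib sq)
  finally have p1: "(\<Prod>k<m. 1 + x * q ^ (2 * k)) = w ^ m / q ^ (m\<^sup>2) * (\<Prod>k<m. 1 + inverse w * q ^ (2 * k + 1))" .
  have p2: "(\<Prod>k<m. 1 + x * q ^ (2 * (m + k))) = (\<Prod>k<m. 1 + w * q ^ (2 * k + 1))"
    using q by (intro prod.cong refl) (simp add: x_def power_add distrib_left)
  have "(\<Prod>k<m. (1 + w * q ^ (2 * k + 1)) * (1 + inverse w * q ^ (2 * k + 1))) = 
     q ^ m\<^sup>2 / w ^ m * (\<Prod>k<m + m. 1 + x * q ^ (2 * k))"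
    unfolding prod_split_lessThan p1 p2 prod.distrib using q w by simp
  also have "m + m = 2 * m" by simp
  also have "q ^ m\<^sup>2 / w ^ m * (\<Prod>k<2 * m. 1 + x * q ^ (2 * k)) = (\<Sum>k\<le>2 * m. g k)"
    unfolding q_binomial_theorem[OF q(1)] g_def sum_distrib_left ..
  also have "\<dots> = (\<Sum>k<m + Suc m. g k)" by (intro sum.cong) auto
  also have "\<dots> = (\<Sum>k<m. g (m - Suc k)) + (g m + (\<Sum>k<m. g (m + Suc k)))"
    unfolding sum_split_lessThan sum.nat_diff_reindex sum.lessThan_Suc_shift by simp
  also have "\<dots> = g m + (\<Sum>k<m. g (m + Suc k) + g (m - Suc k))" by (simp add: sum.distrib)
  also have "\<dots> = (\<Sum>i\<le>m. gauss_binomial q (2 * m) (m + i) * theta_term q w i)"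
  proof -
    \<comment> \<open>Completing the square: \<open>i\<close> is the distance from k to the centre
      m, so the exponents of \<open>q\<close> combine to \<open>(k - m)\<^sup>2\<close>.\<close>
    have g: "g k = gauss_binomial q (2 * m) k * (q ^ (i\<^sup>2) * v)" 
      if "m\<^sup>2 + k * k = i\<^sup>2 + 2 * m * k" "w ^ k / w ^ m = v" for k i v
    proof -
      have "q ^ m\<^sup>2 * q ^ (k * (k - 1)) * q ^ k = q ^ (m\<^sup>2 + k * k)"
        unfolding power_add [symmetric] by (cases k) (auto simp: algebra_simps)
      also have "\<dots> = q ^ (i\<^sup>2) * (q ^ (2 * m)) ^ k" using that by (simp add: power_add power_mult)
      finally have "q ^ m\<^sup>2 * q ^ (k * (k - 1)) * (q / q ^ (2 * m)) ^ k = q ^ i\<^sup>2"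
        using q by (simp add: power_divide)
      moreover have "g k = gauss_binomial q (2 * m) k * ((q ^ m\<^sup>2 * q ^ (k * (k - 1)) * (q / q ^ (2 * m)) ^ k) * (w ^ k / w ^ m))"
        by (simp add: g_def x_def power_mult_distrib power_divide mult_ac)
      ultimately show ?thesis using that by simp
    qed
    have 0: "g m = gauss_binomial q (2 * m) (m + 0) * theta_term q w 0"
      using g[of m 0 1] w by (simp add: theta_term_def power2_eq_square)
    have "g (m + Suc i) + g (m - Suc i) = gauss_binomial q (2 * m) (m + Suc i) * theta_term q w (Suc i)" 
      if "i < m" for i
    proof -
      define d where "d = m - Suc i"
      hence d: "m = Suc i + d" using \<open>i < m\<close> by simp
      have "g (m + Suc i) = gauss_binomial q (2 * m) (m + Suc i) * (q ^ ((Suc i)\<^sup>2) * w ^ Suc i)"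
        using w by (intro g) (simp_all add: power2_eq_square algebra_simps power_add)
      moreover have "g (m - Suc i) = gauss_binomial q (2 * m) (m - Suc i) * (q ^ ((Suc i)\<^sup>2) * inverse w ^ Suc i)"
        using w by (intro g) (simp_all add: d power2_eq_square algebra_simps power_add field_simps)
      moreover have "gauss_binomial q (2 * m) (m - Suc i) = gauss_binomial q (2 * m) (m + Suc i)"
      proof -
        have "m - Suc i \<le> 2 * m" "m + Suc i \<le> 2 * m" "2 * m - (m - Suc i) = m + Suc i" "2 * m - (m + Suc i) = m - Suc i"
          using \<open>i < m\<close> by auto
        thus ?thesis by (simp only: gauss_binomial_def if_True mult.commute)
      qed
      ultimately show ?thesis by (simp add: theta_term_def distrib_left)
    qed
    hence "(\<Sum>k<m. g (m + Suc k) + g (m - Suc k)) = (\<Sum>k<m. gauss_binomial q (2 * m) (m + Suc k) * theta_term q w (Suc k))"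
      by (intro sum.cong) auto
    thus ?thesis unfolding 0 lessThan_Suc_atMost [symmetric] sum.lessThan_Suc_shift by simp
  qed
  finally show ?thesis .
qed

text \<open>The range of \<open>w\<close> contains the two values used later, 1 and
  \<open>q\<close>. At \<open>w = q\<close> the negative part only decays like
  \<open>q ^ (k\<^sup>2 - k)\<close>, hence the factor \<open>inverse (norm q)\<close> in the
  majorant.\<close>

lemma summable_theta_term:
  fixes q w :: complex
  assumes q: "norm q < 1" and w: "norm q \<le> norm w" "norm w \<le> 1" "w \<noteq> 0" "q \<noteq> 0"
  shows "summable (\<lambda>k. norm (q ^ (k\<^sup>2) * w ^ k))" "summable (\<lambda>k. norm (q ^ (k\<^sup>2) * inverse w ^ k))"
proof -
  have s: "summable (\<lambda>k. inverse (norm q) * norm q ^ k)" using q by (intro summable_mult summable_geometric) auto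
  have a: "norm (q ^ (k\<^sup>2) * w ^ k) \<le> inverse (norm q) * norm q ^ k" for k
  proof -
    have "norm (q ^ (k\<^sup>2) * w ^ k) \<le> norm q ^ k * 1"
      unfolding norm_mult norm_power using q w
      by (intro mult_mono power_decreasing power_le_one) (auto simp: power2_eq_square)
    also have "\<dots> \<le> norm q ^ k * inverse (norm q)" using q w(4) by (intro mult_left_mono) (auto simp: one_le_inverse_iff)
    finally show ?thesis by (simp add: mult_ac)
  qed
  show "summable (\<lambda>k. norm (q ^ (k\<^sup>2) * w ^ k))"
    by (rule summable_comparison_test'[OF s, of 0]) (use a in auto)
  have b: "norm (q ^ (k\<^sup>2) * inverse w ^ k) \<le> inverse (norm q) * norm q ^ k" for k
  proof (cases k)
    case (Suc n)
    have "norm (q ^ (k\<^sup>2) * inverse w ^ k) = norm q ^ (k * n) * (norm q / norm w) ^ k"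
    proof -
      have "k\<^sup>2 = k * n + k" by (simp add: Suc power2_eq_square)
      thus ?thesis by (simp add: norm_mult norm_power norm_inverse power_divide power_add divide_inverse power_inverse power_mult_distrib)
    qed
    also have "\<dots> \<le> norm q ^ n * 1"
      using q w by (intro mult_mono power_decreasing power_le_one) (auto simp: Suc divide_simps)
    also have "\<dots> = inverse (norm q) * norm q ^ k" using w(4) by (simp add: Suc)
    finally show ?thesis .
  qed (use q w(4) in \<open>auto simp: one_le_inverse_iff\<close>)
  show "summable (\<lambda>k. norm (q ^ (k\<^sup>2) * inverse w ^ k))"
    by (rule summable_comparison_test'[OF s, of 0]) (use b in auto)
qed

text \<open>\<open>qpoch q\<close> converges to a nonzero limit, so it and its inverse are bounded.
  The bound supplies the domination in the limit of the finite triple product.\<close>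

lemma gauss_binomial_bounded:
  assumes "norm q < 1"
  obtains K where "\<And>n k. norm (gauss_binomial q n k) \<le> K" "K \<ge> 0"
proof -
  have "Bseq (qpoch q)" by (rule convergent_imp_Bseq, rule convergentI, rule tendsto_qpoch[OF assms])
  then obtain B where B: "\<And>n. norm (qpoch q n) \<le> B" by (auto simp: Bseq_def)
  have "(\<lambda>n. inverse (qpoch q n)) \<longlonglongrightarrow> inverse (euler_prod (q\<^sup>2))"
    using assms by (intro tendsto_inverse tendsto_qpoch euler_prod_nonzero norm_square_less_1)
  hence "Bseq (\<lambda>n. inverse (qpoch q n))" by (intro convergent_imp_Bseq convergentI)
  then obtain B' where B': "\<And>n. norm (inverse (qpoch q n)) \<le> B'" by (auto simp: Bseq_def)
  have pos: "B \<ge> 0" "B' \<ge> 0" using B[of 0] B'[of 0] by simp_all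
  have "norm (gauss_binomial q n k) \<le> B * (B' * B')" for n k
  proof (cases "k \<le> n")
    case True
    hence "norm (gauss_binomial q n k) = norm (qpoch q n) * (norm (inverse (qpoch q k)) * norm (inverse (qpoch q (n - k))))"
      by (simp add: gauss_binomial_def norm_mult norm_divide norm_inverse field_simps)
    also have "\<dots> \<le> B * (B' * B')" using pos by (intro mult_mono B B') auto
    finally show ?thesis .
  qed (use pos in \<open>simp add: gauss_binomial_def\<close>)
  thus ?thesis using that[of "B * (B' * B')"] pos by auto
qed

text \<open>Tannery's theorem: for fixed k the central coefficient tends to
  \<open>P / (P * P) = 1 / P\<close> with \<open>P = euler_prod (q\<^sup>2)\<close>.\<close>

lemma triple_product_limit:
  assumes q: "norm q < 1" and w: "norm q \<le> norm w" "norm w \<le> 1" "w \<noteq> 0" "q \<noteq> 0"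
  shows "(\<lambda>m. \<Prod>k<m. (1 + w * q ^ (2 * k + 1)) * (1 + inverse w * q ^ (2 * k + 1)))
     \<longlonglongrightarrow> (\<Sum>k. theta_term q w k) / euler_prod (q\<^sup>2)"
    and "summable (\<lambda>k. norm (theta_term q w k))"
proof -
  have "summable (\<lambda>k. norm (q ^ (k\<^sup>2) * w ^ k) + norm (q ^ (k\<^sup>2) * inverse w ^ k))"
    by (intro summable_add summable_theta_term assms)
  moreover have "norm (norm (theta_term q w k)) \<le> norm (q ^ (k\<^sup>2) * w ^ k) + norm (q ^ (k\<^sup>2) * inverse w ^ k)" for k
    using norm_triangle_ineq[of "q ^ (k\<^sup>2) * w ^ k" "q ^ (k\<^sup>2) * inverse w ^ k"]
    by (auto simp: theta_term_def distrib_left)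
  ultimately show sm: "summable (\<lambda>k. norm (theta_term q w k))"
    by (rule summable_comparison_test'[where N = 0])
  obtain K where K: "\<And>n k. norm (gauss_binomial q n k) \<le> K" "K \<ge> 0"
    using gauss_binomial_bounded[OF q] by blast
  define a where "a = (\<lambda>k m. if k \<le> m then gauss_binomial q (2 * m) (m + k) * theta_term q w k else 0)"
  define P where "P = euler_prod (q\<^sup>2)"
  have P: "P \<noteq> 0" unfolding P_def by (intro euler_prod_nonzero norm_square_less_1 q)
  have "(\<lambda>m. \<Sum>k. a k m) \<longlonglongrightarrow> (\<Sum>k. theta_term q w k / P)"
  proof (rule tannerys_theorem[THEN conjunct2, THEN conjunct2])
    show "eventually (\<lambda>(k, m). norm (a k m) \<le> K * norm (theta_term q w k)) (at_top \<times>\<^sub>F sequentially)"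
      by (intro always_eventually) (auto simp: a_def norm_mult K(2) intro!: mult_right_mono K(1))
    show "summable (\<lambda>k. K * norm (theta_term q w k))" by (intro summable_mult sm)
    fix k
    have "(\<lambda>m. qpoch q (2 * m) / (qpoch q (m + k) * qpoch q (m - k)) * theta_term q w k) \<longlonglongrightarrow> P / (P * P) * theta_term q w k"
      unfolding P_def
      by (intro tendsto_intros filterlim_compose[OF tendsto_qpoch[OF q]] filterlim_subseq filterlim_add_const_nat_at_top
            filterlim_minus_const_nat_at_top) (use P in \<open>auto simp: P_def strict_mono_def\<close>)
    moreover have "\<forall>\<^sub>F m in sequentially. qpoch q (2 * m) / (qpoch q (m + k) * qpoch q (m - k)) * theta_term q w k = a k m"
      using eventually_ge_at_top[of k] by eventually_elim (auto simp: a_def gauss_binomial_def)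
    ultimately have "a k \<longlonglongrightarrow> P / (P * P) * theta_term q w k" by (rule Lim_transform_eventually)
    thus "a k \<longlonglongrightarrow> theta_term q w k / P" using P by simp
  qed simp
  moreover have "(\<Sum>k. a k m) = (\<Prod>k<m. (1 + w * q ^ (2 * k + 1)) * (1 + inverse w * q ^ (2 * k + 1)))" for m
    unfolding finite_triple_product[OF q w(4,3)]
    by (subst suminf_finite[of "{..m}"]) (auto simp: a_def)
  ultimately show "(\<lambda>m. \<Prod>k<m. (1 + w * q ^ (2 * k + 1)) * (1 + inverse w * q ^ (2 * k + 1)))
     \<longlonglongrightarrow> (\<Sum>k. theta_term q w k) / euler_prod (q\<^sup>2)"
    using suminf_divide[OF summable_norm_cancel[OF sm], of P] by (simp add: P_def)
qed

section \<open>The cubic theta function\<close>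

lemma has_sum_int_split:
  fixes f :: "int \<Rightarrow> complex"
  assumes "summable (\<lambda>k. norm (f (int k)))" "summable (\<lambda>k. norm (f (- int (Suc k))))"
  shows "(f has_sum (\<Sum>k. f (int k)) + (\<Sum>k. f (- int (Suc k)))) UNIV"
    and "(\<lambda>j. norm (f j)) summable_on UNIV"
proof -
  have inj: "inj int" "inj (\<lambda>k. - int (Suc k))" by (auto simp: inj_on_def)
  have disj: "range int \<inter> range (\<lambda>k. - int (Suc k)) = {}" by auto
  have un: "range int \<union> range (\<lambda>k. - int (Suc k)) = UNIV"
  proof (intro equalityI subsetI)
    fix j :: int
    show "j \<in> range int \<union> range (\<lambda>k. - int (Suc k))" by (cases j) auto
  qed auto
  have "(f has_sum (\<Sum>k. f (int k))) (range int)"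
    using norm_summable_imp_has_sum[OF assms(1) summable_sums[OF summable_norm_cancel[OF assms(1)]]]
    by (simp add: has_sum_reindex[OF inj(1)] o_def)
  moreover have "(f has_sum (\<Sum>k. f (- int (Suc k)))) (range (\<lambda>k. - int (Suc k)))"
    using norm_summable_imp_has_sum[OF assms(2) summable_sums[OF summable_norm_cancel[OF assms(2)]]]
    by (simp only: has_sum_reindex[OF inj(2)] o_def)
  ultimately show "(f has_sum (\<Sum>k. f (int k)) + (\<Sum>k. f (- int (Suc k)))) UNIV"
    using has_sum_Un_disjoint[OF _ _ disj] un by metis
  have "(\<lambda>j. norm (f j)) summable_on range int"
    using norm_summable_imp_summable_on[of "\<lambda>k. norm (f (int k))"] assms(1)
    by (simp add: summable_on_reindex[OF inj(1)] o_def)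
  moreover have "(\<lambda>j. norm (f j)) summable_on range (\<lambda>k. - int (Suc k))"
    using norm_summable_imp_summable_on[of "\<lambda>k. norm (f (- int (Suc k)))"] assms(2)
    by (simp only: summable_on_reindex[OF inj(2)] o_def real_norm_def abs_norm_cancel)
  ultimately show "(\<lambda>j. norm (f j)) summable_on UNIV"
    using summable_on_Un_disjoint[OF _ _ disj] un by metis
qed

lemma has_sum_theta:
  assumes q: "norm q < 1" and w: "norm q \<le> norm w" "norm w \<le> 1" "w \<noteq> 0" "q \<noteq> 0"
  shows "((\<lambda>j::int. q ^ nat (j\<^sup>2) * w powi j) has_sum (\<Sum>k. theta_term q w k)) UNIV"
    and "(\<lambda>j::int. norm (q ^ nat (j\<^sup>2) * w powi j)) summable_on UNIV"
proof -
  define f where "f = (\<lambda>j::int. q ^ nat (j\<^sup>2) * w powi j)"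
  have f1: "f (int k) = q ^ (k\<^sup>2) * w ^ k" for k by (simp add: f_def nat_power_eq)
  have f2: "f (- int (Suc k)) = q ^ ((Suc k)\<^sup>2) * inverse w ^ Suc k" for k
  proof -
    have "nat ((- int (Suc k))\<^sup>2) = (Suc k)\<^sup>2" by (simp only: power2_minus) (simp add: nat_power_eq del: of_nat_Suc)
    thus ?thesis by (simp add: f_def power_int_minus power_inverse del: of_nat_Suc power_Suc)
  qed
  note sm = summable_theta_term[OF q w]
  have s1: "summable (\<lambda>k. norm (f (int k)))" using sm(1) by (simp only: f1)
  have s2: "summable (\<lambda>k. norm (f (- int (Suc k))))" 
    using sm(2) unfolding f2 by (subst (asm) summable_Suc_iff [symmetric])
  have "(\<Sum>k. theta_term q w k) = (\<Sum>k. theta_term q w (Suc k)) + 1"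
    using suminf_split_head[OF summable_norm_cancel[OF triple_product_limit(2)[OF q w]]] by (simp add: theta_term_def)
  also have "(\<Sum>k. theta_term q w (Suc k)) = (\<Sum>k. q ^ ((Suc k)\<^sup>2) * w ^ Suc k + f (- int (Suc k)))"
    by (simp only: f2) (simp add: theta_term_def distrib_left)
  also have "\<dots> = (\<Sum>k. q ^ ((Suc k)\<^sup>2) * w ^ Suc k) + (\<Sum>k. f (- int (Suc k)))"
    using summable_norm_cancel[OF sm(1)] summable_norm_cancel[OF s2]
    by (intro suminf_add [symmetric]) (simp_all only: summable_Suc_iff[of "\<lambda>k. q ^ (k\<^sup>2) * w ^ k"])
  also have "(\<Sum>k. q ^ ((Suc k)\<^sup>2) * w ^ Suc k) = (\<Sum>k. f (int k)) - 1"
    using suminf_split_head[OF summable_norm_cancel[OF sm(1)]] by (simp add: f1)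
  finally have "(\<Sum>k. theta_term q w k) = (\<Sum>k. f (int k)) + (\<Sum>k. f (- int (Suc k)))" by simp
  thus "((\<lambda>j::int. q ^ nat (j\<^sup>2) * w powi j) has_sum (\<Sum>k. theta_term q w k)) UNIV"
    "(\<lambda>j::int. norm (q ^ nat (j\<^sup>2) * w powi j)) summable_on UNIV"
    using has_sum_int_split[OF s1 s2] by (simp_all add: f_def)
qed

text \<open>Product form of the sum of \<open>q^(j\<^sup>2)\<close> over the integers, the triple
  product at \<open>w = 1\<close>.\<close>

definition theta_phi :: "complex \<Rightarrow> complex" where
  "theta_phi q = euler_prod (- q) ^ 2 / euler_prod (q ^ 2)"

text \<open>Product form of the sum of \<open>q^(j\<^sup>2 + j)\<close> over the integers, the
  triple product at \<open>w = q\<close>; the 2 is the factor \<open>1 + q^0\<close> there.\<close>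

definition theta_psi :: "complex \<Rightarrow> complex" where
  "theta_psi q = 2 * euler_prod (q ^ 4) ^ 2 / euler_prod (q ^ 2)"

lemma theta_phi_series:
  assumes "norm q < 1" "q \<noteq> 0"
  shows "((\<lambda>j::int. q ^ nat (j\<^sup>2)) has_sum theta_phi q) UNIV"
    and "(\<lambda>j::int. norm (q ^ nat (j\<^sup>2))) summable_on UNIV"
proof -
  have q2: "norm (q ^ 2) < 1" using norm_square_less_1[OF assms(1)] .
  have nz: "euler_prod (q ^ 2) \<noteq> 0" using euler_prod_nonzero[OF q2] .
  have "(\<lambda>m. (\<Prod>k<m. 1 - (- q) ^ (2 * k + 1)) * (\<Prod>k<m. 1 - (- q) ^ (2 * k + 1))) \<longlonglongrightarrow>
     (euler_prod (- q) / euler_prod ((- q) ^ 2)) * (euler_prod (- q) / euler_prod ((- q) ^ 2))"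
    using assms by (intro tendsto_mult euler_prod_odd) auto
  moreover have "(\<lambda>m. \<Prod>k<m. (1 + 1 * q ^ (2 * k + 1)) * (1 + inverse 1 * q ^ (2 * k + 1)))
     \<longlonglongrightarrow> (\<Sum>k. theta_term q 1 k) / euler_prod (q\<^sup>2)"
    using assms by (intro triple_product_limit) auto
  ultimately have "(\<Sum>k. theta_term q 1 k) / euler_prod (q\<^sup>2) = (euler_prod (- q) / euler_prod (q ^ 2)) * (euler_prod (- q) / euler_prod (q ^ 2))"
    using LIMSEQ_unique by (simp add: prod.distrib)
  hence "(\<Sum>k. theta_term q 1 k) = theta_phi q" using nz by (simp add: theta_phi_def field_simps power2_eq_square)
  thus "((\<lambda>j::int. q ^ nat (j\<^sup>2)) has_sum theta_phi q) UNIV" "(\<lambda>j::int. norm (q ^ nat (j\<^sup>2))) summable_on UNIV"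
    using has_sum_theta[of q 1] assms by simp_all
qed

lemma nonneg_pronic: "0 \<le> (j::int)\<^sup>2 + j"
proof (cases "j \<ge> 0")
  case False
  hence "0 \<le> j * (j + 1)" by (intro mult_nonpos_nonpos) auto
  thus ?thesis by (simp add: power2_eq_square algebra_simps)
qed simp

lemma theta_psi_series:
  assumes "norm q < 1" "q \<noteq> 0"
  shows "((\<lambda>j::int. q ^ nat (j\<^sup>2 + j)) has_sum theta_psi q) UNIV"
    and "(\<lambda>j::int. norm (q ^ nat (j\<^sup>2 + j))) summable_on UNIV"
proof -
  have q2: "norm (q ^ 2) < 1" and q4: "norm (q ^ 4) < 1" 
    using assms by (auto simp: norm_power power_less_one_iff)
  have nz: "euler_prod (q ^ 2) \<noteq> 0" using euler_prod_nonzero[OF q2] .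
  define R where "R = (\<lambda>m. \<Prod>k<m. 1 + (q ^ 2) ^ (k + 1))"
  have "(\<lambda>m. (\<Prod>k<m. 1 - (q ^ 4) ^ (k + 1)) / (\<Prod>k<m. 1 - (q ^ 2) ^ (k + 1))) \<longlonglongrightarrow> euler_prod (q ^ 4) / euler_prod (q ^ 2)"
    by (intro tendsto_divide tendsto_euler_prod q2 q4 nz)
  moreover have "(\<Prod>k<m. 1 - (q ^ 4) ^ (k + 1)) / (\<Prod>k<m. 1 - (q ^ 2) ^ (k + 1)) = R m" for m
  proof -
    have "1 - (q ^ 4) ^ (k + 1) = (1 + (q ^ 2) ^ (k + 1)) * (1 - (q ^ 2) ^ (k + 1))" for k
    proof -
      have "(q ^ 4) ^ (k + 1) = (q ^ 2) ^ (k + 1) * (q ^ 2) ^ (k + 1)"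
      proof -
        have "q ^ 4 = q ^ 2 * q ^ 2" by (simp flip: power_add)
        thus ?thesis by (simp only: power_mult_distrib)
      qed
      moreover have "1 - x * x = (1 + x) * (1 - x)" for x :: complex by (simp add: algebra_simps)
      ultimately show ?thesis by (simp only:)
    qed
    hence "(\<Prod>k<m. 1 - (q ^ 4) ^ (k + 1)) = R m * (\<Prod>k<m. 1 - (q ^ 2) ^ (k + 1))"
      by (simp only: R_def prod.distrib)
    moreover have "(\<Prod>k<m. 1 - (q ^ 2) ^ (k + 1)) \<noteq> 0" using power_Suc_neq_1[OF q2] by auto
    ultimately show ?thesis by simp
  qed
  ultimately have R: "R \<longlonglongrightarrow> euler_prod (q ^ 4) / euler_prod (q ^ 2)" by simp
  \<comment> \<open>At \<open>w = q\<close> the second family is \<open>1 + q^(2 k)\<close>, one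
    step behind \<open>R\<close>. The extra factor on the left completes it to
    \<open>2 * R m\<close> and tends to 1.\<close>
  have "(\<Prod>k<m. (1 + q * q ^ (2 * k + 1)) * (1 + inverse q * q ^ (2 * k + 1))) * (1 + (q ^ 2) ^ m) = 2 * R m * R m" for m
  proof -
    have "(\<Prod>k<m. (1 + q * q ^ (2 * k + 1)) * (1 + inverse q * q ^ (2 * k + 1))) = R m * (\<Prod>k<m. 1 + (q ^ 2) ^ k)"
    proof -
      have "q * q ^ (2 * k + 1) = (q ^ 2) ^ (k + 1)" "inverse q * q ^ (2 * k + 1) = (q ^ 2) ^ k" for k
        unfolding power_mult [symmetric] using assms(2) by simp_all
      thus ?thesis by (simp only: R_def prod.distrib)
    qed
    moreover have "(\<Prod>k<m. 1 + (q ^ 2) ^ k) * (1 + (q ^ 2) ^ m) = 2 * R m"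
    proof -
      have "(\<Prod>k<m. 1 + (q ^ 2) ^ k) * (1 + (q ^ 2) ^ m) = (\<Prod>k<Suc m. 1 + (q ^ 2) ^ k)" by simp
      also have "\<dots> = 2 * R m" unfolding prod.lessThan_Suc_shift R_def by simp
      finally show ?thesis .
    qed
    ultimately show ?thesis by (simp add: mult_ac)
  qed
  moreover have "(\<lambda>m. (\<Prod>k<m. (1 + q * q ^ (2 * k + 1)) * (1 + inverse q * q ^ (2 * k + 1))) * (1 + (q ^ 2) ^ m))
     \<longlonglongrightarrow> (\<Sum>k. theta_term q q k) / euler_prod (q\<^sup>2) * (1 + 0)"
    using assms by (intro tendsto_mult triple_product_limit tendsto_add tendsto_const LIMSEQ_power_zero q2) auto
  moreover have "(\<lambda>m. 2 * R m * R m) \<longlonglongrightarrow> 2 * (euler_prod (q ^ 4) / euler_prod (q ^ 2)) * (euler_prod (q ^ 4) / euler_prod (q ^ 2))"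
    by (intro tendsto_intros R)
  ultimately have "(\<Sum>k. theta_term q q k) / euler_prod (q\<^sup>2) = 2 * (euler_prod (q ^ 4) / euler_prod (q ^ 2)) * (euler_prod (q ^ 4) / euler_prod (q ^ 2))"
    using LIMSEQ_unique by simp
  hence "(\<Sum>k. theta_term q q k) = theta_psi q" using nz by (simp add: theta_psi_def field_simps power2_eq_square)
  moreover have "q ^ nat (j\<^sup>2) * q powi j = q ^ nat (j\<^sup>2 + j)" for j
  proof -
    have "q ^ nat (j\<^sup>2) * q powi j = q powi (j\<^sup>2 + j)" using assms(2) by (simp add: power_int_add power_int_nonneg_exp)
    thus ?thesis using nonneg_pronic[of j] by (simp add: power_int_nonneg_exp)
  qed
  ultimately show "((\<lambda>j::int. q ^ nat (j\<^sup>2 + j)) has_sum theta_psi q) UNIV" "(\<lambda>j::int. norm (q ^ nat (j\<^sup>2 + j))) summable_on UNIV"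
    using has_sum_theta[of q q] assms by simp_all
qed

lemma has_sum_times:
  fixes f g :: "int \<Rightarrow> complex"
  assumes "(f has_sum a) UNIV" "(g has_sum b) UNIV"
    and "(\<lambda>j. norm (f j)) summable_on UNIV" "(\<lambda>j. norm (g j)) summable_on UNIV"
  shows "((\<lambda>(j, k). f j * g k) has_sum a * b) UNIV"
proof -
  have "((\<lambda>(j, k). f j * g k) has_sum a * b) (UNIV \<times> UNIV)"
  proof (rule has_sum_SigmaI)
    show "((\<lambda>k. case (j, k) of (j, k) \<Rightarrow> f j * g k) has_sum f j * b) UNIV" for j
      using has_sum_cmult_right[OF assms(2), of "f j"] by simp
    show "((\<lambda>j. f j * b) has_sum a * b) UNIV"
      using has_sum_cmult_left[OF assms(1), of b] by simp
    have "(\<lambda>p. norm ((\<lambda>(j, k). f j * g k) p)) summable_on (UNIV \<times> UNIV)"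
    proof (rule summable_on_SigmaI)
      show "((\<lambda>k. norm ((\<lambda>(j, k). f j * g k) (j, k))) has_sum norm (f j) * infsum (\<lambda>k. norm (g k)) UNIV) UNIV" for j
        using has_sum_cmult_right[OF has_sum_infsum[OF assms(4)], of "norm (f j)"] by (simp add: norm_mult)
      show "(\<lambda>j. norm (f j) * infsum (\<lambda>k. norm (g k)) UNIV) summable_on UNIV"
        using assms(3) by (rule summable_on_cmult_left)
    qed auto
    thus "(\<lambda>(j, k). f j * g k) summable_on (UNIV \<times> UNIV)"
      by (rule abs_summable_summable)
  qed
  thus ?thesis by simp
qed

lemma nonneg_norm_form: "0 \<le> (m::int)\<^sup>2 + m * n + n\<^sup>2"
proof -
  have "4 * (m\<^sup>2 + m * n + n\<^sup>2) = (2 * m + n)\<^sup>2 + 3 * n\<^sup>2" by algebra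
  also have "\<dots> \<ge> 0" by simp
  finally show ?thesis by (simp only: zero_le_mult_iff) simp
qed

lemma nat_linear_combination:
  assumes "0 \<le> (a::int)" "0 \<le> b"
  shows "nat (a + 3 * b) = nat a + 3 * nat b" "nat (1 + (a + 3 * b)) = 1 + (nat a + 3 * nat b)"
  using assms by (simp_all add: nat_add_distrib nat_mult_distrib)

text \<open>Splits the quadratic form by the parity of n: \<open>m = j - k\<close>,
  \<open>n = 2 k\<close> gives \<open>j\<^sup>2 + 3 k\<^sup>2\<close>, and
  \<open>n = 2 k + 1\<close> gives \<open>1 + (j\<^sup>2 + j) + 3 (k\<^sup>2 + k)\<close>.\<close>

definition cubic_theta_sum :: "complex \<Rightarrow> complex" where
  "cubic_theta_sum q = theta_phi q * theta_phi (q ^ 3) + q * (theta_psi q * theta_psi (q ^ 3))"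

lemma has_sum_cubic_theta:
  assumes "norm q < 1" "q \<noteq> 0"
  shows "((\<lambda>(m, n). q ^ nat (m\<^sup>2 + m * n + n\<^sup>2)) has_sum cubic_theta_sum q) UNIV"
proof -
  have q3: "norm (q ^ 3) < 1" "q ^ 3 \<noteq> 0" using assms by (auto simp: norm_power power_less_one_iff)
  have "((\<lambda>(j, k). q ^ nat (j\<^sup>2) * (q ^ 3) ^ nat (k\<^sup>2)) has_sum theta_phi q * theta_phi (q ^ 3)) UNIV"
    by (intro has_sum_times theta_phi_series assms q3)
  also have "?this \<longleftrightarrow> ((\<lambda>(m, n). q ^ nat (m\<^sup>2 + m * n + n\<^sup>2)) has_sum theta_phi q * theta_phi (q ^ 3)) {(m, n). even n}"
  proof (rule has_sum_reindex_bij_witness[where j = "\<lambda>(j, k). (j - k, 2 * k)" and i = "\<lambda>(m, n). (m + n div 2, n div 2)"])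
    fix p :: "int \<times> int"
    obtain j k where p: "p = (j, k)" by force
    have "(j - k)\<^sup>2 + (j - k) * (2 * k) + (2 * k)\<^sup>2 = j\<^sup>2 + 3 * k\<^sup>2" by algebra
    hence "nat ((j - k)\<^sup>2 + (j - k) * (2 * k) + (2 * k)\<^sup>2) = nat (j\<^sup>2) + 3 * nat (k\<^sup>2)"
      by (simp only: nat_linear_combination zero_le_power2)
    thus "(case (case p of (j, k) \<Rightarrow> (j - k, 2 * k)) of (m, n) \<Rightarrow> q ^ nat (m\<^sup>2 + m * n + n\<^sup>2)) = 
       (case p of (j, k) \<Rightarrow> q ^ nat (j\<^sup>2) * (q ^ 3) ^ nat (k\<^sup>2))"
      by (simp only: p prod.case power_add power_mult)
  qed auto
  finally have ev: "((\<lambda>(m, n). q ^ nat (m\<^sup>2 + m * n + n\<^sup>2)) has_sum theta_phi q * theta_phi (q ^ 3)) {(m, n). even n}" .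
  have "((\<lambda>(j, k). q ^ nat (j\<^sup>2 + j) * (q ^ 3) ^ nat (k\<^sup>2 + k)) has_sum theta_psi q * theta_psi (q ^ 3)) UNIV"
    by (intro has_sum_times theta_psi_series assms q3)
  from has_sum_cmult_right[OF this, of q]
  have "((\<lambda>p. q * (case p of (j, k) \<Rightarrow> q ^ nat (j\<^sup>2 + j) * (q ^ 3) ^ nat (k\<^sup>2 + k))) has_sum q * (theta_psi q * theta_psi (q ^ 3))) UNIV" .
  also have "?this \<longleftrightarrow> ((\<lambda>(m, n). q ^ nat (m\<^sup>2 + m * n + n\<^sup>2)) has_sum q * (theta_psi q * theta_psi (q ^ 3))) {(m, n). odd n}"
  proof (rule has_sum_reindex_bij_witness[where j = "\<lambda>(j, k). (j - k, 2 * k + 1)" and i = "\<lambda>(m, n). (m + n div 2, n div 2)"])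
    fix p :: "int \<times> int"
    obtain j k where p: "p = (j, k)" by force
    have "(j - k)\<^sup>2 + (j - k) * (2 * k + 1) + (2 * k + 1)\<^sup>2 = 1 + ((j\<^sup>2 + j) + 3 * (k\<^sup>2 + k))" by algebra
    hence "nat ((j - k)\<^sup>2 + (j - k) * (2 * k + 1) + (2 * k + 1)\<^sup>2) = 1 + (nat (j\<^sup>2 + j) + 3 * nat (k\<^sup>2 + k))"
      by (simp only: nat_linear_combination nonneg_pronic)
    thus "(case (case p of (j, k) \<Rightarrow> (j - k, 2 * k + 1)) of (m, n) \<Rightarrow> q ^ nat (m\<^sup>2 + m * n + n\<^sup>2)) = 
       q * (case p of (j, k) \<Rightarrow> q ^ nat (j\<^sup>2 + j) * (q ^ 3) ^ nat (k\<^sup>2 + k))"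
      by (simp only: p prod.case power_add power_mult power_one_right)
  qed (auto elim!: oddE)
  finally have od: "((\<lambda>(m, n). q ^ nat (m\<^sup>2 + m * n + n\<^sup>2)) has_sum q * (theta_psi q * theta_psi (q ^ 3))) {(m, n). odd n}" .
  have "{(m::int, n::int). even n} \<inter> {(m, n). odd n} = {}" "{(m::int, n::int). even n} \<union> {(m, n). odd n} = UNIV" by auto
  with has_sum_Un_disjoint[OF ev od] show ?thesis by (simp add: cubic_theta_sum_def)
qed

text \<open>The sum over both signs keeps the terms with j + k even, and \<open>j = 2 m + k\<close>
  turns \<open>j\<^sup>2 + 3 k\<^sup>2\<close> into
  \<open>4 (m\<^sup>2 + m k + k\<^sup>2)\<close>.\<close>

lemma theta_phi_even_part:
  assumes "norm q < 1" "q \<noteq> 0"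
  shows "theta_phi q * theta_phi (q ^ 3) + theta_phi (- q) * theta_phi ((- q) ^ 3) = 2 * cubic_theta_sum (q ^ 4)"
proof -
  have q3: "norm (q ^ 3) < 1" "q ^ 3 \<noteq> 0" "norm ((- q) ^ 3) < 1" "(- q) ^ 3 \<noteq> 0" "norm (- q) < 1" "- q \<noteq> 0"
    using assms by (auto simp: norm_power power_less_one_iff)
  have q4: "norm (q ^ 4) < 1" "q ^ 4 \<noteq> 0" using assms by (auto simp: norm_power power_less_one_iff)
  have p: "((\<lambda>(j, k). q ^ nat (j\<^sup>2) * (q ^ 3) ^ nat (k\<^sup>2)) has_sum theta_phi q * theta_phi (q ^ 3)) UNIV"
    by (intro has_sum_times theta_phi_series assms q3)
  have m: "((\<lambda>(j, k). (- q) ^ nat (j\<^sup>2) * ((- q) ^ 3) ^ nat (k\<^sup>2)) has_sum theta_phi (- q) * theta_phi ((- q) ^ 3)) UNIV"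
    by (intro has_sum_times theta_phi_series assms q3)
  have "((\<lambda>p. (case p of (j, k) \<Rightarrow> q ^ nat (j\<^sup>2) * (q ^ 3) ^ nat (k\<^sup>2)) + (case p of (j, k) \<Rightarrow> (- q) ^ nat (j\<^sup>2) * ((- q) ^ 3) ^ nat (k\<^sup>2)))
     has_sum theta_phi q * theta_phi (q ^ 3) + theta_phi (- q) * theta_phi ((- q) ^ 3)) UNIV"
    by (intro has_sum_add p m)
  also have "?this \<longleftrightarrow> ((\<lambda>(j, k). 2 * (q ^ nat (j\<^sup>2) * (q ^ 3) ^ nat (k\<^sup>2)))
     has_sum theta_phi q * theta_phi (q ^ 3) + theta_phi (- q) * theta_phi ((- q) ^ 3)) {(j, k). even (j + k)}"
  proof (rule has_sum_cong_neutral)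
    have sgn: "(- q) ^ nat (j\<^sup>2) * ((- q) ^ 3) ^ nat (k\<^sup>2) = 
       (if even (j + k) then 1 else - 1) * (q ^ nat (j\<^sup>2) * (q ^ 3) ^ nat (k\<^sup>2))" for j k :: int
    proof -
      have par: "even (nat (i\<^sup>2)) \<longleftrightarrow> even i" for i :: int by (simp add: even_nat_iff)
      show ?thesis by (cases "even j"; cases "even k") (simp_all add: par)
    qed
    show "(case p of (j, k) \<Rightarrow> q ^ nat (j\<^sup>2) * (q ^ 3) ^ nat (k\<^sup>2)) + (case p of (j, k) \<Rightarrow> (- q) ^ nat (j\<^sup>2) * ((- q) ^ 3) ^ nat (k\<^sup>2)) = 0"
      if "p \<in> UNIV - {(j, k). even (j + k)}" for p :: "int \<times> int"
    proof -
      obtain j k where p: "p = (j, k)" by force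
      hence "odd (j + k)" using that by simp
      thus ?thesis by (simp only: p prod.case sgn [of j k] if_False) simp
    qed
    show "(case p of (j, k) \<Rightarrow> q ^ nat (j\<^sup>2) * (q ^ 3) ^ nat (k\<^sup>2)) + (case p of (j, k) \<Rightarrow> (- q) ^ nat (j\<^sup>2) * ((- q) ^ 3) ^ nat (k\<^sup>2)) 
      = (case p of (j, k) \<Rightarrow> 2 * (q ^ nat (j\<^sup>2) * (q ^ 3) ^ nat (k\<^sup>2)))"
      if "p \<in> UNIV \<inter> {(j, k). even (j + k)}" for p :: "int \<times> int"
    proof -
      obtain j k where p: "p = (j, k)" by force
      hence "even (j + k)" using that by simp
      thus ?thesis by (simp only: p prod.case sgn [of j k] if_True) simp
    qed
  qed auto
  also have "\<dots> \<longleftrightarrow> ((\<lambda>p. 2 * (case p of (m, n) \<Rightarrow> (q ^ 4) ^ nat (m\<^sup>2 + m * n + n\<^sup>2)))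
     has_sum theta_phi q * theta_phi (q ^ 3) + theta_phi (- q) * theta_phi ((- q) ^ 3)) UNIV"
  proof (rule has_sum_reindex_bij_witness[where i = "\<lambda>(m, n). (2 * m + n, n)" and j = "\<lambda>(j, k). ((j - k) div 2, k)"])
    fix p :: "int \<times> int" assume "p \<in> {(j, k). even (j + k)}"
    then obtain j k where p: "p = (j, k)" and ev: "even (j - k)" by auto
    from ev obtain m where "j - k = 2 * m" by (rule evenE)
    hence jm: "j = 2 * m + k" by simp
    have "4 * (m\<^sup>2 + m * k + k\<^sup>2) = j\<^sup>2 + 3 * k\<^sup>2" unfolding jm by algebra
    hence "nat (4 * (m\<^sup>2 + m * k + k\<^sup>2)) = nat (j\<^sup>2) + 3 * nat (k\<^sup>2)"
      by (simp only: nat_linear_combination zero_le_power2)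
    moreover have "nat (4 * (m\<^sup>2 + m * k + k\<^sup>2)) = 4 * nat (m\<^sup>2 + m * k + k\<^sup>2)"
      by (subst nat_mult_distrib) auto
    ultimately have "4 * nat (m\<^sup>2 + m * k + k\<^sup>2) = nat (j\<^sup>2) + 3 * nat (k\<^sup>2)" by simp
    thus "2 * (case (case p of (j, k) \<Rightarrow> ((j - k) div 2, k)) of (m, n) \<Rightarrow> (q ^ 4) ^ nat (m\<^sup>2 + m * n + n\<^sup>2)) =
      (case p of (j, k) \<Rightarrow> 2 * (q ^ nat (j\<^sup>2) * (q ^ 3) ^ nat (k\<^sup>2)))"
      by (simp add: p jm flip: power_mult power_add)
  qed auto
  finally have 1: "((\<lambda>p. 2 * (case p of (m, n) \<Rightarrow> (q ^ 4) ^ nat (m\<^sup>2 + m * n + n\<^sup>2)))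
     has_sum theta_phi q * theta_phi (q ^ 3) + theta_phi (- q) * theta_phi ((- q) ^ 3)) UNIV" .
  have "((\<lambda>p. 2 * (case p of (m, n) \<Rightarrow> (q ^ 4) ^ nat (m\<^sup>2 + m * n + n\<^sup>2))) has_sum 2 * cubic_theta_sum (q ^ 4)) UNIV"
    by (intro has_sum_cmult_right has_sum_cubic_theta q4)
  from has_sum_unique[OF 1 this] show ?thesis .
qed

lemma cubic_theta_a_eq:
  assumes "Im \<tau> > 0"
  shows "cubic_theta_a \<tau> = cubic_theta_sum (nome \<tau>)"
proof -
  have "((\<lambda>(m, n). nome \<tau> powi (m\<^sup>2 + m * n + n\<^sup>2)) has_sum cubic_theta_sum (nome \<tau>)) UNIV"
    using has_sum_cubic_theta[OF norm_nome_less_1[OF assms] nome_nonzero]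
    by (simp add: power_int_nonneg_exp nonneg_norm_form)
  from infsumI[OF this] show ?thesis by (simp add: cubic_theta_a_def nome_def)
qed

lemma holomorphic_cubic_theta_sum: "cubic_theta_sum holomorphic_on ball 0 1"
proof -
  have minus: "(\<lambda>q. euler_prod (- q)) holomorphic_on ball 0 1"
  proof -
    have "(\<lambda>q::complex. - q) holomorphic_on ball 0 1" by (intro holomorphic_intros)
    from holomorphic_on_compose_gen[OF this holomorphic_euler_prod] show ?thesis by (auto simp: o_def image_subset_iff)
  qed
  have phi: "theta_phi holomorphic_on ball 0 1" and psi: "theta_psi holomorphic_on ball 0 1"
    unfolding theta_phi_def [abs_def] theta_psi_def [abs_def] using euler_prod_power_nonzero
    by (auto intro!: holomorphic_intros minus holomorphic_euler_prod_power)
  have cube: "(\<lambda>q. F (q ^ 3)) holomorphic_on ball 0 1" if "F holomorphic_on ball 0 1" for F :: "complex \<Rightarrow> complex"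
  proof -
    have "(\<lambda>q::complex. q ^ 3) holomorphic_on ball 0 1" by (intro holomorphic_intros)
    from holomorphic_on_compose_gen[OF this that] show ?thesis
      using power_in_unit_disc[of _ 3] by (auto simp: o_def image_subset_iff)
  qed
  show ?thesis unfolding cubic_theta_sum_def [abs_def]
    by (intro holomorphic_intros phi psi cube[OF phi] cube[OF psi])
qed

lemma cubic_theta_sum_minus:
  assumes "norm q < 1" "q \<noteq> 0"
  shows "cubic_theta_sum (- q) = 2 * cubic_theta_sum (q ^ 4) - cubic_theta_sum q"
proof -
  have "theta_psi (- q) = theta_psi q" "theta_psi ((- q) ^ 3) = theta_psi (q ^ 3)" by (simp_all add: theta_psi_def)
  thus ?thesis using theta_phi_even_part[OF assms] by (simp add: cubic_theta_sum_def algebra_simps)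
qed

lemma cubic_theta_sum_eta_quotient:
  assumes "Im \<sigma> > 0"
  shows "cubic_theta_sum (nome \<sigma>) =
     eta_mult 2 \<sigma> ^ 5 * eta_mult 6 \<sigma> ^ 5 / (eta_mult 1 \<sigma> ^ 2 * eta_mult 4 \<sigma> ^ 2 * eta_mult 3 \<sigma> ^ 2 * eta_mult 12 \<sigma> ^ 2)
     + 4 * (eta_mult 4 \<sigma> ^ 2 * eta_mult 12 \<sigma> ^ 2 / (eta_mult 2 \<sigma> * eta_mult 6 \<sigma>))" (is ?A)
    and "theta_phi (nome \<sigma>) * theta_phi (nome \<sigma> ^ 3) = 
     eta_mult 2 \<sigma> ^ 5 * eta_mult 6 \<sigma> ^ 5 / (eta_mult 1 \<sigma> ^ 2 * eta_mult 4 \<sigma> ^ 2 * eta_mult 3 \<sigma> ^ 2 * eta_mult 12 \<sigma> ^ 2)" (is ?B)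
    and "theta_phi (- nome \<sigma>) * theta_phi ((- nome \<sigma>) ^ 3) = 
      eta_mult 1 \<sigma> ^ 2 * eta_mult 3 \<sigma> ^ 2 / (eta_mult 2 \<sigma> * eta_mult 6 \<sigma>)" (is ?C)
proof -
  define x where "x = exp (2 * of_real pi * \<i> * \<sigma> / 24)"
  have x: "x \<noteq> 0" by (simp add: x_def)
  define p where "p = nome \<sigma>"
  have p: "norm p < 1" "norm (p ^ 3) < 1"
    using norm_nome_less_1[OF assms] by (auto simp: p_def norm_power power_less_one_iff)
  have pw: "(- p) ^ 2 = p ^ 2" "(- p) ^ 3 = - (p ^ 3)" "(- (p ^ 3)) ^ 2 = p ^ 6"
    "(p ^ 3) ^ 2 = p ^ 6" "(p ^ 3) ^ 4 = p ^ 12" by (auto simp flip: power_mult)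
  note E = euler_prod_nome_power[of \<sigma> 1, simplified power_one_right] euler_prod_nome_power[of \<sigma> 2]
    euler_prod_nome_power[of \<sigma> 3] euler_prod_nome_power[of \<sigma> 4] euler_prod_nome_power[of \<sigma> 6] euler_prod_nome_power[of \<sigma> 12]
  note E = E[folded p_def x_def]
  note nz = eta_mult_nonzero[OF assms, of 1] eta_mult_nonzero[OF assms, of 2] eta_mult_nonzero[OF assms, of 3]
    eta_mult_nonzero[OF assms, of 4] eta_mult_nonzero[OF assms, of 6] eta_mult_nonzero[OF assms, of 12]
  note M = euler_prod_minus[OF p(1)] euler_prod_minus[OF p(2), unfolded pw]
  have p24: "p = x ^ 24" using nome_eq_exp_power_24[of \<sigma>] by (simp add: p_def x_def)
  show B: ?B
    unfolding p_def [symmetric] theta_phi_def pw M E using x nz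
    by (simp add: divide_simps power_mult_distrib power_divide flip: power_mult power_add) algebra
  show ?C
    unfolding p_def [symmetric] theta_phi_def pw minus_minus M E using x nz
    by (simp add: divide_simps power_mult_distrib power_divide flip: power_mult power_add)
  have "p * (theta_psi p * theta_psi (p ^ 3)) = 4 * (eta_mult 4 \<sigma> ^ 2 * eta_mult 12 \<sigma> ^ 2 / (eta_mult 2 \<sigma> * eta_mult 6 \<sigma>))"
    unfolding theta_psi_def pw M E unfolding p24 using x nz
    by (simp add: divide_simps power_mult_distrib power_divide flip: power_mult power_add)
  thus ?A using B unfolding cubic_theta_sum_def p_def by simp
qed

section \<open>The cubic theta function under the involutions\<close>

text \<open>Replaces a two-dimensional Poisson summation. With \<open>\<sigma> = \<tau> / 4\<close>,
  the inversion \<open>\<sigma> \<mapsto> -1/(12 \<sigma>)\<close> of the eta quotients turns the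
  phi part into \<open>phi(q) phi(q^3)\<close> and the psi part into the same product at
  \<open>-q\<close>, with equal factors; \<open>theta_phi_even_part\<close> recombines them at the
  nome of \<open>4 \<sigma> = \<tau>\<close>.\<close>

lemma cubic_theta_a_inversion:
  assumes "Im \<tau> > 0"
  shows "cubic_theta_a (- 1 / (3 * \<tau>)) = \<rho> * (- \<i> * \<tau>) * cubic_theta_a \<tau>"
proof -
  define \<sigma> where "\<sigma> = \<tau> / 4"
  have \<sigma>: "Im \<sigma> > 0" "\<tau> = 4 * \<sigma>" using assms by (simp_all add: \<sigma>_def)
  define s where "s = csqrt (- \<i> * \<sigma>)"
  have s: "- \<i> * \<sigma> = s ^ 2" "s \<noteq> 0" using \<sigma> by (auto simp: s_def)
  define t where "t = complex_of_real (sqrt 2)"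
  have t: "t ^ 2 = 2" "t \<noteq> 0" by (simp_all add: t_def flip: of_real_power)
  define r where "r = \<rho>"
  have r: "r ^ 2 = 3" "r \<noteq> 0" using rho_sq by (simp_all add: r_def)
  define \<sigma>' where "\<sigma>' = - 1 / (12 * \<sigma>)"
  have \<sigma>': "Im \<sigma>' > 0" using Im_minus_inverse_pos[of "12 * \<sigma>"] \<sigma> by (simp add: \<sigma>'_def)
  have E: "eta_mult 1 \<sigma>' = 2 * r * s * eta_mult 12 \<sigma>" "eta_mult 2 \<sigma>' = t * r * s * eta_mult 6 \<sigma>"
    "eta_mult 3 \<sigma>' = 2 * s * eta_mult 4 \<sigma>" "eta_mult 4 \<sigma>' = r * s * eta_mult 3 \<sigma>" 
    "eta_mult 6 \<sigma>' = t * s * eta_mult 2 \<sigma>" "eta_mult 12 \<sigma>' = s * eta_mult 1 \<sigma>"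
    using eta_mult_inversion[OF \<sigma>(1), of 1 12 12] eta_mult_inversion[OF \<sigma>(1), of 2 6 12]
      eta_mult_inversion[OF \<sigma>(1), of 3 4 12] eta_mult_inversion[OF \<sigma>(1), of 4 3 12]
      eta_mult_inversion[OF \<sigma>(1), of 6 2 12] eta_mult_inversion[OF \<sigma>(1), of 12 1 12]
    by (simp_all add: \<sigma>'_def s_def t_def r_def of_real_sqrt_numerals)
  define e1 e2 e3 e4 e6 e12 where "e1 = eta_mult 1 \<sigma>" and "e2 = eta_mult 2 \<sigma>" and "e3 = eta_mult 3 \<sigma>"
    and "e4 = eta_mult 4 \<sigma>" and "e6 = eta_mult 6 \<sigma>" and "e12 = eta_mult 12 \<sigma>"
  note e = this
  have nz: "e1 \<noteq> 0" "e2 \<noteq> 0" "e3 \<noteq> 0" "e4 \<noteq> 0" "e6 \<noteq> 0" "e12 \<noteq> 0" 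
    using \<sigma> unfolding e by (intro eta_mult_nonzero; simp)+
  have pw: "r ^ 5 = 9 * r" "r ^ 3 = 3 * r" "t ^ 5 = 4 * t" "t ^ 10 = 32" "t ^ 3 = 2 * t"
    using r t power_mult[of t 2 5] by (simp_all add: powers_via_square)
  note Q' = cubic_theta_sum_eta_quotient(1)[OF \<sigma>', unfolded E, folded e]
  note Q = cubic_theta_sum_eta_quotient(2,3)[OF \<sigma>(1), folded e]
  have "(t * r * s * e6) ^ 5 * (t * s * e2) ^ 5 / ((2 * r * s * e12) ^ 2 * (r * s * e3) ^ 2 * (2 * s * e4) ^ 2 * (s * e1) ^ 2)
     = 2 * r * s ^ 2 * (e2 ^ 5 * e6 ^ 5 / (e1 ^ 2 * e4 ^ 2 * e3 ^ 2 * e12 ^ 2))"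
    using nz s(2) r t pw by (simp add: divide_simps power_mult_distrib) algebra
  moreover have "4 * ((r * s * e3) ^ 2 * (s * e1) ^ 2 / (t * r * s * e6 * (t * s * e2))) = 
     2 * r * s ^ 2 * (e1 ^ 2 * e3 ^ 2 / (e2 * e6))"
    using nz s(2) r t pw by (simp add: divide_simps power_mult_distrib) algebra
  ultimately have "cubic_theta_sum (nome \<sigma>') = 2 * r * s ^ 2 * 
      (theta_phi (nome \<sigma>) * theta_phi (nome \<sigma> ^ 3) + theta_phi (- nome \<sigma>) * theta_phi ((- nome \<sigma>) ^ 3))"
    unfolding Q' Q by (simp only: distrib_left)
  also have "\<dots> = 2 * r * s ^ 2 * (2 * cubic_theta_sum (nome \<tau>))"
    using theta_phi_even_part[OF norm_nome_less_1[OF \<sigma>(1)] nome_nonzero] by (simp add: \<sigma>(2) nome_numeral_mult)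
  finally have "cubic_theta_sum (nome \<sigma>') = r * (4 * s ^ 2) * cubic_theta_sum (nome \<tau>)" by simp
  moreover have "\<sigma>' = - 1 / (3 * \<tau>)" by (simp add: \<sigma>'_def \<sigma>(2))
  moreover have "4 * s ^ 2 = - \<i> * \<tau>" by (simp add: \<sigma>(2) s(1) [symmetric])
  ultimately show ?thesis using cubic_theta_a_eq[OF assms] cubic_theta_a_eq[OF \<sigma>'] by (simp add: r_def)
qed

lemma cubic_theta_a_plus_half:
  assumes "Im \<sigma> > 0"
  shows "cubic_theta_a (\<sigma> + 1 / 2) = 2 * cubic_theta_a (4 * \<sigma>) - cubic_theta_a \<sigma>"
proof -
  have "nome (\<sigma> + 1 / 2) = - nome \<sigma>" by (simp add: nome_def distrib_left exp_add)
  thus ?thesis using cubic_theta_sum_minus[OF norm_nome_less_1[OF assms] nome_nonzero] assms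
    by (simp add: cubic_theta_a_eq nome_numeral_mult)
qed

lemma cubic_theta_a_plus_1:
  assumes "Im \<sigma> > 0"
  shows "cubic_theta_a (\<sigma> + 1) = cubic_theta_a \<sigma>"
  using nome_plus_of_int[of \<sigma> 1] assms by (simp add: cubic_theta_a_eq)

lemma cubic_theta_W6:
  assumes "Im \<tau> > 0"
  shows "cubic_theta_a (2 * W6 \<tau>) = \<rho> * (- \<i> * \<tau>) * cubic_theta_a \<tau>"
    and "cubic_theta_a (W6 \<tau>) = 2 * \<rho> * (- \<i> * \<tau>) * cubic_theta_a (2 * \<tau>)"
proof -
  have "2 * W6 \<tau> = - 1 / (3 * \<tau>)" "W6 \<tau> = - 1 / (3 * (2 * \<tau>))" by (simp_all add: W6_def)
  thus "cubic_theta_a (2 * W6 \<tau>) = \<rho> * (- \<i> * \<tau>) * cubic_theta_a \<tau>"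
    "cubic_theta_a (W6 \<tau>) = 2 * \<rho> * (- \<i> * \<tau>) * cubic_theta_a (2 * \<tau>)"
    using cubic_theta_a_inversion[of \<tau>] cubic_theta_a_inversion[of "2 * \<tau>"] assms by simp_all
qed

text \<open>With \<open>s = \<tau> - 1 / 2\<close>, the point \<open>2 W3 \<tau>\<close> is an
  inversion of \<open>2 s\<close> up to a translation by 1. For \<open>W3 \<tau>\<close> the
  half-shift formula is used before and after the inversion, which exchanges the arguments
  \<open>s\<close> and \<open>4 s\<close>; this causes the factor -2.\<close>

lemma cubic_theta_W3:
  assumes t: "Im \<tau> > 0"
  shows "cubic_theta_a (2 * W3 \<tau>) = 2 * \<rho> * (- \<i> * (\<tau> - 1 / 2)) * cubic_theta_a (2 * \<tau>)"
    and "cubic_theta_a (W3 \<tau>) = - (2 * \<rho>) * (- \<i> * (\<tau> - 1 / 2)) * cubic_theta_a \<tau>"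
proof -
  define s where "s = \<tau> - 1 / 2"
  have s: "Im s > 0" "\<tau> = s + 1 / 2" using t by (simp_all add: s_def)
  have pos: "Im (- 1 / (k * s)) > 0" if "k \<in> {3, 6, 12}" for k
    using Im_minus_inverse_pos[of "k * s"] that s by auto
  have W: "2 * W3 \<tau> = - 1 / (6 * s) + 1" "W3 \<tau> = - 1 / (12 * s) + 1 / 2" "4 * (- 1 / (12 * s)) = - 1 / (3 * s)"
    by (simp_all add: W3_def s(2))
  have "cubic_theta_a (2 * W3 \<tau>) = cubic_theta_a (- 1 / (6 * s))"
    unfolding W using cubic_theta_a_plus_1[OF pos[of 6]] by simp
  also have "\<dots> = 2 * \<rho> * (- \<i> * s) * cubic_theta_a (2 * s)"
    using cubic_theta_a_inversion[of "2 * s"] s by simp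
  also have "cubic_theta_a (2 * s) = cubic_theta_a (2 * \<tau>)"
    using cubic_theta_a_plus_1[of "2 * s"] s by (simp add: distrib_left)
  finally show "cubic_theta_a (2 * W3 \<tau>) = 2 * \<rho> * (- \<i> * (\<tau> - 1 / 2)) * cubic_theta_a (2 * \<tau>)"
    by (simp add: s_def)
  have "cubic_theta_a (W3 \<tau>) = 2 * cubic_theta_a (- 1 / (3 * s)) - cubic_theta_a (- 1 / (12 * s))"
    unfolding W(2) using cubic_theta_a_plus_half[OF pos[of 12]] unfolding W(3) by simp
  also have "\<dots> = 2 * (\<rho> * (- \<i> * s) * cubic_theta_a s) - \<rho> * (- \<i> * (4 * s)) * cubic_theta_a (4 * s)"
    using cubic_theta_a_inversion[of s] cubic_theta_a_inversion[of "4 * s"] s by simp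
  also have "\<dots> = - (2 * \<rho>) * (- \<i> * s) * (2 * cubic_theta_a (4 * s) - cubic_theta_a s)"
    by (simp add: algebra_simps)
  also have "2 * cubic_theta_a (4 * s) - cubic_theta_a s = cubic_theta_a \<tau>"
    using cubic_theta_a_plus_half[of s] s by simp
  finally show "cubic_theta_a (W3 \<tau>) = - (2 * \<rho>) * (- \<i> * (\<tau> - 1 / 2)) * cubic_theta_a \<tau>"
    by (simp add: s_def)
qed

text \<open>The involutions link \<open>a(2\<tau>)\<close> with \<open>a(\<tau>)\<close>, so the
  orbit consists of two forms of this relation and two of \<open>a(\<tau>) = D + 3 C\<close>. The
  values at the cusp, \<open>4 - 3 - 1 = 0\<close>, fix the constant.\<close>

lemma cubic_theta_a_relation:
  assumes tau: "Im \<tau> > 0"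
  shows "4 * cubic_theta_a (2 * \<tau>) = 3 * form_A \<tau> + form_B \<tau>"
proof -
  define N where "N = (\<lambda>q. 4 * cubic_theta_sum (q ^ 2) - 3 * A_hat q - B_hat q)"
  have h2: "(\<lambda>q. cubic_theta_sum (q ^ 2)) holomorphic_on ball 0 1"
  proof -
    have "(\<lambda>q::complex. q ^ 2) holomorphic_on ball 0 1" by (intro holomorphic_intros)
    from holomorphic_on_compose_gen[OF this holomorphic_cubic_theta_sum] show ?thesis
      using power_in_unit_disc[of _ 2] by (auto simp: o_def image_subset_iff)
  qed
  have c0: "cubic_theta_sum 0 = 1" by (simp add: cubic_theta_sum_def theta_phi_def theta_psi_def)
  have "N holomorphic_on ball 0 1" unfolding N_def by (intro holomorphic_intros holomorphic_hats h2)
  moreover have "N 0 = 0" by (simp add: N_def c0)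
  ultimately obtain G where G: "G holomorphic_on ball 0 1" "\<And>q. N q = q * G q"
    using removable_zero by blast
  define F0 F1 F2 F3 where "F0 = (\<lambda>q. G q / C_hat q)"
    and "F1 = (\<lambda>q. 24 * (cubic_theta_sum q - D_hat q - 3 * (q * C_hat q)) / B_hat q)"
    and "F2 = (\<lambda>q. - 3 * (4 * cubic_theta_sum (q ^ 2) - B_hat q - 3 * A_hat q) / D_hat q)"
    and "F3 = (\<lambda>q. - 8 * (cubic_theta_sum q - D_hat q - 3 * (q * C_hat q)) / A_hat q)"
  have F: "F0 (nome \<tau>) = (4 * cubic_theta_a (2 * \<tau>) - 3 * form_A \<tau> - form_B \<tau>) / form_C \<tau>"
    "F1 (nome \<tau>) = 24 * (cubic_theta_a \<tau> - form_D \<tau> - 3 * form_C \<tau>) / form_B \<tau>"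
    "F2 (nome \<tau>) = - 3 * (4 * cubic_theta_a (2 * \<tau>) - form_B \<tau> - 3 * form_A \<tau>) / form_D \<tau>"
    "F3 (nome \<tau>) = - 8 * (cubic_theta_a \<tau> - form_D \<tau> - 3 * form_C \<tau>) / form_A \<tau>" if t: "Im \<tau> > 0" for \<tau>
  proof -
    have a: "cubic_theta_a (2 * \<tau>) = cubic_theta_sum (nome \<tau> ^ 2)" "cubic_theta_a \<tau> = cubic_theta_sum (nome \<tau>)"
      using t by (simp_all add: cubic_theta_a_eq nome_numeral_mult)
    have "F0 (nome \<tau>) = N (nome \<tau>) / form_C \<tau>"
      using G(2)[of "nome \<tau>"] by (simp add: F0_def form_C_def)
    thus "F0 (nome \<tau>) = (4 * cubic_theta_a (2 * \<tau>) - 3 * form_A \<tau> - form_B \<tau>) / form_C \<tau>"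
      by (simp only: N_def a form_A_def form_B_def)
    show "F1 (nome \<tau>) = 24 * (cubic_theta_a \<tau> - form_D \<tau> - 3 * form_C \<tau>) / form_B \<tau>"
      "F2 (nome \<tau>) = - 3 * (4 * cubic_theta_a (2 * \<tau>) - form_B \<tau> - 3 * form_A \<tau>) / form_D \<tau>"
      "F3 (nome \<tau>) = - 8 * (cubic_theta_a \<tau> - form_D \<tau> - 3 * form_C \<tau>) / form_A \<tau>"
      by (simp_all only: F1_def F2_def F3_def a form_A_def form_B_def form_C_def form_D_def)
  qed
  have const: "F q = H q'" if "F \<in> {F0, F1, F2, F3}" "H \<in> {F0, F1, F2, F3}" "q \<in> ball 0 1" "q' \<in> ball 0 1" for F H q q'
  proof (rule atkin_lehner_orbit_constant[OF _ _ _ _ _ _ _ _ that])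
    show "F0 holomorphic_on ball 0 1" "F1 holomorphic_on ball 0 1" "F2 holomorphic_on ball 0 1" "F3 holomorphic_on ball 0 1"
      unfolding F0_def F1_def F2_def F3_def using hats_nonzero 
      by (auto intro!: holomorphic_intros holomorphic_hats h2 holomorphic_cubic_theta_sum G(1))
    fix \<tau> :: complex assume t: "Im \<tau> > 0"
    have nz: "\<tau> \<noteq> 0" "\<tau> - 1 / 2 \<noteq> 0" using t by (auto simp: complex_eq_iff)
    define s where "s = \<tau> - 1 / 2"
    define r where "r = \<rho>"
    have r: "r ^ 2 = 3" "r \<noteq> 0" using rho_sq by (simp_all add: r_def)
    define u where "u = - \<i> * \<tau>"
    define v where "v = - \<i> * s"
    have uv: "u \<noteq> 0" "v \<noteq> 0" using nz by (auto simp: u_def v_def s_def)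
    note nz = forms_nonzero[OF t]
    note W6 = forms_W6[OF t, folded r_def u_def] cubic_theta_W6[OF t, folded r_def u_def]
      and W3 = forms_W3[OF t, folded r_def s_def, folded v_def] cubic_theta_W3[OF t, folded r_def s_def, folded v_def]
    note F6 = F[OF Im_W6_pos[OF t]] and F3 = F[OF Im_W3_pos[OF t]] and F = F[OF t]
    show "F0 (nome (W6 \<tau>)) = F1 (nome \<tau>)"
      unfolding F F6 W6 using nz r uv by (simp add: divide_simps) algebra
    show "F2 (nome (W6 \<tau>)) = F3 (nome \<tau>)"
      unfolding F F6 W6 using nz r uv by (simp add: divide_simps) algebra
    show "F0 (nome (W3 \<tau>)) = F2 (nome \<tau>)"
      unfolding F F3 W3 using nz r uv by (simp add: divide_simps) algebra
    show "F1 (nome (W3 \<tau>)) = F3 (nome \<tau>)"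
      unfolding F F3 W3 using nz r uv by (simp add: divide_simps) algebra
  qed
  have "F2 0 = 0" by (simp add: F2_def c0)
  hence "F2 (nome \<tau>) = 0"
    using const[of F2 F2 "nome \<tau>" 0] norm_nome_less_1[OF tau] by auto
  hence "4 * cubic_theta_a (2 * \<tau>) - form_B \<tau> - 3 * form_A \<tau> = 0"
    using forms_nonzero[OF tau] by (simp only: F[OF tau] divide_eq_0_iff mult_eq_0_iff) simp
  thus ?thesis by algebra
qed

section \<open>The differential equation\<close>

lemma form_deriv:
  assumes "X holomorphic_on upper_half_plane" "Im \<tau> > 0" "X \<tau> \<noteq> 0"
  shows "(X has_field_derivative X \<tau> * dlog X \<tau>) (at \<tau>)"
proof -
  have "(X has_field_derivative deriv X \<tau>) (at \<tau>)"
    using assms by (intro holomorphic_derivI[OF assms(1) open_upper_half_plane]) auto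
  thus ?thesis using assms(3) by (simp add: dlog_def)
qed

lemma forms_deriv:
  assumes "Im \<tau> > 0"
  shows "(form_A has_field_derivative form_A \<tau> * dlog form_A \<tau>) (at \<tau>)"
    "(form_B has_field_derivative form_B \<tau> * dlog form_B \<tau>) (at \<tau>)"
    "(form_C has_field_derivative form_C \<tau> * dlog form_C \<tau>) (at \<tau>)"
    "(form_D has_field_derivative form_D \<tau> * dlog form_D \<tau>) (at \<tau>)"
  using form_deriv[OF holomorphic_forms(1) assms] form_deriv[OF holomorphic_forms(2) assms]
    form_deriv[OF holomorphic_forms(3) assms] form_deriv[OF holomorphic_forms(4) assms] forms_nonzero[OF assms] by auto

text \<open>Differentiating \<open>A = B + 8 C\<close> and \<open>D = A + C\<close> and inserting
  the first difference determines the other two.\<close>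

lemma dlog_differences:
  assumes t: "Im \<tau> > 0"
  shows "dlog form_A \<tau> = dlog form_B \<tau> + 8 * \<kappa> * form_C \<tau> * form_D \<tau>"
    and "dlog form_C \<tau> = dlog form_B \<tau> + \<kappa> * form_A \<tau> * form_D \<tau>"
    and "dlog form_D \<tau> = dlog form_B \<tau> + 9 * \<kappa> * form_A \<tau> * form_C \<tau>"
proof -
  define k where "k = \<kappa>"
  show A: "dlog form_A \<tau> = dlog form_B \<tau> + 8 * \<kappa> * form_C \<tau> * form_D \<tau>"
    using dlog_A_minus_dlog_B[OF t] by algebra
  note A' = A[folded k_def]
  note nz = forms_nonzero[OF t] and rel = forms_relations[OF t]
  have "((\<lambda>t. form_B t + 8 * form_C t) has_field_derivative form_B \<tau> * dlog form_B \<tau> + 8 * (form_C \<tau> * dlog form_C \<tau>)) (at \<tau>)"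
    by (intro DERIV_add DERIV_cmult forms_deriv t)
  hence "(form_A has_field_derivative form_B \<tau> * dlog form_B \<tau> + 8 * (form_C \<tau> * dlog form_C \<tau>)) (at \<tau>)"
    by (rule has_field_derivative_transform_within_open[OF _ open_upper_half_plane]) (use t forms_relations in auto)
  from DERIV_unique[OF forms_deriv(1)[OF t] this]
  have "form_C \<tau> * dlog form_C \<tau> = form_C \<tau> * (dlog form_B \<tau> + k * form_A \<tau> * form_D \<tau>)"
    using A' rel by algebra
  hence C': "dlog form_C \<tau> = dlog form_B \<tau> + k * form_A \<tau> * form_D \<tau>" using nz(3) by (simp only: mult_cancel_left) simp
  thus "dlog form_C \<tau> = dlog form_B \<tau> + \<kappa> * form_A \<tau> * form_D \<tau>" by (simp only: k_def)
  have "((\<lambda>t. form_A t + form_C t) has_field_derivative form_A \<tau> * dlog form_A \<tau> + form_C \<tau> * dlog form_C \<tau>) (at \<tau>)"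
    by (intro DERIV_add forms_deriv t)
  hence "(form_D has_field_derivative form_A \<tau> * dlog form_A \<tau> + form_C \<tau> * dlog form_C \<tau>) (at \<tau>)"
    by (rule has_field_derivative_transform_within_open[OF _ open_upper_half_plane]) (use t forms_relations in auto)
  from DERIV_unique[OF forms_deriv(4)[OF t] this]
  have "form_D \<tau> * dlog form_D \<tau> = form_D \<tau> * (dlog form_B \<tau> + 9 * k * form_A \<tau> * form_C \<tau>)"
    using A' C' rel by algebra
  hence "dlog form_D \<tau> = dlog form_B \<tau> + 9 * k * form_A \<tau> * form_C \<tau>" using nz(4) by (simp only: mult_cancel_left) simp
  thus "dlog form_D \<tau> = dlog form_B \<tau> + 9 * \<kappa> * form_A \<tau> * form_C \<tau>" by (simp only: k_def)
qed

text \<open>A Riccati-type equation, from which the linear equation of second order arises. All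
  logarithmic derivatives differ from that of B by quadratic forms, so \<open>form_Q_eq\<close> can
  be solved for this one.\<close>

lemma dlog_B_deriv:
  assumes t: "Im \<tau> > 0"
  shows "(dlog form_B has_field_derivative dlog form_B \<tau> ^ 2 
     - 3 * \<kappa> ^ 2 * form_A \<tau> * form_C \<tau> * form_D \<tau> * (3 * form_A \<tau> - form_B \<tau>)) (at \<tau>)"
proof -
  define k where "k = \<kappa>"
  \<comment> \<open>The sum of the three differences from \<open>dlog form_B\<close>, divided by
    \<open>\<kappa>\<close>: thus \<open>dlog_E = 4 dlog form_B + \<kappa> S\<close>.\<close>
  define S where "S = (\<lambda>t. 8 * (form_C t * form_D t) + form_A t * form_D t + 9 * (form_A t * form_C t))"
  note dd = dlog_differences[folded k_def]
  have U: "dlog form_B t = (dlog_E t - k * S t) / 4" if "Im t > 0" for t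
    using dd[OF that] by (simp add: dlog_E_def S_def algebra_simps)
  define S' where "S' = 8 * (form_C \<tau> * (form_D \<tau> * dlog form_D \<tau>) + form_C \<tau> * dlog form_C \<tau> * form_D \<tau>)
     + (form_A \<tau> * (form_D \<tau> * dlog form_D \<tau>) + form_A \<tau> * dlog form_A \<tau> * form_D \<tau>)
     + 9 * (form_A \<tau> * (form_C \<tau> * dlog form_C \<tau>) + form_A \<tau> * dlog form_A \<tau> * form_C \<tau>)"
  have "(S has_field_derivative S') (at \<tau>)"
    unfolding S_def S'_def by (intro DERIV_add DERIV_cmult DERIV_mult' forms_deriv t)
  hence "((\<lambda>t. (dlog_E t - k * S t) / 4) has_field_derivative (deriv dlog_E \<tau> - k * S') / 4) (at \<tau>)"
    by (intro DERIV_cdivide DERIV_diff DERIV_cmult dlog_E_deriv' t)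
  hence *: "(dlog form_B has_field_derivative (deriv dlog_E \<tau> - k * S') / 4) (at \<tau>)"
    by (rule has_field_derivative_transform_within_open[OF _ open_upper_half_plane]) (use t U in auto)
  have Q: "deriv dlog_E \<tau> = dlog_E \<tau> ^ 2 / 4 + k ^ 2 * (3 / 2 * (form_A \<tau> * form_B \<tau> * form_C \<tau> * form_D \<tau>) 
      - (form_A \<tau> ^ 2 * form_D \<tau> ^ 2 + form_B \<tau> ^ 2 * form_C \<tau> ^ 2) / 4)"
    using form_Q_eq[OF t] unfolding form_Q_def form_E_def k_def by (simp add: algebra_simps)
  define a b c d u where "a = form_A \<tau>" and "b = form_B \<tau>" and "c = form_C \<tau>" and "d = form_D \<tau>" and "u = dlog form_B \<tau>"
  note defs = this
  have E: "dlog_E \<tau> = 4 * u + k * (8 * c * d + a * d + 9 * a * c)"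
    using U[OF t] by (simp add: S_def defs field_simps)
  have rel: "a = b + 8 * c" "d = b + 9 * c" using forms_relations[OF t] by (simp_all add: defs)
  have "(deriv dlog_E \<tau> - k * S') / 4 = u ^ 2 - 3 * k ^ 2 * a * c * d * (3 * a - b)"
    unfolding Q S'_def E dd[OF t] unfolding defs[symmetric] unfolding rel
    by (simp add: field_simps power2_eq_square)
  with * show ?thesis by (simp only: defs k_def)
qed

theorem theorem8p8:
  fixes f T m :: "complex \<Rightarrow> complex" and W :: "complex set"
  assumes f: "\<And>\<tau>. \<tau> \<in> upper_half_plane \<Longrightarrow>
      f \<tau> = (dedekind_eta (2 * \<tau>) ^ 4 * dedekind_eta (3 * \<tau>) ^ 8) /
            (dedekind_eta \<tau> ^ 8 * dedekind_eta (6 * \<tau>) ^ 4)"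
    and T: "local_holomorphic_inverse f W T"
    and m: "\<And>w. w \<in> W \<Longrightarrow> m w = cubic_theta_a (2 * T w)"
  shows "m holomorphic_on W \<and>
    (\<forall>w \<in> W - {0, 1, - 1/3, 1/9}.
       deriv (deriv m) w
       + (1 / w + 1 / (w - 1) - 2 / (w + 1/3) + 1 / (w - 1/9)) * deriv m w
       - 2 / (3 * w * (w + 1/3)\<^sup>2) * m w = 0)"
proof -
  define k where "k = \<kappa>"
  have k: "k \<noteq> 0" by (simp add: k_def)
  have W: "open W" "T holomorphic_on W" "\<And>w. w \<in> W \<Longrightarrow> Im (T w) > 0" "\<And>w. w \<in> W \<Longrightarrow> f (T w) = w"
    using T unfolding local_holomorphic_inverse_def by auto
  have f_eq: "form_A \<tau> = f \<tau> * form_B \<tau>" if "Im \<tau> > 0" for \<tau>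
  proof -
    have nz: "dedekind_eta \<tau> \<noteq> 0" "dedekind_eta (2 * \<tau>) \<noteq> 0" "dedekind_eta (3 * \<tau>) \<noteq> 0" "dedekind_eta (6 * \<tau>) \<noteq> 0"
      using that by (auto intro!: dedekind_eta_nonzero)
    have "f \<tau> = (dedekind_eta (2 * \<tau>) ^ 4 * dedekind_eta (3 * \<tau>) ^ 8) / (dedekind_eta \<tau> ^ 8 * dedekind_eta (6 * \<tau>) ^ 4)"
      using f that by simp
    thus ?thesis unfolding forms_eta_quotient[OF that] using nz
      by (simp add: divide_simps) algebra
  qed
  define b where "b = (\<lambda>w. form_B (T w))"
  define u where "u = (\<lambda>w. dlog form_B (T w))"
  have bT: "form_B (T w) = b w" for w by (simp add: b_def)
  \<comment> \<open>\<open>A C D = R b^3 / 64\<close> along \<open>T\<close>; the roots of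
    \<open>R\<close> are the values of \<open>f\<close> at the cusps where A, C, D vanish.\<close>
  define R where "R = (\<lambda>w. w * (w - 1) * (9 * w - 1) :: complex)"
  have forms: "form_A (T w) = w * b w" "form_C (T w) = (w - 1) * b w / 8" "form_D (T w) = (9 * w - 1) * b w / 8" 
    if "w \<in> W" for w
  proof -
    show 1: "form_A (T w) = w * b w" using f_eq[OF W(3)[OF that]] W(4)[OF that] by (simp add: b_def)
    with forms_relations[OF W(3)[OF that]] show 2: "form_C (T w) = (w - 1) * b w / 8"
      by (simp add: b_def field_simps)
    from 1 2 forms_relations[OF W(3)[OF that]] show "form_D (T w) = (9 * w - 1) * b w / 8"
      by (simp add: field_simps)
  qed
  have b_nz: "b w \<noteq> 0" if "w \<in> W" for w using forms_nonzero[OF W(3)[OF that]] by (simp add: b_def)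
  have dT: "(T has_field_derivative deriv T w) (at w)" if "w \<in> W" for w
    using that W by (intro holomorphic_derivI[OF W(2,1)])
  \<comment> \<open>Differentiating \<open>f (T w) = w\<close>, with \<open>f = A / B\<close>, gives
    \<open>k R b\<^sup>2 / 8\<close> times the derivative of \<open>T\<close> equal to 1; hence
    \<open>f\<close> never takes the values 0, 1, 1/9.\<close>
  have T': "R w \<noteq> 0 \<and> deriv T w = 8 / (k * R w * b w ^ 2)" if w: "w \<in> W" for w
  proof -
    have "((\<lambda>w. form_A (T w) / form_B (T w)) has_field_derivative 
        (form_A (T w) * dlog form_A (T w) * deriv T w * form_B (T w) - form_A (T w) * (form_B (T w) * dlog form_B (T w) * deriv T w)) / 
         (form_B (T w) * form_B (T w))) (at w)"
      using b_nz[OF w] unfolding b_def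
      by (intro DERIV_divide DERIV_chain2[where f = form_A and g = T, OF forms_deriv(1)[OF W(3)[OF w]]] DERIV_chain2[where f = form_B and g = T, OF forms_deriv(2)[OF W(3)[OF w]]] dT w)
    also have "(form_A (T w) * dlog form_A (T w) * deriv T w * form_B (T w) - form_A (T w) * (form_B (T w) * dlog form_B (T w) * deriv T w)) / 
         (form_B (T w) * form_B (T w)) = k * R w * b w ^ 2 / 8 * deriv T w"
      unfolding dlog_differences[OF W(3)[OF w]] forms[OF w] bT k_def [symmetric] R_def
      using b_nz[OF w] by (simp add: field_simps power2_eq_square)
    finally have "((\<lambda>w. form_A (T w) / form_B (T w)) has_field_derivative k * R w * b w ^ 2 / 8 * deriv T w) (at w)" .
    hence "((\<lambda>w. w) has_field_derivative k * R w * b w ^ 2 / 8 * deriv T w) (at w)"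
      by (rule has_field_derivative_transform_within_open[OF _ W(1) w]) (use forms b_nz in \<open>auto simp: b_def\<close>)
    from DERIV_unique[OF this DERIV_ident] have eq: "k * R w * b w ^ 2 / 8 * deriv T w = 1" .
    hence "R w \<noteq> 0" by auto
    moreover from this have "deriv T w = 8 / (k * R w * b w ^ 2)"
      using eq k b_nz[OF w] by (simp add: divide_simps mult_ac)
    ultimately show ?thesis by simp
  qed
  have db: "(b has_field_derivative 8 * u w / (k * R w * b w)) (at w)" if w: "w \<in> W" for w
  proof -
    have "(b has_field_derivative b w * u w * deriv T w) (at w)"
      unfolding b_def u_def by (intro DERIV_chain2[where f = form_B and g = T, OF forms_deriv(2)[OF W(3)[OF w]]] dT w)
    also have "b w * u w * deriv T w = 8 * u w / (k * R w * b w)"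
      using T'[OF w] b_nz[OF w] by (simp add: power2_eq_square mult_ac)
    finally show ?thesis .
  qed
  have du: "(u has_field_derivative (u w ^ 2 - 3 / 64 * k ^ 2 * R w * (3 * w - 1) * b w ^ 4) * (8 / (k * R w * b w ^ 2))) (at w)" 
    if w: "w \<in> W" for w
  proof -
    have "(u has_field_derivative (u w ^ 2 - 3 * k ^ 2 * form_A (T w) * form_C (T w) * form_D (T w) * 
       (3 * form_A (T w) - form_B (T w))) * deriv T w) (at w)"
      unfolding u_def k_def by (intro DERIV_chain2[where f = "dlog form_B" and g = T, OF dlog_B_deriv[OF W(3)[OF w]]] dT w)
    moreover have "3 * k ^ 2 * form_A (T w) * form_C (T w) * form_D (T w) * (3 * form_A (T w) - form_B (T w)) = 
      3 / 64 * k ^ 2 * R w * (3 * w - 1) * b w ^ 4"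
      unfolding forms[OF w] bT R_def by (simp add: field_simps power2_eq_square power4_eq_xxxx)
    ultimately show ?thesis using T'[OF w] by simp
  qed
  have m_eq: "m w = (3 * w + 1) / 4 * b w" if w: "w \<in> W" for w
    using cubic_theta_a_relation[OF W(3)[OF w]] m[OF w] forms(1)[OF w] by (simp add: b_def field_simps)
  \<comment> \<open>The derivative of \<open>b\<close>, by \<open>db\<close>.\<close>
  define g where "g = (\<lambda>w. 8 * u w / (k * R w * b w))"
  define m1 where "m1 = (\<lambda>w. 3 / 4 * b w + (3 * w + 1) / 4 * g w)"
  have dm: "(m has_field_derivative m1 w) (at w)" if w: "w \<in> W" for w
  proof -
    have "((\<lambda>w. (3 * w + 1) / 4 * b w) has_field_derivative (3 * w + 1) / 4 * g w + 3 / 4 * b w) (at w)"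
      unfolding g_def by (rule derivative_eq_intros db w refl | simp)+
    hence "(m has_field_derivative (3 * w + 1) / 4 * g w + 3 / 4 * b w) (at w)"
      by (rule has_field_derivative_transform_within_open[OF _ W(1) w]) (use m_eq in auto)
    thus ?thesis by (simp add: m1_def add_ac)
  qed
  have holo: "m holomorphic_on W"
    using dm W(1) by (auto simp: holomorphic_on_open)
  have ode: "deriv (deriv m) w
       + (1 / w + 1 / (w - 1) - 2 / (w + 1/3) + 1 / (w - 1/9)) * deriv m w
       - 2 / (3 * w * (w + 1/3)\<^sup>2) * m w = 0" if w: "w \<in> W" "w \<notin> {0, 1, - 1/3, 1/9}" for w
  proof -
    define R' where "R' = (w - 1) * (9 * w - 1) + w * (9 * w - 1) + 9 * w * (w - 1)"
    have dR: "(R has_field_derivative R') (at w)"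
      unfolding R_def R'_def by (auto intro!: derivative_eq_intros simp: algebra_simps)
    define u' where "u' = (u w ^ 2 - 3 / 64 * k ^ 2 * R w * (3 * w - 1) * b w ^ 4) * (8 / (k * R w * b w ^ 2))"
    have nz: "R w \<noteq> 0" "b w \<noteq> 0" using T' b_nz w by auto
    have dg: "(g has_field_derivative (8 * u' * (k * R w * b w) - 8 * u w * (k * R w * g w + k * R' * b w)) / 
         ((k * R w * b w) * (k * R w * b w))) (at w)"
      unfolding g_def
      by (intro DERIV_divide DERIV_mult' DERIV_cmult dR db[OF w(1)] du[OF w(1), folded u'_def]) (use nz k in auto)
    \<comment> \<open>The \<open>u\<^sup>2\<close> of the Riccati equation cancels against the one
      from differentiating \<open>1 / b\<close>, so the second derivative of \<open>b\<close> is
      linear in \<open>b\<close> and \<open>g\<close>.\<close>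
    define g' where "g' = 64 * (- 3 / 64 * R w * (3 * w - 1) * b w) / R w ^ 2 - R' / R w * g w"
    have "(8 * u' * (k * R w * b w) - 8 * u w * (k * R w * g w + k * R' * b w)) / 
         ((k * R w * b w) * (k * R w * b w)) = g'"
      unfolding u'_def g'_def g_def using nz k by (simp add: field_simps) algebra
    with dg have dg': "(g has_field_derivative g') (at w)" by simp
    have "(m1 has_field_derivative 3 / 4 * g w + ((3 * w + 1) / 4 * g' + 3 / 4 * g w)) (at w)"
      unfolding m1_def
      by (rule derivative_eq_intros dg' db[OF w(1), folded g_def] refl | simp add: g_def)+
    moreover have "deriv m w' = m1 w'" if "w' \<in> W" for w' using dm[OF that] by (rule DERIV_imp_deriv)
    ultimately have "(deriv m has_field_derivative 3 / 4 * g w + ((3 * w + 1) / 4 * g' + 3 / 4 * g w)) (at w)"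
      by (elim has_field_derivative_transform_within_open[OF _ W(1) w(1)]) auto
    hence d2: "deriv (deriv m) w = 3 / 2 * g w + (3 * w + 1) / 4 * g'"
      by (simp add: DERIV_imp_deriv)
    have d1: "deriv m w = 3 / 4 * b w + (3 * w + 1) / 4 * g w"
      using DERIV_imp_deriv[OF dm[OF w(1)]] by (simp add: m1_def)
    define G B where "G = g w" and "B = b w"
    have w1: "w \<noteq> 0" "w - 1 \<noteq> 0" "9 * w - 1 \<noteq> 0" using nz(1) by (auto simp: R_def)
    \<comment> \<open>This is the differential equation of \<open>b\<close>. Substituting
      \<open>b = 4 m / (3 w + 1)\<close> in it creates the terms at -1/3.\<close>
    have g'2: "g' = - 3 * (3 * w - 1) / (w * (w - 1) * (9 * w - 1)) * B - (1 / w + 1 / (w - 1) + 9 / (9 * w - 1)) * G"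
    proof -
      have "R' / R w = 1 / w + 1 / (w - 1) + 9 / (9 * w - 1)"
        using w1 by (simp add: R'_def R_def divide_simps) algebra
      moreover have "64 * (- 3 / 64 * R w * (3 * w - 1) * b w) / R w ^ 2 = - 3 * (3 * w - 1) / R w * b w"
        using nz by (simp add: power2_eq_square field_simps)
      ultimately show ?thesis unfolding g'_def by (simp add: G_def B_def R_def)
    qed
    have "w \<noteq> - 1 / 3" using w(2) by auto
    hence w3: "3 * w + 1 \<noteq> 0" by (auto simp: field_simps eq_neg_iff_add_eq_0)
    have e: "1 / (w - 1 / 9) = 9 / (9 * w - 1)" "2 / (w + 1 / 3) = 6 / (3 * w + 1)" 
      "2 / (3 * w * (w + 1 / 3)\<^sup>2) = 6 / (w * (3 * w + 1)\<^sup>2)"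
    proof -
      have 1: "w - 1 / 9 = (9 * w - 1) / 9" "w + 1 / 3 = (3 * w + 1) / 3" by (simp_all add: field_simps)
      show "1 / (w - 1 / 9) = 9 / (9 * w - 1)" "2 / (w + 1 / 3) = 6 / (3 * w + 1)" 
        "2 / (3 * w * (w + 1 / 3)\<^sup>2) = 6 / (w * (3 * w + 1)\<^sup>2)" 
        unfolding 1 by (simp_all add: power_divide)
    qed
    show ?thesis
      unfolding d2 d1 m_eq[OF w(1)] g'2 e G_def [symmetric] B_def [symmetric]
      using w1 w3 by (simp add: divide_simps) algebra
  qed
  show ?thesis using holo ode by blast
qed

end
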